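(* Let $A\in\mathbb{R}^{m\times n}$, $\boldsymbol c\in\mathbb{R}^n$ with $\lVert\boldsymbol c\rVert=1$, and consider $(\mathrm P)$: $\max\{\boldsymbol c^T\boldsymbol x:A\boldsymbol x\le\mathbf 1\}$. Let $B\ge1$ be a (finite) integer, assume exact arithmetic and deterministic tie-breaking in all Wolfe calls, and require global Wolfe verification before accepting a projection of any target $\boldsymbol y_k\notin\mathcal Q$. Then CR-P-LPN with reuse limit $B$ terminates with the same solution status for $(\mathrm P)$ (optimal or unbounded) and generates the same outer-target sequence $(\boldsymbol y_k)$ as P-LPN, both methods being started from the same initial radius $\rho_0$. If $N_{\rm P}$ and $N_{\rm CR}$ denote the numbers of completed outer iterations of P-LPN and CR-P-LPN, then $$N_{\rm CR}=N_{\rm P}\le K(m+1,n):=1+\sum_{j=1}^{\min\{n+1,m+1\}}\binom{m+1}{j}.$$ Moreover, suppose that the generators $\boldsymbol v_0,\dots,\boldsymbol v_m$, a nonzero vector $\boldsymbol\gamma$ with $\boldsymbol c=\boldsymbol\gamma/\lVert\boldsymbol\gamma\rVert$, and a number $t_0$ with $t_0>\max_{0\le i\le m}\boldsymbol\gamma^T\boldsymbol v_i/\lVert\boldsymbol\gamma\rVert^2$ and $\rho_0=t_0\lVert\boldsymbol\gamma\rVert$ are all rational, and let $\mathcal L$ be the total binary encoding length of $\boldsymbol v_0,\dots,\boldsymbol v_m,\boldsymbol\gamma,t_0$. Then this common count is $O(n^2\mathcal L)$.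
   Context: Notation. $\boldsymbol a_i^T$ is row $i$ of $A$; $\boldsymbol v_0:=\boldsymbol 0$, $\boldsymbol v_i:=\boldsymbol a_i$ $(1\le i\le m)$; $\mathcal I:=\{0,\dots,m\}$; $\mathcal Q:=\operatorname{conv}\{\boldsymbol v_0,\dots,\boldsymbol v_m\}$; $V_C$ is the matrix with columns $\boldsymbol v_i$, $i\in C$. $\lVert\cdot\rVert$ is Euclidean. $O(\cdot)$ has a universal constant; binary encoding length is the total number of bits for all coordinates written as fractions in lowest terms (at least one bit per coordinate). Wolfe's algorithm. A corral is a nonempty $C\subseteq\mathcal I$ with affinely independent generators such that the nearest point to the target $\boldsymbol y$ in $\operatorname{aff}\{\boldsymbol v_i:i\in C\}$ is a strictly positive convex combination of them. Starting from an active set with weights, Wolfe alternates major steps (insert, with weight $0$, a generator $j$ violating $(\boldsymbol y-\boldsymbol z)^T(\boldsymbol v_j-\boldsymbol z)\le0$ at the current point $\boldsymbol z$; stop if no generator violates) and minor steps (compute the affine minimizer weights over the active generators; accept if all are positive, otherwise move toward them until a weight first reaches zero, delete zero-weight generators, and repeat). The cold call $\mathrm{Wolfe}(\boldsymbol y;\mathcal I)$ starts from a single generator, inserts a $j\in\mathcal I$ maximizing $(\boldsymbol y-\boldsymbol z)^T\boldsymbol v_j$, and returns $(\boldsymbol z,C,\boldsymbol\lambda_C)$: the Euclidean projection $\boldsymbol z$ of $\boldsymbol y$ onto $\mathcal Q$, the terminal corral and its positive convex weights. Global Wolfe verification of $\boldsymbol z\in\mathcal Q$ for target $\boldsymbol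 y$ is the test $(\boldsymbol y-\boldsymbol z)^T(\boldsymbol v_j-\boldsymbol z)\le0$ for all $j\in\mathcal I$. P-LPN. Choose $\rho_0>\max_{i\in\mathcal I}\boldsymbol c^T\boldsymbol v_i$, $k=0$. At outer iteration $k$: $\boldsymbol y_k:=\rho_k\boldsymbol c$; $(\boldsymbol z_k,C_k,\boldsymbol\lambda^k_{C_k}):=\mathrm{Wolfe}(\boldsymbol y_k;\mathcal I)$. Then the status update is: (a) If $\boldsymbol z_k=\boldsymbol y_k$: if $\rho_k=0$, stop with status unbounded and recession direction $\boldsymbol d_{k-1}/(\boldsymbol c^T\boldsymbol d_{k-1})$; if $\rho_k\neq0$, stop with status optimal and $\boldsymbol x^*:=\boldsymbol d_{k-1}/h_{k-1}$, $u_i^*:=\lambda^k_i/\rho_k$ $(1\le i\le m$, zero outside $C_k)$. (b) Otherwise $\boldsymbol d_k:=\boldsymbol y_k-\boldsymbol z_k$, $h_k:=\boldsymbol d_k^T\boldsymbol z_k$. If $h_k=0$, stop with status unbounded and recession direction $\boldsymbol d_k/(\boldsymbol c^T\boldsymbol d_k)$; else $\rho_{k+1}:=h_k/(\boldsymbol d_k^T\boldsymbol c)$ and continue with $k+1$. (The returned quantities are also tested for the corresponding optimality or recession conditions.) An outer iteration is completed once the accepted projection is available and the method has stopped or chosen the next target; steps inside the projection computation are not counted. Repair$(\boldsymbol y^+;C,\boldsymbol\lambda)$, for a corral $C$ with positive convex weights $\boldsymbol\lambda$: compute $\boldsymbol\lambda^{\rm aff}:=\arg\min_{\mathbf 1^T\boldsymbol\mu=1}\tfrac12\lVert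 V_C\boldsymbol\mu-\boldsymbol y^+\rVert^2$. If all components are positive, return $(C,\boldsymbol\lambda^{\rm aff})$. Otherwise set $\theta:=\min_{i\in C:\lambda_i^{\rm aff}\le0}\lambda_i/(\lambda_i-\lambda_i^{\rm aff})$, replace $\boldsymbol\lambda$ by $(1-\theta)\boldsymbol\lambda+\theta\boldsymbol\lambda^{\rm aff}$, delete all zero-weight generators from $C$, and repeat. CR-P-LPN with reuse limit $B$. Same as P-LPN (same status update), except for how the projection is computed. A flag coldOnly is initially $0$. At iteration $k$, if $k=0$ or $k\ge B$ or coldOnly $=1$, call the cold $\mathrm{Wolfe}(\boldsymbol y_k;\mathcal I)$. Otherwise compute $(\widetilde C_k,\widetilde{\boldsymbol\lambda}_k):=\mathrm{Repair}(\boldsymbol y_k;C_{k-1},\boldsymbol\lambda^{k-1}_{C_{k-1}})$ and run WarmWolfe: Wolfe's algorithm started from $(\widetilde C_k,\widetilde{\boldsymbol\lambda}_k)$, which looks for violating generators first in a candidate set $\mathcal J_k\subseteq\mathcal I$ containing $\widetilde C_k$ and then among all remaining generators; finding a violating generator makes Wolfe continue. It returns $(\boldsymbol z_k,C_k,\boldsymbol\lambda^k_{C_k},\mathrm{ok})$; it returns with $\mathrm{ok}=1$ only if $\boldsymbol z_k=\boldsymbol y_k$ or global Wolfe verification has succeeded, and with $\mathrm{ok}=0$ if a numerical or resource limit stops it before that. If $\mathrm{ok}=0$, set coldOnly $:=1$ and recompute by the cold $\mathrm{Wolfe}(\boldsymbol y_k;\mathcal I)$ before any radius update. *)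

theory Defs
  imports
    Complex_Main
    "HOL-Library.While_Combinator"
    "HOL-Library.Extended_Nat"
    "HOL-Library.Log_Nat"
    "Jordan_Normal_Form.Matrix"
begin

(* Vectors and matrices carry their dimensions explicitly (carrier_vec n, carrier_mat m n), so that
   one constant can be chosen uniformly in m and n. Rows of A are indexed from 0, hence v_i is row
   i - 1. *)

definition vnorm :: "real vec \<Rightarrow> real" where
  "vnorm x = sqrt (x \<bullet> x)"

definition gen :: "'a::zero mat \<Rightarrow> nat \<Rightarrow> 'a vec" where
  "gen A i = (if i = 0 then 0\<^sub>v (dim_col A) else row A (i - 1))"

definition idx :: "real mat \<Rightarrow> nat set" where
  "idx A = {0..dim_row A}"

text \<open>The product of \<open>V\<^sub>C\<close> with a weight vector. Weights are functions on indices, and only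
  their values on \<open>C\<close> matter.\<close>

definition comb :: "real mat \<Rightarrow> nat set \<Rightarrow> (nat \<Rightarrow> real) \<Rightarrow> real vec" where
  "comb A C w = vec (dim_col A) (\<lambda>l. \<Sum>i\<in>C. w i * gen A i $ l)"

definition aff_weights :: "real mat \<Rightarrow> real vec \<Rightarrow> nat set \<Rightarrow> nat \<Rightarrow> real" where
  "aff_weights A y C =
     arg_min (\<lambda>\<mu>. 1/2 * (vnorm (comb A C \<mu> - y))\<^sup>2)
             (\<lambda>\<mu>. (\<Sum>i\<in>C. \<mu> i) = 1 \<and> (\<forall>i. i \<notin> C \<longrightarrow> \<mu> i = 0))"

definition aff_positive :: "real mat \<Rightarrow> real vec \<Rightarrow> nat set \<Rightarrow> bool" where
  "aff_positive A y C \<longleftrightarrow> (\<forall>i\<in>C. aff_weights A y C i > 0)"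

type_synonym active = "nat set \<times> (nat \<Rightarrow> real)"

definition reduce :: "real mat \<Rightarrow> real vec \<Rightarrow> active \<Rightarrow> active" where
  "reduce A y = (\<lambda>(C, w).
     let a = aff_weights A y C;
         \<theta> = Min ((\<lambda>i. w i / (w i - a i)) ` {i\<in>C. a i \<le> 0});
         w' = (\<lambda>i. (1 - \<theta>) * w i + \<theta> * a i)
     in ({i\<in>C. w' i \<noteq> 0}, w'))"

text \<open>\<open>None\<close> stands for non-termination throughout.\<close>

definition repair :: "real mat \<Rightarrow> real vec \<Rightarrow> active \<Rightarrow> active option" where
  "repair A y s =
     map_option (\<lambda>(C, w). (C, aff_weights A y C))
       (while_option (\<lambda>(C, w). \<not> aff_positive A y C) (reduce A y) s)"

definition violators :: "real mat \<Rightarrow> real vec \<Rightarrow> real vec \<Rightarrow> nat set" where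
  "violators A y z = {j \<in> idx A. (y - z) \<bullet> (gen A j - z) > 0}"

definition verified :: "real mat \<Rightarrow> real vec \<Rightarrow> real vec \<Rightarrow> bool" where
  "verified A y z \<longleftrightarrow> (\<forall>j\<in>idx A. (y - z) \<bullet> (gen A j - z) \<le> 0)"

datatype phase = Major | Minor

text \<open>One step of Wolfe's algorithm. The argument \<open>ins\<close> selects the generator to insert, given the
  active set, its weights and the current point. A state whose phase is \<open>Major\<close> has passed the
  positivity test of the minor steps (or is a single generator).\<close>

definition wolfe_step ::
  "real mat \<Rightarrow> real vec \<Rightarrow> (active \<Rightarrow> real vec \<Rightarrow> nat) \<Rightarrow> phase \<times> active \<Rightarrow> phase \<times> active" where
  "wolfe_step A y ins = (\<lambda>(ph, C, w).
     case ph of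
       Major \<Rightarrow> (let j = ins (C, w) (comb A C w) in (Minor, insert j C, w(j := 0)))
     | Minor \<Rightarrow> (if aff_positive A y C then (Major, C, aff_weights A y C)
                 else (Minor, reduce A y (C, w))))"

definition wolfe_done :: "real mat \<Rightarrow> real vec \<Rightarrow> phase \<times> active \<Rightarrow> bool" where
  "wolfe_done A y = (\<lambda>(ph, C, w). ph = Major \<and> verified A y (comb A C w))"

type_synonym projection = "real vec \<times> nat set \<times> (nat \<Rightarrow> real)"

definition wolfe_result :: "real mat \<Rightarrow> phase \<times> active \<Rightarrow> projection" where
  "wolfe_result A = (\<lambda>(ph, C, w). (comb A C w, C, w))"

text \<open>A deterministic choice rule for the cold calls: the starting generator for each target, and
  the element taken from a nonempty set of equally eligible generators.\<close>

record cold_rule =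
  start :: "real vec \<Rightarrow> nat"
  cold_tie :: "real vec \<Rightarrow> active \<Rightarrow> nat set \<Rightarrow> nat"

definition valid_cold_rule :: "real mat \<Rightarrow> cold_rule \<Rightarrow> bool" where
  "valid_cold_rule A R \<longleftrightarrow>
     (\<forall>y. start R y \<in> idx A) \<and> (\<forall>y s S. S \<noteq> {} \<longrightarrow> cold_tie R y s S \<in> S)"

definition cold_insert :: "real mat \<Rightarrow> cold_rule \<Rightarrow> real vec \<Rightarrow> active \<Rightarrow> real vec \<Rightarrow> nat" where
  "cold_insert A R y s z =
     cold_tie R y s {j \<in> idx A. \<forall>i\<in>idx A. (y - z) \<bullet> gen A i \<le> (y - z) \<bullet> gen A j}"

definition cold_wolfe :: "real mat \<Rightarrow> cold_rule \<Rightarrow> real vec \<Rightarrow> projection option" where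
  "cold_wolfe A R y =
     map_option (wolfe_result A)
       (while_option (\<lambda>s. \<not> wolfe_done A y s) (wolfe_step A y (cold_insert A R y))
          (Major, {start R y}, \<lambda>i. if i = start R y then 1 else 0))"

text \<open>\<open>cands k C\<close> is the candidate set of outer iteration \<open>k\<close> when the repaired active set is \<open>C\<close>.
  \<open>step_limit k\<close> is the number of steps after which the warm call of outer iteration \<open>k\<close> is
  abandoned. As all calls are deterministic, any pattern of resource failures on a
  given instance is obtained from some \<open>step_limit\<close>; \<open>\<infinity>\<close> means no limit, and \<open>0\<close> means that
  the call fails at once.\<close>

record warm_rule =
  cands :: "nat \<Rightarrow> nat set \<Rightarrow> nat set"
  warm_tie :: "nat \<Rightarrow> real vec \<Rightarrow> active \<Rightarrow> nat set \<Rightarrow> nat"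
  step_limit :: "nat \<Rightarrow> enat"

definition valid_warm_rule :: "real mat \<Rightarrow> warm_rule \<Rightarrow> bool" where
  "valid_warm_rule A W \<longleftrightarrow>
     (\<forall>k C. C \<subseteq> idx A \<longrightarrow> C \<subseteq> cands W k C \<and> cands W k C \<subseteq> idx A) \<and>
     (\<forall>k y s S. S \<noteq> {} \<longrightarrow> warm_tie W k y s S \<in> S)"

definition warm_insert ::
  "real mat \<Rightarrow> warm_rule \<Rightarrow> nat \<Rightarrow> nat set \<Rightarrow> real vec \<Rightarrow> active \<Rightarrow> real vec \<Rightarrow> nat" where
  "warm_insert A W k J y s z =
     (let S = violators A y z
      in warm_tie W k y s (if S \<inter> J \<noteq> {} then S \<inter> J else S))"

text \<open>The Boolean of the result is the flag \<open>ok\<close>. It requires the final verification to have been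
  reached strictly before the limit. If \<open>z = y\<close>, then verification holds trivially.\<close>

definition warm_wolfe ::
  "real mat \<Rightarrow> warm_rule \<Rightarrow> nat \<Rightarrow> real vec \<Rightarrow> active \<Rightarrow> (projection \<times> bool) option" where
  "warm_wolfe A W k y s0 =
     map_option (\<lambda>(l, s). (wolfe_result A s, wolfe_done A y s \<and> enat l < step_limit W k))
       (while_option (\<lambda>(l, s). \<not> wolfe_done A y s \<and> enat l < step_limit W k)
          (\<lambda>(l, s). (Suc l, wolfe_step A y (warm_insert A W k (cands W k (fst s0)) y) s))
          (0, Major, s0))"

text \<open>\<open>Rejected\<close> is the outcome if the final test of the returned quantities fails.\<close>

datatype lp_result =
  is_Optimal: Optimal "real vec" "real vec" | is_Unbounded: Unbounded "real vec" | Rejected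

definition ones :: "nat \<Rightarrow> real vec" where
  "ones m = vec m (\<lambda>_. 1)"

definition optimality_conditions :: "real mat \<Rightarrow> real vec \<Rightarrow> real vec \<Rightarrow> real vec \<Rightarrow> bool" where
  "optimality_conditions A c x u \<longleftrightarrow>
     A *\<^sub>v x \<le> ones (dim_row A) \<and> 0\<^sub>v (dim_row A) \<le> u \<and> A\<^sup>T *\<^sub>v u = c \<and>
     c \<bullet> x = ones (dim_row A) \<bullet> u"

definition recession_conditions :: "real mat \<Rightarrow> real vec \<Rightarrow> real vec \<Rightarrow> bool" where
  "recession_conditions A c r \<longleftrightarrow> A *\<^sub>v r \<le> 0\<^sub>v (dim_row A) \<and> c \<bullet> r > 0"

definition optimal_result ::
  "real mat \<Rightarrow> real vec \<Rightarrow> real vec \<Rightarrow> real \<Rightarrow> real \<Rightarrow> nat set \<Rightarrow> (nat \<Rightarrow> real) \<Rightarrow> lp_result" where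
  "optimal_result A c d h \<rho> C w =
     (let x = (1 / h) \<cdot>\<^sub>v d;
          u = vec (dim_row A) (\<lambda>i. if Suc i \<in> C then w (Suc i) / \<rho> else 0)
      in if optimality_conditions A c x u then Optimal x u else Rejected)"

definition unbounded_result :: "real mat \<Rightarrow> real vec \<Rightarrow> real vec \<Rightarrow> lp_result" where
  "unbounded_result A c d =
     (let r = (1 / (c \<bullet> d)) \<cdot>\<^sub>v d
      in if recession_conditions A c r then Unbounded r else Rejected)"

text \<open>The state before outer iteration \<open>k\<close> is \<open>Running \<rho>\<^sub>k d\<^sub>k\<^sub>-\<^sub>1 h\<^sub>k\<^sub>-\<^sub>1 mem\<close>, where \<open>mem\<close> is what the
  projection routine remembers. \<open>Hung\<close> means that a projection computation has not terminated.\<close>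

datatype 'mem outer = is_Running: Running real "real vec" real 'mem | Stopped lp_result | Hung

definition status_update ::
  "real mat \<Rightarrow> real vec \<Rightarrow> real \<Rightarrow> real vec \<Rightarrow> real \<Rightarrow> projection \<Rightarrow> 'mem \<Rightarrow> 'mem outer" where
  "status_update A c \<rho> d h = (\<lambda>(z, C, w) mem.
     let y = \<rho> \<cdot>\<^sub>v c in
     if z = y then
       Stopped (if \<rho> = 0 then unbounded_result A c d else optimal_result A c d h \<rho> C w)
     else
       (let d' = y - z; h' = d' \<bullet> z in
        if h' = 0 then Stopped (unbounded_result A c d')
        else Running (h' / (d' \<bullet> c)) d' h' mem))"

text \<open>The states of the outer loop, parametric in the projection routine. The quantities
  \<open>d\<^sub>-\<^sub>1\<close> and \<open>h\<^sub>-\<^sub>1\<close> are arbitrarily set to zero.\<close>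

primrec outer_run ::
  "(nat \<Rightarrow> real vec \<Rightarrow> 'mem \<Rightarrow> (projection \<times> 'mem) option) \<Rightarrow>
   real mat \<Rightarrow> real vec \<Rightarrow> real \<Rightarrow> 'mem \<Rightarrow> nat \<Rightarrow> 'mem outer" where
  "outer_run proj A c \<rho>0 mem0 0 = Running \<rho>0 (0\<^sub>v (dim_col A)) 0 mem0"
| "outer_run proj A c \<rho>0 mem0 (Suc k) =
     (case outer_run proj A c \<rho>0 mem0 k of
        Running \<rho> d h mem \<Rightarrow>
          (case proj k (\<rho> \<cdot>\<^sub>v c) mem of
             None \<Rightarrow> Hung
           | Some (p, mem') \<Rightarrow> status_update A c \<rho> d h p mem')
      | s \<Rightarrow> s)"

text \<open>\<open>y\<^sub>k\<close>, or \<open>None\<close> if the method has already ended.\<close>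

definition target :: "real vec \<Rightarrow> 'mem outer \<Rightarrow> real vec option" where
  "target c s = (case s of Running \<rho> d h mem \<Rightarrow> Some (\<rho> \<cdot>\<^sub>v c) | _ \<Rightarrow> None)"

definition completed :: "(nat \<Rightarrow> 'mem outer) \<Rightarrow> nat set" where
  "completed run = {k. is_Running (run k) \<and> run (Suc k) \<noteq> Hung}"

definition terminates_with :: "(nat \<Rightarrow> 'mem outer) \<Rightarrow> lp_result \<Rightarrow> bool" where
  "terminates_with run r \<longleftrightarrow> (\<exists>N. run N = Stopped r)"

definition p_projection ::
  "real mat \<Rightarrow> cold_rule \<Rightarrow> nat \<Rightarrow> real vec \<Rightarrow> unit \<Rightarrow> (projection \<times> unit) option" where
  "p_projection A R k y mem = map_option (\<lambda>p. (p, ())) (cold_wolfe A R y)"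

definition p_lpn :: "real mat \<Rightarrow> real vec \<Rightarrow> cold_rule \<Rightarrow> real \<Rightarrow> nat \<Rightarrow> unit outer" where
  "p_lpn A c R \<rho>0 = outer_run (p_projection A R) A c \<rho>0 ()"

text \<open>The memory consists of the previous corral with its weights, and of the flag \<open>coldOnly\<close>.\<close>

type_synonym cr_mem = "active \<times> bool"

definition cold_with_mem ::
  "real mat \<Rightarrow> cold_rule \<Rightarrow> real vec \<Rightarrow> bool \<Rightarrow> (projection \<times> cr_mem) option" where
  "cold_with_mem A R y cold_only = map_option (\<lambda>p. (p, snd p, cold_only)) (cold_wolfe A R y)"

definition cr_projection ::
  "real mat \<Rightarrow> cold_rule \<Rightarrow> warm_rule \<Rightarrow> nat \<Rightarrow> nat \<Rightarrow> real vec \<Rightarrow> cr_mem \<Rightarrow>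
   (projection \<times> cr_mem) option" where
  "cr_projection A R W B k y = (\<lambda>(prev, cold_only).
     if k = 0 \<or> k \<ge> B \<or> cold_only then cold_with_mem A R y cold_only
     else (case repair A y prev of
        None \<Rightarrow> None
      | Some s \<Rightarrow>
          (case warm_wolfe A W k y s of
             None \<Rightarrow> None
           | Some (p, ok) \<Rightarrow>
               if ok then Some (p, snd p, cold_only) else cold_with_mem A R y True)))"

definition cr_p_lpn ::
  "real mat \<Rightarrow> real vec \<Rightarrow> cold_rule \<Rightarrow> warm_rule \<Rightarrow> nat \<Rightarrow> real \<Rightarrow> nat \<Rightarrow> cr_mem outer" where
  "cr_p_lpn A c R W B \<rho>0 = outer_run (cr_projection A R W B) A c \<rho>0 (({}, \<lambda>_. 0), False)"

definition same_status :: "lp_result \<Rightarrow> lp_result \<Rightarrow> bool" where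
  "same_status r r' \<longleftrightarrow>
     (is_Optimal r \<and> is_Optimal r') \<or> (is_Unbounded r \<and> is_Unbounded r')"

definition corral_bound :: "nat \<Rightarrow> nat \<Rightarrow> nat" where
  "corral_bound M n = 1 + (\<Sum>j=1..min (n + 1) M. M choose j)"

text \<open>Number of bits of the numerator and the denominator in lowest terms. Since
  \<open>floorlog 2 0 = 0\<close> and the denominator is positive, this is at least one. A sign bit would at
  most double it.\<close>

definition rat_bits :: "rat \<Rightarrow> nat" where
  "rat_bits q = (case quotient_of q of (a, b) \<Rightarrow> floorlog 2 (nat \<bar>a\<bar>) + floorlog 2 (nat b))"

definition vec_bits :: "rat vec \<Rightarrow> nat" where
  "vec_bits x = (\<Sum>l<dim_vec x. rat_bits (x $ l))"

definition encoding_length :: "rat mat \<Rightarrow> rat vec \<Rightarrow> rat \<Rightarrow> nat" where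
  "encoding_length A \<gamma> t = (\<Sum>i\<le>dim_row A. vec_bits (gen A i)) + vec_bits \<gamma> + rat_bits t"

end

(* The outer method is a Newton iteration for the largest rho with rho * c in the polytope Q: the
   residual d of projecting rho * c onto Q is the normal of a supporting hyperplane, and the next
   radius is where that hyperplane cuts the ray. Wolfe's algorithm terminates from every corral,
   because the distance decreases strictly between corrals, and global verification makes the
   result the projection, which is unique. So the way a projection is computed does not influence
   the targets or the kind of stop.

   No corral C occurs at two steps k < l: the hyperplane of step k contains z_l, so
   d_k . d_l <= 0, while the hyperplane of step l contains z_k, so d_k . d_l > 0. Hence the count
   is at most one more than the number of affinely independent index sets.

   For the bit bound, monotonicity of the projection and Cauchy-Schwarz show that the slope
   d_k . gamma shrinks by a factor of 4 in each step. It cannot become too small: after scaling to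
   integral data, either aff C_k misses the ray and the squared residual is at least 1/g for a Gram
   determinant g, or rho_(k+1) has denominator g and the same reasoning applies to step k + 1. *)

theory Submission
  imports Defs "HOL-Analysis.Inner_Product" "Jordan_Normal_Form.Determinant"
begin

text \<open>Why the bit bound looks two steps ahead: unrolling
  \<open>\<rho> (Suc k) = h k / s k\<close> would let denominators grow with \<open>k\<close>, so
  every estimate has to come from a single corral. If the affine hull of \<open>C k\<close> meets
  the line through \<open>c\<close>, the meeting point, hence \<open>\<rho> (Suc k)\<close>, depends
  on the corral alone. But \<open>\<rho> k\<close> may be arbitrarily close to it, so nothing bounds
  \<open>d k\<close> directly; \<open>d (Suc k)\<close> is bounded instead, and the bound is carried
  back because residual norms decrease. If the hull misses the line, its distance from the whole
  line bounds \<open>d k\<close>, whatever \<open>\<rho> k\<close> is. A unit vector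
  \<open>c\<close> is in general irrational even for rational data, so Gram determinants of the data
  as given are not integers. The Newton iteration is therefore stated for a direction of any length
  and used twice: on the given data to count corrals, on rescaled integral data to count bits. The
  second count is linear in \<open>n\<close>, which implies the quadratic claim.\<close>

no_notation inner (infix "\<bullet>" 70)

section \<open>Affine projections in inner product spaces\<close>

definition lincomb_on :: "('i \<Rightarrow> 'a::real_vector) \<Rightarrow> 'i set \<Rightarrow> ('i \<Rightarrow> real) \<Rightarrow> 'a" where
  "lincomb_on v C w = (\<Sum>i\<in>C. w i *\<^sub>R v i)"

text \<open>Independence of the indexed family, not of its set of values: an index set with two
  equal generators is dependent.\<close>

definition affinely_independent :: "('i \<Rightarrow> 'a::real_vector) \<Rightarrow> 'i set \<Rightarrow> bool" where
  "affinely_independent v C \<longleftrightarrow>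
     (\<forall>\<mu>. sum \<mu> C = 0 \<longrightarrow> lincomb_on v C \<mu> = 0 \<longrightarrow> (\<forall>i\<in>C. \<mu> i = 0))"

text \<open>The normal equations in place of minimality. They also make sense for dependent
  families, where the weights are not unique.\<close>

definition affine_projection ::
  "('i \<Rightarrow> 'a::real_inner) \<Rightarrow> 'a \<Rightarrow> 'i set \<Rightarrow> ('i \<Rightarrow> real) \<Rightarrow> bool" where
  "affine_projection v y C \<mu> \<longleftrightarrow>
     sum \<mu> C = 1 \<and> (\<forall>i\<in>C. inner (y - lincomb_on v C \<mu>) (v i - lincomb_on v C \<mu>) = 0)"

lemma lincomb_on_add: "lincomb_on v C (\<lambda>i. a i + b i) = lincomb_on v C a + lincomb_on v C b"
  by (simp add: lincomb_on_def scaleR_left_distrib sum.distrib)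

lemma lincomb_on_diff: "lincomb_on v C (\<lambda>i. a i - b i) = lincomb_on v C a - lincomb_on v C b"
  by (simp add: lincomb_on_def scaleR_left_diff_distrib sum_subtractf)

lemma lincomb_on_scale: "lincomb_on v C (\<lambda>i. t * a i) = t *\<^sub>R lincomb_on v C a"
  by (simp add: lincomb_on_def scaleR_sum_right)

lemma lincomb_on_translate:
  "lincomb_on (\<lambda>i. v i - p) C a = lincomb_on v C a - sum a C *\<^sub>R p"
  by (simp add: lincomb_on_def scaleR_right_diff_distrib sum_subtractf scaleR_sum_left)

lemma lincomb_on_cong:
  "(\<And>i. i \<in> C \<Longrightarrow> a i = b i) \<Longrightarrow> (\<And>i. i \<in> C \<Longrightarrow> v i = w i) \<Longrightarrow> lincomb_on v C a = lincomb_on w C b"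
  by (simp add: lincomb_on_def)

lemma lincomb_on_mono_neutral:
  "finite C \<Longrightarrow> D \<subseteq> C \<Longrightarrow> (\<And>i. i \<in> C - D \<Longrightarrow> w i = 0) \<Longrightarrow> lincomb_on v C w = lincomb_on v D w"
  unfolding lincomb_on_def by (rule sum.mono_neutral_right) auto

lemma inner_lincomb_on: "inner x (lincomb_on v C w) = (\<Sum>i\<in>C. w i * inner x (v i))"
  by (simp add: lincomb_on_def inner_sum_right)

lemma inner_lincomb_on_const:
  assumes "\<And>i. i \<in> C \<Longrightarrow> inner x (v i) = h" "sum w C = 1"
  shows "inner x (lincomb_on v C w) = h"
proof -
  have "inner x (lincomb_on v C w) = (\<Sum>i\<in>C. w i * h)"
    using assms(1) by (simp add: inner_lincomb_on)
  also have "\<dots> = h" using assms(2) by (simp flip: sum_distrib_right)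
  finally show ?thesis .
qed

lemma inner_lincomb_on_le:
  assumes "\<And>i. i \<in> C \<Longrightarrow> inner x (v i) \<le> h" "\<And>i. i \<in> C \<Longrightarrow> 0 \<le> w i" "sum w C = 1"
  shows "inner x (lincomb_on v C w) \<le> h"
proof -
  have "inner x (lincomb_on v C w) \<le> (\<Sum>i\<in>C. w i * h)"
    unfolding inner_lincomb_on by (intro sum_mono mult_left_mono) (use assms in auto)
  also have "\<dots> = h" using assms(3) by (simp flip: sum_distrib_right)
  finally show ?thesis .
qed

lemma affinely_independent_subset:
  assumes "affinely_independent v C" "D \<subseteq> C" "finite C"
  shows "affinely_independent v D"
  unfolding affinely_independent_def
proof (intro allI impI)
  fix \<mu> assume *: "sum \<mu> D = 0" "lincomb_on v D \<mu> = 0"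
  let ?\<nu> = "\<lambda>i. if i \<in> D then \<mu> i else 0"
  have "sum ?\<nu> C = 0"
    using * assms by (simp add: sum.inter_restrict[symmetric] Int_absorb1)
  moreover have "lincomb_on v C ?\<nu> = 0"
  proof -
    have "lincomb_on v C ?\<nu> = lincomb_on v D ?\<nu>"
      using assms by (intro lincomb_on_mono_neutral) auto
    also have "\<dots> = lincomb_on v D \<mu>" by (rule lincomb_on_cong) auto
    finally show ?thesis using * by simp
  qed
  ultimately have "\<forall>i\<in>C. ?\<nu> i = 0" using assms(1) unfolding affinely_independent_def by blast
  then show "\<forall>i\<in>D. \<mu> i = 0" using assms(2) by (metis subsetD)
qed

lemma affinely_independent_singleton: "affinely_independent v {i}"
  by (simp add: affinely_independent_def)

text \<open>A Gram-Schmidt step: the part \<open>r\<close> of the new vector that is orthogonal to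
  the old ones corrects the old projection of \<open>y\<close>. No completeness of the space
  enters.\<close>

lemma linear_projection_exists:
  fixes v :: "'i \<Rightarrow> 'a::real_inner"
  assumes "finite C"
  shows "\<exists>\<mu>. \<forall>i\<in>C. inner (y - lincomb_on v C \<mu>) (v i) = 0"
  using assms
proof (induction C arbitrary: y)
  case empty
  then show ?case by simp
next
  case (insert j C)
  obtain \<alpha> where \<alpha>: "\<And>i. i \<in> C \<Longrightarrow> inner (v j - lincomb_on v C \<alpha>) (v i) = 0"
    using insert.IH by blast
  obtain \<beta> where \<beta>: "\<And>i. i \<in> C \<Longrightarrow> inner (y - lincomb_on v C \<beta>) (v i) = 0"
    using insert.IH by blast
  define r where "r = v j - lincomb_on v C \<alpha>"
  \<comment> \<open>If the new vector lies in the old span, then \<open>r = 0\<close>, and division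
    by zero gives \<open>t = 0\<close>: the old projection is kept.\<close>
  define t where "t = inner y r / inner r r"
  define \<mu> where "\<mu> = (\<lambda>i. if i = j then t else \<beta> i - t * \<alpha> i)"
  have r: "inner r (lincomb_on v C w) = 0" for w
    using \<alpha> by (simp add: inner_lincomb_on r_def)
  have "lincomb_on v (insert j C) \<mu> = t *\<^sub>R v j + lincomb_on v C \<mu>"
    using insert.hyps by (simp add: lincomb_on_def \<mu>_def)
  also have "lincomb_on v C \<mu> = lincomb_on v C (\<lambda>i. \<beta> i - t * \<alpha> i)"
    using insert.hyps by (intro lincomb_on_cong) (auto simp: \<mu>_def)
  finally have eq: "y - lincomb_on v (insert j C) \<mu> = (y - lincomb_on v C \<beta>) - t *\<^sub>R r"
    by (simp add: lincomb_on_diff lincomb_on_scale r_def algebra_simps)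
  have 1: "inner (y - lincomb_on v (insert j C) \<mu>) (v i) = 0" if "i \<in> C" for i
    unfolding eq using that \<alpha> \<beta> by (simp add: inner_diff_left r_def)
  have "inner (y - lincomb_on v (insert j C) \<mu>) r = inner y r - t * inner r r"
    unfolding eq using r by (simp add: inner_diff_left inner_diff_right inner_commute)
  also have "\<dots> = 0" by (cases "r = 0") (simp_all add: t_def)
  finally have "inner (y - lincomb_on v (insert j C) \<mu>) r = 0" .
  moreover have "inner (y - lincomb_on v (insert j C) \<mu>) (lincomb_on v C \<alpha>) = 0"
    using 1 by (simp add: inner_lincomb_on)
  ultimately have "inner (y - lincomb_on v (insert j C) \<mu>) (v j) = 0"
    by (simp add: r_def inner_diff_right)
  with 1 show ?case by (intro exI[of _ \<mu>]) auto
qed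

text \<open>Translation by a base point \<open>v k\<close> makes the problem linear. As
  \<open>u k = 0\<close>, the weight of \<open>k\<close> is free and is spent on making the sum 1.
  Vanishing outside \<open>C\<close> matches the normalization in
  \<open>aff_weights\<close>.\<close>

lemma affine_projection_exists:
  fixes v :: "'i \<Rightarrow> 'a::real_inner"
  assumes "finite C" "C \<noteq> {}"
  shows "\<exists>\<mu>. affine_projection v y C \<mu> \<and> (\<forall>i. i \<notin> C \<longrightarrow> \<mu> i = 0)"
proof -
  obtain k where k: "k \<in> C" using assms by blast
  define u where "u = (\<lambda>i. v i - v k)"
  obtain \<mu> where \<mu>: "\<And>i. i \<in> C \<Longrightarrow> inner (y - v k - lincomb_on u C \<mu>) (u i) = 0"
    using linear_projection_exists[OF assms(1)] by blast
  define \<nu> where "\<nu> = (\<lambda>i. if i \<notin> C then 0 else if i = k then 1 - sum \<mu> (C - {k}) else \<mu> i)"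
  have s: "sum \<nu> C = 1"
  proof -
    have "sum \<nu> C = \<nu> k + sum \<nu> (C - {k})" using assms k by (simp add: sum.remove)
    also have "sum \<nu> (C - {k}) = sum \<mu> (C - {k})" by (rule sum.cong) (auto simp: \<nu>_def)
    finally show ?thesis using k by (simp add: \<nu>_def)
  qed
  have "lincomb_on u C \<nu> = lincomb_on u C \<mu>"
    unfolding lincomb_on_def by (rule sum.cong) (auto simp: \<nu>_def u_def)
  then have eq: "lincomb_on v C \<nu> = v k + lincomb_on u C \<mu>"
    using s by (simp add: u_def lincomb_on_translate algebra_simps)
  define r where "r = y - lincomb_on v C \<nu>"
  have r: "inner r (u i) = 0" if "i \<in> C" for i
    using \<mu>[OF that] by (simp add: r_def eq diff_diff_eq)
  have "inner r (v i - lincomb_on v C \<nu>) = 0" if "i \<in> C" for i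
  proof -
    have "v i - lincomb_on v C \<nu> = u i - lincomb_on u C \<mu>" by (simp add: eq u_def)
    then show ?thesis using r that by (simp add: inner_diff_right inner_lincomb_on)
  qed
  then have "affine_projection v y C \<nu>"
    using s by (simp add: affine_projection_def r_def)
  moreover have "\<forall>i. i \<notin> C \<longrightarrow> \<nu> i = 0" by (simp add: \<nu>_def)
  ultimately show ?thesis by blast
qed

lemma affine_projection_inner:
  assumes "affine_projection v y C \<mu>" "i \<in> C"
  shows "inner (y - lincomb_on v C \<mu>) (v i)
    = inner (y - lincomb_on v C \<mu>) (lincomb_on v C \<mu>)"
  using assms by (simp add: affine_projection_def inner_diff_right)

text \<open>The residual has constant inner product with the affine hull, so it is orthogonal to
  \<open>q - p\<close>. The identity serves for minimality, for uniqueness of the nearest point and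
  for the exact decrease in a minor step.\<close>

lemma affine_projection_pythagoras:
  assumes "affine_projection v y C \<mu>" "sum \<nu> C = 1"
  defines "p \<equiv> lincomb_on v C \<mu>" and "q \<equiv> lincomb_on v C \<nu>"
  shows "inner (y - q) (y - q) = inner (y - p) (y - p) + inner (q - p) (q - p)"
proof -
  have "inner (y - p) q = inner (y - p) p"
    unfolding q_def using affine_projection_inner[OF assms(1)] assms(2)
    by (intro inner_lincomb_on_const) (simp_all add: p_def)
  then show ?thesis by (simp add: inner_diff_left inner_diff_right inner_commute algebra_simps)
qed

section \<open>Finitely supported sequences\<close>

text \<open>A single inner product space that contains \<open>\<real>\<^sup>n\<close> for every \<open>n\<close>, so that the library of
  type-class inner products becomes available for vectors whose dimension is a term.\<close>

typedef fseq = "{f :: nat \<Rightarrow> real. finite {i. f i \<noteq> 0}}"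
  morphisms coord Abs_fseq
  by (rule exI[of _ "\<lambda>_. 0"]) simp

setup_lifting type_definition_fseq

lemma finite_coord: "finite {i. coord x i \<noteq> 0}"
  using coord[of x] by simp

instantiation fseq :: real_vector
begin

lift_definition zero_fseq :: fseq is "\<lambda>_. 0" by simp
lift_definition plus_fseq :: "fseq \<Rightarrow> fseq \<Rightarrow> fseq" is "\<lambda>f g i. f i + g i"
  subgoal for f g by (rule finite_subset[of _ "{i. f i \<noteq> 0} \<union> {i. g i \<noteq> 0}"]) auto
  done
lift_definition uminus_fseq :: "fseq \<Rightarrow> fseq" is "\<lambda>f i. - f i" by simp
lift_definition minus_fseq :: "fseq \<Rightarrow> fseq \<Rightarrow> fseq" is "\<lambda>f g i. f i - g i"
  subgoal for f g by (rule finite_subset[of _ "{i. f i \<noteq> 0} \<union> {i. g i \<noteq> 0}"]) auto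
  done
lift_definition scaleR_fseq :: "real \<Rightarrow> fseq \<Rightarrow> fseq" is "\<lambda>a f i. a * f i"
  by (rule finite_subset) auto

instance
  by standard (transfer; simp add: fun_eq_iff algebra_simps)+

end

instantiation fseq :: real_inner
begin

definition inner_fseq :: "fseq \<Rightarrow> fseq \<Rightarrow> real" where
  "inner_fseq x y = (\<Sum>i | coord x i \<noteq> 0. coord x i * coord y i)"
definition norm_fseq :: "fseq \<Rightarrow> real" where
  "norm_fseq x = sqrt (inner x x)"
definition dist_fseq :: "fseq \<Rightarrow> fseq \<Rightarrow> real" where
  "dist_fseq x y = norm (x - y)"
definition sgn_fseq :: "fseq \<Rightarrow> fseq" where
  "sgn_fseq x = x /\<^sub>R norm x"
definition uniformity_fseq :: "(fseq \<times> fseq) filter" where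
  "uniformity_fseq = (INF e\<in>{0 <..}. principal {(x, y). dist x y < e})"
definition open_fseq :: "fseq set \<Rightarrow> bool" where
  "open_fseq U = (\<forall>x\<in>U. eventually (\<lambda>(x', y). x' = x \<longrightarrow> y \<in> U) uniformity)"

text \<open>The defining sum runs over the support of the first argument only. Passing to a common
  finite index set makes symmetry and additivity visible.\<close>

lemma inner_fseq_superset:
  assumes "finite S" "{i. coord x i \<noteq> 0} \<subseteq> S"
  shows "inner x y = (\<Sum>i\<in>S. coord x i * coord y i)"
  unfolding inner_fseq_def using assms by (intro sum.mono_neutral_left) auto

instance
proof
  fix x y z :: fseq and r :: real
  have fin: "finite {i. coord x i \<noteq> 0}" for x by (rule finite_coord)
  show "inner x y = inner y x"
    using fin[of x] fin[of y]
    by (simp add: inner_fseq_superset[of "{i. coord x i \<noteq> 0} \<union> {i. coord y i \<noteq> 0}"] mult.commute)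
  show "inner (x + y) z = inner x z + inner y z"
  proof -
    let ?S = "{i. coord x i \<noteq> 0} \<union> {i. coord y i \<noteq> 0}"
    have "{i. coord (x + y) i \<noteq> 0} \<subseteq> ?S" by (auto simp: plus_fseq.rep_eq)
    then show ?thesis using fin[of x] fin[of y]
      by (simp add: inner_fseq_superset[of ?S] plus_fseq.rep_eq distrib_right sum.distrib)
  qed
  show "inner (r *\<^sub>R x) y = r * inner x y"
  proof -
    let ?S = "{i. coord x i \<noteq> 0}"
    have "{i. coord (r *\<^sub>R x) i \<noteq> 0} \<subseteq> ?S" by (auto simp: scaleR_fseq.rep_eq)
    then show ?thesis using fin[of x]
      by (simp add: inner_fseq_superset[of ?S] scaleR_fseq.rep_eq sum_distrib_left mult.assoc)
  qed
  show "0 \<le> inner x x" by (simp add: inner_fseq_def sum_nonneg)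
  show "inner x x = 0 \<longleftrightarrow> x = 0"
  proof -
    have "inner x x = 0 \<longleftrightarrow> (\<forall>i. coord x i = 0)"
      unfolding inner_fseq_def using fin[of x] by (subst sum_nonneg_eq_0_iff) auto
    also have "\<dots> \<longleftrightarrow> x = 0" by (simp add: coord_inject[symmetric] zero_fseq.rep_eq fun_eq_iff)
    finally show ?thesis .
  qed
qed (fact norm_fseq_def dist_fseq_def sgn_fseq_def uniformity_fseq_def open_fseq_def)+

end

section \<open>Isometric embedding of coordinate vectors\<close>

definition fseq_of_vec :: "real vec \<Rightarrow> fseq" where
  "fseq_of_vec x = Abs_fseq (\<lambda>i. if i < dim_vec x then x $ i else 0)"

lemma coord_fseq_of_vec: "coord (fseq_of_vec x) i = (if i < dim_vec x then x $ i else 0)"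
proof -
  have "finite {i. (if i < dim_vec x then x $ i else 0) \<noteq> 0}"
    by (rule finite_subset[of _ "{..<dim_vec x}"]) (auto split: if_splits)
  then show ?thesis by (simp add: fseq_of_vec_def Abs_fseq_inverse)
qed

lemma coord_sum: "coord (sum f S) l = (\<Sum>i\<in>S. coord (f i) l)"
  by (induction S rule: infinite_finite_induct) (simp_all add: zero_fseq.rep_eq plus_fseq.rep_eq)

lemma inner_fseq_of_vec:
  assumes "x \<in> carrier_vec n" "y \<in> carrier_vec n"
  shows "inner (fseq_of_vec x) (fseq_of_vec y) = x \<bullet> y"
proof -
  have "inner (fseq_of_vec x) (fseq_of_vec y)
      = (\<Sum>i\<in>{0..<n}. coord (fseq_of_vec x) i * coord (fseq_of_vec y) i)"
    using assms by (intro inner_fseq_superset) (auto simp: coord_fseq_of_vec split: if_splits)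
  also have "\<dots> = x \<bullet> y"
    using assms by (simp add: coord_fseq_of_vec scalar_prod_def)
  finally show ?thesis .
qed

lemma fseq_of_vec_inject:
  assumes "x \<in> carrier_vec n" "y \<in> carrier_vec n"
  shows "fseq_of_vec x = fseq_of_vec y \<longleftrightarrow> x = y"
proof
  assume *: "fseq_of_vec x = fseq_of_vec y"
  show "x = y"
  proof (rule eq_vecI)
    show "dim_vec x = dim_vec y" using assms by simp
    fix i assume "i < dim_vec y"
    then show "x $ i = y $ i"
      using arg_cong[OF *, of "\<lambda>z. coord z i"] assms by (simp add: coord_fseq_of_vec)
  qed
qed simp

lemma fseq_of_vec_diff:
  assumes "x \<in> carrier_vec n" "y \<in> carrier_vec n"
  shows "fseq_of_vec (x - y) = fseq_of_vec x - fseq_of_vec y"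
  using assms by (auto simp: coord_inject[symmetric] fun_eq_iff coord_fseq_of_vec minus_fseq.rep_eq)

lemma fseq_of_vec_smult: "fseq_of_vec (a \<cdot>\<^sub>v x) = a *\<^sub>R fseq_of_vec x"
  by (auto simp: coord_inject[symmetric] fun_eq_iff coord_fseq_of_vec scaleR_fseq.rep_eq)

lemma fseq_of_vec_zero: "fseq_of_vec (0\<^sub>v n) = 0"
  by (auto simp: coord_inject[symmetric] fun_eq_iff coord_fseq_of_vec zero_fseq.rep_eq)

section \<open>Size of affinely independent sets\<close>

text \<open>Gaussian elimination: a homogeneous system with more unknowns than equations. Equation
  \<open>N\<close> is solved for the unknown of a pivot \<open>p\<close>, and substitution leaves
  \<open>N\<close> equations in one unknown less.\<close>

lemma nontrivial_relation_exists:
  fixes a :: "'i \<Rightarrow> nat \<Rightarrow> real"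
  assumes "finite C" "N < card C"
  shows "\<exists>\<mu>. (\<exists>i\<in>C. \<mu> i \<noteq> 0) \<and> (\<forall>l<N. (\<Sum>i\<in>C. \<mu> i * a i l) = 0)"
  using assms
proof (induction N arbitrary: C a)
  case 0
  then show ?case by (intro exI[of _ "\<lambda>_. 1"]) (auto simp: card_gt_0_iff)
next
  case (Suc N)
  show ?case
  proof (cases "\<forall>i\<in>C. a i N = 0")
    case True
    then show ?thesis
      using Suc.IH[of C a] Suc.prems by (auto simp: less_Suc_eq)
  next
    case False
    then obtain p where p: "p \<in> C" "a p N \<noteq> 0" by blast
    define D where "D = C - {p}"
    have D: "finite D" "N < card D" "p \<notin> D" "C = insert p D"
      using Suc.prems p by (auto simp: D_def)
    obtain \<mu> where \<mu>: "\<exists>i\<in>D. \<mu> i \<noteq> 0"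
      "\<And>l. l < N \<Longrightarrow> (\<Sum>i\<in>D. \<mu> i * (a i l - a i N / a p N * a p l)) = 0"
      using Suc.IH[OF D(1,2), of "\<lambda>i l. a i l - a i N / a p N * a p l"] by blast
    define q where "q = (\<Sum>i\<in>D. \<mu> i * (a i N / a p N))"
    define \<nu> where "\<nu> = \<mu>(p := - q)"
    have split: "(\<Sum>i\<in>C. \<nu> i * a i l) = - q * a p l + (\<Sum>i\<in>D. \<mu> i * a i l)" for l
      using D by (simp add: \<nu>_def) (rule sum.cong, auto)
    have "(\<Sum>i\<in>C. \<nu> i * a i l) = 0" if "l < Suc N" for l
    proof (cases "l = N")
      case True
      have "q * a p N = (\<Sum>i\<in>D. \<mu> i * a i N)"
        unfolding q_def sum_distrib_right using p by (intro sum.cong) auto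
      then show ?thesis using split True by simp
    next
      case False
      then have "0 = (\<Sum>i\<in>D. \<mu> i * (a i l - a i N / a p N * a p l))" using \<mu>(2)[of l] that by simp
      also have "\<dots> = (\<Sum>i\<in>D. \<mu> i * a i l) - q * a p l"
        unfolding q_def sum_distrib_right by (simp add: right_diff_distrib sum_subtractf mult.assoc)
      finally show ?thesis using split by simp
    qed
    moreover have "\<exists>i\<in>C. \<nu> i \<noteq> 0" using \<mu>(1) D by (auto simp: \<nu>_def)
    ultimately show ?thesis by blast
  qed
qed

text \<open>Appending a coordinate 1 to each vector turns affine relations into linear ones:
  equation \<open>n\<close> says that the weights sum to 0.\<close>

lemma affinely_independent_card_le:
  assumes "affinely_independent (\<lambda>i. fseq_of_vec (g i)) C" "finite C"
    and "\<And>i. i \<in> C \<Longrightarrow> g i \<in> carrier_vec n"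
  shows "card C \<le> n + 1"
proof (rule ccontr)
  assume "\<not> card C \<le> n + 1"
  then obtain \<mu> where \<mu>: "\<exists>i\<in>C. \<mu> i \<noteq> 0"
    "\<And>l. l < n + 1 \<Longrightarrow> (\<Sum>i\<in>C. \<mu> i * (if l < n then g i $ l else 1)) = 0"
    using nontrivial_relation_exists[OF assms(2), of "n + 1" "\<lambda>i l. if l < n then g i $ l else 1"]
    by auto
  have "coord (lincomb_on (\<lambda>i. fseq_of_vec (g i)) C \<mu>) l = 0" for l
  proof -
    have "coord (lincomb_on (\<lambda>i. fseq_of_vec (g i)) C \<mu>) l
        = (\<Sum>i\<in>C. \<mu> i * (if l < n then g i $ l else 0))"
      unfolding lincomb_on_def coord_sum using carrier_vecD[OF assms(3)]
      by (intro sum.cong) (simp_all add: scaleR_fseq.rep_eq coord_fseq_of_vec)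
    then show ?thesis using \<mu>(2)[of l] by (cases "l < n") simp_all
  qed
  then have "lincomb_on (\<lambda>i. fseq_of_vec (g i)) C \<mu> = 0"
    by (simp add: coord_inject[symmetric] zero_fseq.rep_eq fun_eq_iff)
  moreover have "sum \<mu> C = 0" using \<mu>(2)[of n] by simp
  ultimately show False using assms(1) \<mu>(1) unfolding affinely_independent_def by blast
qed

section \<open>The Newton iteration on the radius\<close>

text \<open>The trace of the outer iterations before \<open>K\<close>, detached from any algorithm.
  \<open>face\<close> comes from the affine projection onto the corral, \<open>support\<close> from
  global verification. \<open>c\<close> may have any length, so that the rescaled integral data are
  also an instance.\<close>

locale radius_newton =
  fixes v :: "'i \<Rightarrow> 'a::real_inner" and I :: "'i set" and c :: 'a
    and \<rho> :: "nat \<Rightarrow> real" and C :: "nat \<Rightarrow> 'i set" and w :: "nat \<Rightarrow> 'i \<Rightarrow> real" and K :: nat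
  fixes z d h s
  defines "z \<equiv> \<lambda>k. lincomb_on v (C k) (w k)"
    and "d \<equiv> \<lambda>k. \<rho> k *\<^sub>R c - z k"
    and "h \<equiv> \<lambda>k. inner (d k) (z k)"
    and "s \<equiv> \<lambda>k. inner (d k) c"
  assumes subset: "k < K \<Longrightarrow> C k \<subseteq> I"
    and weight_pos: "k < K \<Longrightarrow> i \<in> C k \<Longrightarrow> 0 < w k i"
    and weight_sum: "k < K \<Longrightarrow> sum (w k) (C k) = 1"
    and face: "k < K \<Longrightarrow> i \<in> C k \<Longrightarrow> inner (d k) (v i) = h k"
    and support: "k < K \<Longrightarrow> i \<in> I \<Longrightarrow> inner (d k) (v i) \<le> h k"
    and residual_nonzero: "k < K \<Longrightarrow> d k \<noteq> 0"
    and radius_pos: "k < K \<Longrightarrow> 0 < \<rho> k"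
    and height_nonneg: "k < K \<Longrightarrow> 0 \<le> h k"
    and radius_Suc: "Suc k < K \<Longrightarrow> \<rho> (Suc k) = h k / s k"
begin

lemma residual_eq: "d k = \<rho> k *\<^sub>R c - z k"
  by (simp add: d_def)

lemma residual_square: "inner (d k) (d k) = \<rho> k * s k - h k"
  unfolding s_def h_def by (simp add: residual_eq inner_diff_right)

lemma residual_square_pos: "k < K \<Longrightarrow> 0 < inner (d k) (d k)"
  using residual_nonzero by simp

lemma slope_pos:
  assumes "k < K" shows "0 < s k"
proof -
  have "0 < \<rho> k * s k"
    using residual_square[of k] residual_square_pos[OF assms] height_nonneg[OF assms] by simp
  then show ?thesis using radius_pos[OF assms] by (simp add: zero_less_mult_iff)
qed

lemma inner_residual_point_le: "k < K \<Longrightarrow> l < K \<Longrightarrow> inner (d l) (z k) \<le> h l"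
  unfolding z_def
  by (intro inner_lincomb_on_le support weight_sum less_imp_le weight_pos) (use subset in auto)

lemma radius_step:
  assumes "Suc k < K"
  shows "(\<rho> k - \<rho> (Suc k)) * s k = inner (d k) (d k)"
  using slope_pos[of k] radius_Suc[OF assms] assms residual_square[of k]
  by (simp add: left_diff_distrib)

lemma radius_Suc_less:
  assumes "Suc k < K" shows "\<rho> (Suc k) < \<rho> k"
proof -
  have "0 < (\<rho> k - \<rho> (Suc k)) * s k"
    using radius_step[OF assms] residual_square_pos[of k] assms by simp
  then show ?thesis using slope_pos[of k] assms by (simp add: zero_less_mult_iff)
qed

lemma radius_strict_antimono:
  assumes "k < l" "l < K" shows "\<rho> l < \<rho> k"
  using assms
proof (induction l)
  case (Suc l)
  show ?case
  proof (cases "k = l")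
    case True
    then show ?thesis using radius_Suc_less Suc.prems by simp
  next
    case False
    then have "\<rho> l < \<rho> k" using Suc by simp
    then show ?thesis using radius_Suc_less[of l] Suc.prems by simp
  qed
qed simp

lemma radius_le_initial: "k < K \<Longrightarrow> \<rho> k \<le> \<rho> 0"
  using radius_strict_antimono[of 0 k] by (cases "k = 0") auto

text \<open>Monotonicity of the projection in quantitative form: the hyperplane of step
  \<open>Suc k\<close> supports the polytope, and \<open>z k\<close> lies on the side of the
  polytope.\<close>

lemma residual_cross:
  assumes "Suc k < K"
  shows "inner (d (Suc k)) (d k)
    \<ge> (\<rho> k - \<rho> (Suc k)) * s (Suc k) + inner (d (Suc k)) (d (Suc k))"
proof -
  have "inner (d (Suc k)) (d k) = \<rho> k * s (Suc k) - inner (d (Suc k)) (z k)"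
    unfolding s_def by (simp add: residual_eq inner_diff_right)
  also have "\<dots> \<ge> \<rho> k * s (Suc k) - h (Suc k)"
    using inner_residual_point_le[of k "Suc k"] assms by simp
  finally show ?thesis using residual_square[of "Suc k"] by (simp add: algebra_simps)
qed

text \<open>With \<open>q\<close> and \<open>r\<close> the ratios of consecutive residual norms and slopes, this says
  \<open>r + q\<^sup>2 \<le> q\<close>, hence \<open>r \<le> q (1 - q) \<le> 1/4\<close> and \<open>q < 1\<close>.\<close>

lemma slope_residual_decrease:
  assumes "Suc k < K"
  shows "s (Suc k) * (norm (d k))\<^sup>2 + s k * (norm (d (Suc k)))\<^sup>2
    \<le> s k * (norm (d k) * norm (d (Suc k)))"
proof -
  have sk: "0 < s k" using slope_pos assms by simp
  have "(\<rho> k - \<rho> (Suc k)) * s (Suc k) + (norm (d (Suc k)))\<^sup>2 \<le> norm (d k) * norm (d (Suc k))"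
    using residual_cross[OF assms] norm_cauchy_schwarz[of "d (Suc k)" "d k"]
    by (simp add: power2_norm_eq_inner mult.commute)
  from mult_left_mono[OF this, of "s k"] sk
  have "((\<rho> k - \<rho> (Suc k)) * s k) * s (Suc k) + s k * (norm (d (Suc k)))\<^sup>2
      \<le> s k * (norm (d k) * norm (d (Suc k)))"
    by (simp add: algebra_simps)
  then show ?thesis
    unfolding radius_step[OF assms] by (simp add: power2_norm_eq_inner mult.commute)
qed

lemma residual_norm_Suc_less:
  assumes "Suc k < K" shows "norm (d (Suc k)) < norm (d k)"
proof -
  have pos: "0 < s k" "0 < s (Suc k)" "0 < norm (d k)" "0 < norm (d (Suc k))"
    using slope_pos residual_nonzero assms by auto
  then have "0 < s (Suc k) * (norm (d k))\<^sup>2" by simp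
  then have "s k * norm (d (Suc k)) * norm (d (Suc k)) < s k * norm (d (Suc k)) * norm (d k)"
    using slope_residual_decrease[OF assms] by (simp add: power2_eq_square algebra_simps)
  then show ?thesis using pos by simp
qed

lemma slope_Suc_le:
  assumes "Suc k < K" shows "4 * s (Suc k) \<le> s k"
proof -
  have pos: "0 < s k" "0 < norm (d k)"
    using slope_pos residual_nonzero assms by auto
  have "0 \<le> (norm (d k) / 2 - norm (d (Suc k)))\<^sup>2" by simp
  then have "norm (d k) * norm (d (Suc k)) \<le> (norm (d k))\<^sup>2 / 4 + (norm (d (Suc k)))\<^sup>2"
    by (simp add: power2_eq_square algebra_simps)
  from mult_left_mono[OF this, of "s k"] pos
  have "s k * (norm (d k) * norm (d (Suc k)))
      \<le> s k * ((norm (d k))\<^sup>2 / 4) + s k * (norm (d (Suc k)))\<^sup>2"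
    by (simp add: algebra_simps)
  then have "(4 * s (Suc k)) * (norm (d k))\<^sup>2 \<le> s k * (norm (d k))\<^sup>2"
    using slope_residual_decrease[OF assms] by (simp add: algebra_simps)
  then show ?thesis using pos by simp
qed

lemma slope_le_initial: "k < K \<Longrightarrow> 4 ^ k * s k \<le> s 0"
proof (induction k)
  case (Suc k)
  have "4 ^ Suc k * s (Suc k) = 4 ^ k * (4 * s (Suc k))" by simp
  also have "\<dots> \<le> 4 ^ k * s k" using slope_Suc_le[OF Suc.prems] by (intro mult_left_mono) auto
  finally have "4 ^ Suc k * s (Suc k) \<le> 4 ^ k * s k" .
  also have "\<dots> \<le> s 0" using Suc by simp
  finally show ?case .
qed simp

text \<open>If \<open>k < l\<close> had the same corral, then \<open>d k \<bullet> d l \<le> 0\<close>, since the hyperplane of step \<open>k\<close>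
  contains \<open>z l\<close> and cuts the ray beyond \<open>\<rho> l\<close>; but the hyperplane of step \<open>l\<close> contains \<open>z k\<close>,
  which makes the same product positive.\<close>

lemma corral_inj: "inj_on C {..<K}"
proof (rule linorder_inj_onI')
  fix k l assume "k \<in> {..<K}" "l \<in> {..<K}" "k < l"
  then have kl: "k < l" "k < K" "l < K" by auto
  show "C k \<noteq> C l"
  proof
    assume eq: "C k = C l"
    have zl: "inner (d k) (z l) = h k" unfolding z_def
      by (intro inner_lincomb_on_const face weight_sum) (use eq kl in auto)
    have zk: "inner (d l) (z k) = h l" unfolding z_def
      by (intro inner_lincomb_on_const face weight_sum) (use eq kl in auto)
    have "\<rho> l \<le> \<rho> (Suc k)"
      using radius_strict_antimono[of "Suc k" l] kl by (cases "Suc k = l") auto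
    then have "\<rho> l * s k \<le> \<rho> (Suc k) * s k" using slope_pos[of k] kl by simp
    also have "\<dots> = h k" using radius_Suc[of k] slope_pos[of k] kl by simp
    finally have "inner (d k) (d l) \<le> 0"
      using zl unfolding s_def residual_eq[of l] by (simp add: inner_diff_right)
    moreover have "inner (d l) (d k) = (\<rho> k - \<rho> l) * s l + inner (d l) (d l)"
      unfolding residual_square using zk
      by (simp add: residual_eq[of k] inner_diff_right s_def algebra_simps)
    moreover have "0 < (\<rho> k - \<rho> l) * s l"
      using radius_strict_antimono[of k l] slope_pos[of l] kl by simp
    ultimately show False
      using residual_square_pos[OF kl(3)] inner_commute[of "d k" "d l"] by linarith
  qed
qed

end

section \<open>Projections of integral data\<close>

lemma det_in_Ints:
  fixes A :: "real mat"
  assumes "A \<in> carrier_mat k k" "\<And>i j. i < k \<Longrightarrow> j < k \<Longrightarrow> A $$ (i, j) \<in> \<int>"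
  shows "det A \<in> \<int>"
proof -
  have "(\<Prod>i = 0..<k. A $$ (i, p i)) \<in> \<int>" if "p permutes {0..<k}" for p
    using assms(2) permutes_in_image[OF that] by (intro Ints_prod) auto
  then show ?thesis
    using assms(1) by (auto simp: det_def intro!: Ints_sum Ints_mult)
qed

text \<open>Leibniz expansion. Hadamard's inequality would be sharper, but the logarithm of
  \<open>fact k\<close> is absorbed by the encoding length.\<close>

lemma abs_det_le:
  fixes A :: "real mat"
  assumes "A \<in> carrier_mat k k" "\<And>i j. i < k \<Longrightarrow> j < k \<Longrightarrow> \<bar>A $$ (i, j)\<bar> \<le> M"
  shows "\<bar>det A\<bar> \<le> fact k * M ^ k"
proof -
  have "\<bar>signof p * (\<Prod>i = 0..<k. A $$ (i, p i))\<bar> \<le> M ^ k" if "p permutes {0..<k}" for p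
  proof -
    have "\<bar>signof p * (\<Prod>i = 0..<k. A $$ (i, p i))\<bar> = (\<Prod>i = 0..<k. \<bar>A $$ (i, p i)\<bar>)"
      by (simp add: abs_mult abs_prod sign_def)
    also have "\<dots> \<le> (\<Prod>i = 0..<k. M)"
      using assms(2) permutes_in_image[OF that] by (intro prod_mono) auto
    finally show ?thesis by simp
  qed
  then have "\<bar>\<Sum>p | p permutes {0..<k}. signof p * (\<Prod>i = 0..<k. A $$ (i, p i))\<bar>
      \<le> (\<Sum>p | p permutes {0..<k}. M ^ k)"
    by (intro order_trans[OF sum_abs] sum_mono) auto
  also have "\<dots> = fact k * M ^ k"
    by (simp add: card_permutations[of "{0..<k}" k])
  finally show ?thesis using assms(1) by (auto simp: det_def)
qed

lemma adj_mat_in_Ints: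
  fixes A :: "real mat"
  assumes "A \<in> carrier_mat k k" "\<And>i j. i < k \<Longrightarrow> j < k \<Longrightarrow> A $$ (i, j) \<in> \<int>" "i < k" "j < k"
  shows "adj_mat A $$ (i, j) \<in> \<int>"
proof -
  have "det (mat_delete A j i) \<in> \<int>"
    by (rule det_in_Ints[OF mat_delete_carrier[OF assms(1)]]) (use assms in \<open>auto simp: mat_delete_def\<close>)
  then show ?thesis using assms by (auto simp: adj_mat_def cofactor_def intro: Ints_mult)
qed

text \<open>Cramer's rule for the normal equations: the adjugate of the Gram matrix maps the
  integral right-hand side to an integral vector, and the Gram determinant \<open>g\<close> is a
  common denominator for every \<open>b\<close>. The Gram matrix is nonsingular because a kernel
  vector yields a combination orthogonal to itself.\<close>

lemma integral_projection_coeffs_aux: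
  fixes u :: "nat \<Rightarrow> 'a::real_inner"
  assumes indep: "\<And>\<mu>. lincomb_on u {..<k} \<mu> = 0 \<Longrightarrow> \<forall>i<k. \<mu> i = 0"
    and ints: "\<And>i j. i < k \<Longrightarrow> j < k \<Longrightarrow> inner (u i) (u j) \<in> \<int>"
    and bound: "\<And>i j. i < k \<Longrightarrow> j < k \<Longrightarrow> \<bar>inner (u i) (u j)\<bar> \<le> M"
  shows "\<exists>g\<in>\<int>. g \<noteq> 0 \<and> \<bar>g\<bar> \<le> fact k * M ^ k \<and>
    (\<forall>b. (\<forall>i<k. inner b (u i) \<in> \<int>) \<longrightarrow>
      (\<exists>\<mu>. \<forall>i<k. g * \<mu> i \<in> \<int> \<and> inner (b - lincomb_on u {..<k} \<mu>) (u i) = 0))"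
proof -
  define G where "G = mat k k (\<lambda>(i, j). inner (u i) (u j))"
  have G: "G \<in> carrier_mat k k" by (simp add: G_def)
  have G_int: "G $$ (i, j) \<in> \<int>" if "i < k" "j < k" for i j
    using that ints by (simp add: G_def)
  have G_mult: "(G *\<^sub>v x) $ i = inner (lincomb_on u {..<k} (($) x)) (u i)"
    if "x \<in> carrier_vec k" "i < k" for x i
    using that by (simp add: G_def scalar_prod_def inner_commute[of "lincomb_on _ _ _"]
        inner_lincomb_on mult.commute atLeast0LessThan)
  have "det G \<noteq> 0"
  proof
    assume "det G = 0"
    then obtain x where x: "x \<in> carrier_vec k" "x \<noteq> 0\<^sub>v k" "G *\<^sub>v x = 0\<^sub>v k"
      using det_0_iff_vec_prod_zero_field[OF G] by auto
    define p where "p = lincomb_on u {..<k} (($) x)"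
    have "inner p (u i) = 0" if "i < k" for i
      using G_mult[OF x(1) that] x(3) that by (simp add: p_def)
    then have "inner p (lincomb_on u {..<k} (($) x)) = 0"
      by (simp add: inner_lincomb_on)
    then have "p = 0" by (simp add: p_def)
    then have "\<forall>i<k. x $ i = 0" using indep by (simp add: p_def)
    then show False using x by auto
  qed
  moreover have "det G \<in> \<int>" using det_in_Ints[OF G G_int] .
  moreover have "\<bar>det G\<bar> \<le> fact k * M ^ k"
    by (rule abs_det_le[OF G]) (use bound in \<open>simp add: G_def\<close>)
  moreover have "\<exists>\<mu>. \<forall>i<k. det G * \<mu> i \<in> \<int> \<and> inner (b - lincomb_on u {..<k} \<mu>) (u i) = 0"
    if b: "\<forall>i<k. inner b (u i) \<in> \<int>" for b
  proof (intro exI allI impI conjI)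
    define y where "y = vec k (\<lambda>i. inner b (u i))"
    define x where "x = adj_mat G *\<^sub>v y"
    have y: "y \<in> carrier_vec k" by (simp add: y_def)
    have x: "x \<in> carrier_vec k" using adj_mat(1)[OF G] by (simp add: x_def carrier_vecI)
    have "G *\<^sub>v x = (G * adj_mat G) *\<^sub>v y"
      using assoc_mult_mat_vec[OF G adj_mat(1)[OF G] y] by (simp add: x_def)
    also have "\<dots> = det G \<cdot>\<^sub>v y"
      using y by (intro eq_vecI) (simp_all add: adj_mat(2)[OF G] smult_scalar_prod_distrib[of _ k])
    finally have Gx: "G *\<^sub>v x = det G \<cdot>\<^sub>v y" .
    fix i assume i: "i < k"
    have "x $ i \<in> \<int>"
      using i y b adj_mat(1)[OF G] adj_mat_in_Ints[OF G G_int]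
      by (auto simp: x_def scalar_prod_def y_def intro!: Ints_sum Ints_mult)
    then show "det G * (x $ i / det G) \<in> \<int>" using \<open>det G \<noteq> 0\<close> by simp
    have "lincomb_on u {..<k} (\<lambda>i. x $ i / det G) = (1 / det G) *\<^sub>R lincomb_on u {..<k} (($) x)"
      by (simp flip: lincomb_on_scale)
    moreover have "inner (lincomb_on u {..<k} (($) x)) (u i) = det G * inner b (u i)"
      using G_mult[OF x i] Gx i by (simp add: y_def)
    ultimately show "inner (b - lincomb_on u {..<k} (\<lambda>i. x $ i / det G)) (u i) = 0"
      using \<open>det G \<noteq> 0\<close> by (simp add: inner_diff_left)
  qed
  ultimately show ?thesis by blast
qed

text \<open>Enumerates \<open>I\<close>. The exponent is relaxed from \<open>card I\<close> to
  \<open>q\<close>, so that one bound serves corrals of all sizes.\<close>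

lemma integral_projection_coeffs:
  fixes u :: "'i \<Rightarrow> 'a::real_inner"
  assumes fin: "finite I" and card: "card I \<le> q"
    and indep: "\<And>\<mu>. lincomb_on u I \<mu> = 0 \<Longrightarrow> \<forall>i\<in>I. \<mu> i = 0"
    and ints: "\<And>i j. i \<in> I \<Longrightarrow> j \<in> I \<Longrightarrow> inner (u i) (u j) \<in> \<int>"
    and bound: "\<And>i j. i \<in> I \<Longrightarrow> j \<in> I \<Longrightarrow> \<bar>inner (u i) (u j)\<bar> \<le> M" and M: "1 \<le> M"
  shows "\<exists>g\<in>\<int>. g \<noteq> 0 \<and> \<bar>g\<bar> \<le> fact q * M ^ q \<and>
    (\<forall>b. (\<forall>i\<in>I. inner b (u i) \<in> \<int>) \<longrightarrow>
      (\<exists>\<mu>. \<forall>i\<in>I. g * \<mu> i \<in> \<int> \<and> inner (b - lincomb_on u I \<mu>) (u i) = 0))"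
proof -
  define k where "k = card I"
  obtain f where f: "bij_betw f {..<k} I"
    using ex_bij_betw_nat_finite[OF fin] by (auto simp: k_def atLeast0LessThan)
  have inv: "inv_into {..<k} f (f i) = i" if "i < k" for i
    using f that by (simp add: bij_betw_def inv_into_f_f)
  have fI: "f i \<in> I" if "i < k" for i using f that by (auto simp: bij_betw_def)
  have reindex: "lincomb_on u I \<mu> = lincomb_on (u \<circ> f) {..<k} (\<mu> \<circ> f)" for \<mu>
    unfolding lincomb_on_def using sum.reindex_bij_betw[OF f, of "\<lambda>i. \<mu> i *\<^sub>R u i"] by simp
  have "\<forall>i<k. \<mu> i = 0" if "lincomb_on (u \<circ> f) {..<k} \<mu> = 0" for \<mu>
  proof -
    have "lincomb_on u I (\<mu> \<circ> inv_into {..<k} f) = 0"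
      unfolding reindex that[symmetric] using inv by (intro lincomb_on_cong) auto
    from indep[OF this] show ?thesis using inv fI by fastforce
  qed
  then have "\<exists>g\<in>\<int>. g \<noteq> 0 \<and> \<bar>g\<bar> \<le> fact k * M ^ k \<and>
      (\<forall>b. (\<forall>i<k. inner b ((u \<circ> f) i) \<in> \<int>) \<longrightarrow>
        (\<exists>\<mu>. \<forall>i<k. g * \<mu> i \<in> \<int> \<and> inner (b - lincomb_on (u \<circ> f) {..<k} \<mu>) ((u \<circ> f) i) = 0))"
    by (rule integral_projection_coeffs_aux) (simp_all add: ints bound fI comp_def)
  then obtain g where g: "g \<in> \<int>" "g \<noteq> 0" "\<bar>g\<bar> \<le> fact k * M ^ k"
    "\<And>b. (\<forall>i<k. inner b ((u \<circ> f) i) \<in> \<int>) \<Longrightarrow>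
      (\<exists>\<mu>. \<forall>i<k. g * \<mu> i \<in> \<int> \<and> inner (b - lincomb_on (u \<circ> f) {..<k} \<mu>) ((u \<circ> f) i) = 0)"
    by blast
  have "fact k * M ^ k \<le> fact q * M ^ q"
    using card M unfolding k_def by (intro mult_mono fact_mono power_increasing) auto
  then have "\<bar>g\<bar> \<le> fact q * M ^ q" using g(3) by linarith
  moreover have "\<exists>\<mu>. \<forall>i\<in>I. g * \<mu> i \<in> \<int> \<and> inner (b - lincomb_on u I \<mu>) (u i) = 0"
    if b: "\<forall>i\<in>I. inner b (u i) \<in> \<int>" for b
  proof -
    obtain \<mu> where \<mu>: "\<And>i. i < k \<Longrightarrow> g * \<mu> i \<in> \<int> \<and>
        inner (b - lincomb_on (u \<circ> f) {..<k} \<mu>) ((u \<circ> f) i) = 0"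
      using g(4)[of b] b fI by auto
    have eq: "lincomb_on u I (\<mu> \<circ> inv_into {..<k} f) = lincomb_on (u \<circ> f) {..<k} \<mu>"
      unfolding reindex using inv by (intro lincomb_on_cong) auto
    have "g * (\<mu> \<circ> inv_into {..<k} f) i \<in> \<int> \<and>
        inner (b - lincomb_on u I (\<mu> \<circ> inv_into {..<k} f)) (u i) = 0" if "i \<in> I" for i
    proof -
      have "i \<in> f ` {..<k}" using f that by (simp add: bij_betw_def)
      then obtain l where l: "l < k" "i = f l" by auto
      show ?thesis unfolding eq using \<mu>[OF l(1)] inv[OF l(1)] by (simp add: l(2))
    qed
    then show ?thesis by blast
  qed
  ultimately show ?thesis using g(1,2) by blast
qed

text \<open>The squared distance of \<open>b\<close> from the span is \<open>inner b b\<close> minus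
  a combination of the integers \<open>inner b (u i)\<close>; multiplied by \<open>g\<close> it is a
  nonzero integer. Any other coefficients \<open>\<nu>\<close> give a point at least as far
  away.\<close>

lemma integral_residual:
  fixes u :: "'i \<Rightarrow> 'a::real_inner"
  assumes b: "\<And>i. i \<in> I \<Longrightarrow> inner b (u i) \<in> \<int>" "inner b b \<in> \<int>" and "g \<in> \<int>"
    and \<mu>: "\<And>i. i \<in> I \<Longrightarrow> g * \<mu> i \<in> \<int>"
      "\<And>i. i \<in> I \<Longrightarrow> inner (b - lincomb_on u I \<mu>) (u i) = 0"
    and g: "g \<noteq> 0" "b \<noteq> lincomb_on u I \<mu>"
  shows "1 \<le> \<bar>g\<bar> * inner (b - lincomb_on u I \<nu>) (b - lincomb_on u I \<nu>)"
proof -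
  define r where "r = b - lincomb_on u I \<mu>"
  define e where "e = lincomb_on u I \<mu> - lincomb_on u I \<nu>"
  have ru: "inner r (lincomb_on u I \<alpha>) = 0" for \<alpha>
    using \<mu>(2) by (simp add: r_def inner_lincomb_on)
  then have "inner r e = 0" by (simp add: e_def inner_diff_right)
  then have "inner (r + e) (r + e) = inner r r + inner e e"
    by (simp add: inner_add_left inner_add_right inner_commute)
  moreover have "0 \<le> inner e e" by simp
  moreover have "r + e = b - lincomb_on u I \<nu>" by (simp add: r_def e_def)
  ultimately have le: "inner r r \<le> inner (b - lincomb_on u I \<nu>) (b - lincomb_on u I \<nu>)"
    by simp
  have "inner r r = inner r b" using ru[of \<mu>] by (simp add: r_def inner_diff_right)
  also have "\<dots> = inner b b - (\<Sum>i\<in>I. \<mu> i * inner b (u i))"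
    by (simp add: r_def inner_diff_left inner_lincomb_on inner_commute[of "lincomb_on u I \<mu>" b])
  finally have "g * inner r r = g * inner b b - (\<Sum>i\<in>I. (g * \<mu> i) * inner b (u i))"
    by (simp add: right_diff_distrib sum_distrib_left mult.assoc)
  also have "\<dots> \<in> \<int>" 
    by (intro Ints_diff Ints_sum Ints_mult[OF \<open>g \<in> \<int>\<close> b(2)] Ints_mult[OF \<mu>(1) b(1)])
  finally have "g * inner r r \<in> \<int>" .
  moreover have "g * inner r r \<noteq> 0" using g by (simp add: r_def)
  ultimately have "1 \<le> \<bar>g * inner r r\<bar>" by (rule Ints_nonzero_abs_ge1)
  also have "\<dots> = \<bar>g\<bar> * inner r r" by (simp add: abs_mult)
  also have "\<dots> \<le> \<bar>g\<bar> * inner (b - lincomb_on u I \<nu>) (b - lincomb_on u I \<nu>)"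
    using le by (intro mult_left_mono) auto
  finally show ?thesis .
qed

lemma lincomb_on_remove_base:
  assumes "finite C" "j \<in> C" "sum \<alpha> C = 1"
  shows "lincomb_on v C \<alpha> = v j + lincomb_on (\<lambda>i. v i - v j) (C - {j}) \<alpha>"
proof -
  have "lincomb_on (\<lambda>i. v i - v j) (C - {j}) \<alpha> = lincomb_on (\<lambda>i. v i - v j) C \<alpha>"
    using assms by (simp add: lincomb_on_def sum.remove[of C j])
  then show ?thesis using assms by (simp add: lincomb_on_translate)
qed

text \<open>A linear relation among the differences becomes an affine relation once the base
  \<open>j\<close> receives minus the total weight.\<close>

lemma affinely_independent_differences:
  assumes "affinely_independent v C" "finite C" "j \<in> C"
    and "lincomb_on (\<lambda>i. v i - v j) (C - {j}) \<mu> = 0" "i \<in> C - {j}"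
  shows "\<mu> i = 0"
proof -
  define \<nu> where "\<nu> = \<mu>(j := - sum \<mu> (C - {j}))"
  have "sum \<nu> C = \<nu> j + sum \<nu> (C - {j})" using assms by (simp add: sum.remove[of C j])
  also have "sum \<nu> (C - {j}) = sum \<mu> (C - {j})" by (rule sum.cong) (auto simp: \<nu>_def)
  finally have s: "sum \<nu> C = 0" by (simp add: \<nu>_def)
  have "lincomb_on (\<lambda>i. v i - v j) C \<nu> = lincomb_on (\<lambda>i. v i - v j) (C - {j}) \<nu>"
    using assms by (simp add: lincomb_on_def sum.remove[of C j])
  also have "\<dots> = lincomb_on (\<lambda>i. v i - v j) (C - {j}) \<mu>"
    by (rule lincomb_on_cong) (auto simp: \<nu>_def)
  finally have "lincomb_on v C \<nu> = 0" using s assms by (simp add: lincomb_on_translate)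
  with s assms(1) have "\<forall>i\<in>C. \<nu> i = 0" unfolding affinely_independent_def by blast
  then show ?thesis using assms(5) by (auto simp: \<nu>_def)
qed

section \<open>Lower bounds on the residual for integral data\<close>

context radius_newton
begin

text \<open>First alternative: the affine hull of the corral misses the ray. Otherwise the next radius
  belongs to their common point.\<close>

lemma residual_bound_or_integral_radius:
  assumes k: "k < K" and fin: "finite (C k)" and card: "card (C k) \<le> q"
    and indep: "affinely_independent v (C k)"
    and ints: "\<And>i j. i \<in> I \<Longrightarrow> j \<in> I \<Longrightarrow> inner (v i) (v j) \<in> \<int>"
      "\<And>i. i \<in> I \<Longrightarrow> inner (v i) c \<in> \<int>" "inner c c \<in> \<int>"
    and bound: "\<And>i j. i \<in> I \<Longrightarrow> j \<in> I \<Longrightarrow> \<bar>inner (v i) (v j)\<bar> \<le> M"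
      "\<And>i. i \<in> I \<Longrightarrow> \<bar>inner (v i) c\<bar> \<le> M" "\<bar>inner c c\<bar> \<le> M" and M: "1 \<le> M"
  obtains g where "g \<in> \<int>" "g \<noteq> 0" "\<bar>g\<bar> \<le> fact q * (4 * M) ^ q"
    "1 \<le> \<bar>g\<bar> * inner (d k) (d k) \<or> g * (h k / s k) \<in> \<int>"
proof -
  have "C k \<noteq> {}" using weight_sum[OF k] by auto
  then obtain j where j: "j \<in> C k" by blast
  \<comment> \<open>Index \<open>j\<close> would carry the zero difference, so it is reused for
    \<open>c\<close>. The base point \<open>v j\<close> lies in the span of this family exactly if
    the affine hull of the corral meets the line through \<open>c\<close>, and then the coefficient
    of \<open>c\<close> locates the common point.\<close>
  define u where "u = (\<lambda>i. if i = j then c else v i - v j)"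
  have CI: "i \<in> I" if "i \<in> C k" for i using subset[OF k] that by blast
  have u_int: "inner (u i) (u l) \<in> \<int>" if "i \<in> C k" "l \<in> C k" for i l
    using ints CI[OF j] CI[OF that(1)] CI[OF that(2)]
    by (auto simp: u_def inner_diff_left inner_diff_right inner_commute[of c "v i" for i] intro!: Ints_diff)
  have square_bounds: "- M \<le> inner c c" "- M \<le> inner (v j) (v j)"
    using M inner_ge_zero[of c] inner_ge_zero[of "v j"] by linarith+
  \<comment> \<open>An inner product of two differences expands into four inner products of the
    data, hence the factor 4.\<close>
  have u_bound: "\<bar>inner (u i) (u l)\<bar> \<le> 4 * M" if "i \<in> C k" "l \<in> C k" for i l
    using bound(1)[OF CI[OF that(1)] CI[OF that(2)]] bound(1)[OF CI[OF that(1)] CI[OF j]]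
      bound(1)[OF CI[OF j] CI[OF that(2)]] bound(1)[OF CI[OF j] CI[OF j]]
      bound(2)[OF CI[OF that(1)]] bound(2)[OF CI[OF that(2)]] bound(2)[OF CI[OF j]] bound(3)
      square_bounds
    by (auto simp: u_def inner_diff_left inner_diff_right inner_commute[of c "v i" for i] abs_le_iff)
  have lincomb_u: "lincomb_on u (C k) \<mu> = \<mu> j *\<^sub>R c + lincomb_on (\<lambda>i. v i - v j) (C k - {j}) \<mu>" for \<mu>
    using fin j by (simp add: lincomb_on_def u_def sum.remove[of "C k" j])
  have d_lincomb: "inner (d k) (lincomb_on u (C k) \<mu>) = \<mu> j * s k" for \<mu>
    using face[OF k] j
    by (simp add: lincomb_u inner_add_right inner_lincomb_on inner_diff_right s_def)
  \<comment> \<open>\<open>d k\<close> is orthogonal to all differences but has positive slope on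
    \<open>c\<close>, which separates \<open>c\<close> from their span.\<close>
  have u_indep: "\<forall>i\<in>C k. \<mu> i = 0" if "lincomb_on u (C k) \<mu> = 0" for \<mu>
  proof -
    have "\<mu> j = 0" using d_lincomb[of \<mu>] slope_pos[OF k] that by simp
    then have "lincomb_on (\<lambda>i. v i - v j) (C k - {j}) \<mu> = 0" using that by (simp add: lincomb_u)
    then show ?thesis
      using affinely_independent_differences[OF indep fin j] \<open>\<mu> j = 0\<close> by blast
  qed
  have M4: "1 \<le> 4 * M" using M by simp
  obtain g where g: "g \<in> \<int>" "g \<noteq> 0" "\<bar>g\<bar> \<le> fact q * (4 * M) ^ q"
    "\<And>b. \<forall>i\<in>C k. inner b (u i) \<in> \<int> \<Longrightarrow>
      \<exists>\<mu>. \<forall>i\<in>C k. g * \<mu> i \<in> \<int> \<and> inner (b - lincomb_on u (C k) \<mu>) (u i) = 0"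
    using integral_projection_coeffs[where u = u and I = "C k" and q = q and M = "4 * M",
          OF fin card u_indep u_int u_bound M4] by blast
  have b_int: "inner (v j) (u i) \<in> \<int>" if "i \<in> C k" for i
    using ints CI[OF j] CI[OF that] by (auto simp: u_def inner_diff_right intro!: Ints_diff)
  obtain \<mu> where \<mu>: "\<And>i. i \<in> C k \<Longrightarrow> g * \<mu> i \<in> \<int>"
    "\<And>i. i \<in> C k \<Longrightarrow> inner (v j - lincomb_on u (C k) \<mu>) (u i) = 0"
    using g(4)[of "v j"] b_int by blast
  have "1 \<le> \<bar>g\<bar> * inner (d k) (d k) \<or> g * (h k / s k) \<in> \<int>"
  proof (cases "v j = lincomb_on u (C k) \<mu>")
    case True
    then have "h k = \<mu> j * s k" using face[OF k j] d_lincomb[of \<mu>] by simp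
    then show ?thesis using \<mu>(1)[OF j] slope_pos[OF k] by simp
  next
    case False
    \<comment> \<open>These coefficients express \<open>- d k\<close> as \<open>v j\<close> minus an
      element of the span, so the distance of \<open>v j\<close> from the span bounds the residual
      from below.\<close>
    define \<nu> where "\<nu> = (\<lambda>i. if i = j then \<rho> k else - w k i)"
    have "lincomb_on (\<lambda>i. v i - v j) (C k - {j}) \<nu> = - lincomb_on (\<lambda>i. v i - v j) (C k - {j}) (w k)"
      unfolding lincomb_on_def sum_negf[symmetric] by (rule sum.cong) (auto simp: \<nu>_def)
    then have "v j - lincomb_on u (C k) \<nu> = - d k"
      using lincomb_on_remove_base[OF fin j weight_sum[OF k], of v]
      by (simp add: lincomb_u residual_eq z_def \<nu>_def)
    moreover have "1 \<le> \<bar>g\<bar> * inner (v j - lincomb_on u (C k) \<nu>) (v j - lincomb_on u (C k) \<nu>)"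
      by (rule integral_residual[OF b_int ints(1)[OF CI[OF j] CI[OF j]] g(1) \<mu> g(2) False])
    ultimately show ?thesis by simp
  qed
  with g that show thesis by blast
qed

text \<open>Once \<open>g\<close> clears the denominator of the radius, the vector \<open>b\<close>
  from \<open>g *\<^sub>R v j\<close> to the target scaled by \<open>g\<close> has integral inner
  products with the differences. Its distance from their span is the norm of
  \<open>g *\<^sub>R d k\<close>.\<close>

lemma residual_bound_of_integral_radius:
  assumes k: "k < K" and fin: "finite (C k)" and card: "card (C k) \<le> q"
    and indep: "affinely_independent v (C k)"
    and ints: "\<And>i j. i \<in> I \<Longrightarrow> j \<in> I \<Longrightarrow> inner (v i) (v j) \<in> \<int>"
      "\<And>i. i \<in> I \<Longrightarrow> inner (v i) c \<in> \<int>" "inner c c \<in> \<int>"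
    and bound: "\<And>i j. i \<in> I \<Longrightarrow> j \<in> I \<Longrightarrow> \<bar>inner (v i) (v j)\<bar> \<le> M" and M: "1 \<le> M"
    and g: "g \<in> \<int>" "g \<noteq> 0" "g * \<rho> k \<in> \<int>"
  shows "1 \<le> fact q * (4 * M) ^ q * (g\<^sup>2 * inner (d k) (d k))"
proof -
  have "C k \<noteq> {}" using weight_sum[OF k] by auto
  then obtain j where j: "j \<in> C k" by blast
  define D where "D = C k - {j}"
  define u where "u = (\<lambda>i. v i - v j)"
  have CI: "i \<in> I" if "i \<in> C k" for i using subset[OF k] that by blast
  have DI: "i \<in> I" if "i \<in> D" for i using CI that by (simp add: D_def)
  have jI: "j \<in> I" using CI j .
  have u_int: "inner (u i) (u l) \<in> \<int>" if "i \<in> D" "l \<in> D" for i l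
    using ints DI[OF that(1)] DI[OF that(2)] jI
    by (auto simp: u_def inner_diff_left inner_diff_right intro!: Ints_diff)
  have u_bound: "\<bar>inner (u i) (u l)\<bar> \<le> 4 * M" if "i \<in> D" "l \<in> D" for i l
    using bound[OF DI[OF that(1)] DI[OF that(2)]] bound[OF DI[OF that(1)] jI]
      bound[OF jI DI[OF that(2)]] bound[OF jI jI]
    unfolding u_def inner_diff_left inner_diff_right by linarith
  have u_indep: "\<forall>i\<in>D. \<mu> i = 0" if "lincomb_on u D \<mu> = 0" for \<mu>
    using affinely_independent_differences[OF indep fin j] that by (auto simp: u_def D_def)
  have D: "finite D" "card D \<le> q"
    using fin card card_mono[of "C k" D] by (auto simp: D_def)
  have M4: "1 \<le> 4 * M" using M by simp
  obtain g' where g': "g' \<in> \<int>" "g' \<noteq> 0" "\<bar>g'\<bar> \<le> fact q * (4 * M) ^ q"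
    "\<And>b. \<forall>i\<in>D. inner b (u i) \<in> \<int> \<Longrightarrow>
      \<exists>\<mu>. \<forall>i\<in>D. g' * \<mu> i \<in> \<int> \<and> inner (b - lincomb_on u (D) \<mu>) (u i) = 0"
    using integral_projection_coeffs[where u = u and I = "D" and q = q and M = "4 * M",
          OF D u_indep u_int u_bound M4] by blast
  define b where "b = (g * \<rho> k) *\<^sub>R c - g *\<^sub>R v j"
  have b_int: "inner b (u i) \<in> \<int>" if "i \<in> D" for i
    using ints DI[OF that] jI g
    by (auto simp: b_def u_def inner_diff_left inner_diff_right inner_commute[of c "v i" for i]
        intro!: Ints_diff Ints_mult)
  have bb_int: "inner b b \<in> \<int>"
  proof -
    have "inner b b = (g * \<rho> k) * (g * \<rho> k) * inner c c - 2 * ((g * \<rho> k) * g * inner (v j) c)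
        + g * g * inner (v j) (v j)"
      by (simp add: b_def inner_diff_left inner_diff_right inner_commute[of c "v i" for i] algebra_simps)
    also have "\<dots> \<in> \<int>"
      by (intro Ints_add Ints_diff Ints_mult Ints_numeral g ints jI)
    finally show ?thesis .
  qed
  obtain \<mu> where \<mu>: "\<And>i. i \<in> D \<Longrightarrow> g' * \<mu> i \<in> \<int>"
    "\<And>i. i \<in> D \<Longrightarrow> inner (b - lincomb_on u D \<mu>) (u i) = 0"
    using g'(4)[of b] b_int by blast
  define \<nu> where "\<nu> = (\<lambda>i. g * w k i)"
  have gd: "b - lincomb_on u D \<nu> = g *\<^sub>R d k"
    unfolding \<nu>_def lincomb_on_scale
    using lincomb_on_remove_base[OF fin j weight_sum[OF k], of v]
    by (simp add: b_def u_def D_def residual_eq z_def algebra_simps)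
  have du: "inner (d k) (u i) = 0" if "i \<in> D" for i
    using face[OF k] j that by (simp add: u_def D_def inner_diff_right)
  \<comment> \<open>Otherwise the nonzero residual would be a combination of differences, all of
    which are orthogonal to it.\<close>
  have "b \<noteq> lincomb_on u D \<mu>"
  proof
    assume "b = lincomb_on u D \<mu>"
    then have "g *\<^sub>R d k = lincomb_on u D (\<lambda>i. \<mu> i - \<nu> i)"
      using gd by (simp add: lincomb_on_diff)
    moreover have "inner (d k) (lincomb_on u D (\<lambda>i. \<mu> i - \<nu> i)) = 0"
      using du by (simp add: inner_lincomb_on)
    ultimately have "inner (d k) (g *\<^sub>R d k) = 0" by simp
    then show False using g residual_nonzero[OF k] by simp
  qed
  then have "1 \<le> \<bar>g'\<bar> * inner (b - lincomb_on u D \<nu>) (b - lincomb_on u D \<nu>)"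
    by (intro integral_residual[OF b_int bb_int g'(1) \<mu> g'(2)])
  also have "\<dots> = \<bar>g'\<bar> * (g\<^sup>2 * inner (d k) (d k))"
    by (simp add: gd power2_eq_square)
  also have "\<dots> \<le> fact q * (4 * M) ^ q * (g\<^sup>2 * inner (d k) (d k))"
    using g'(3) by (intro mult_right_mono) auto
  finally show ?thesis .
qed

text \<open>The cube collects one Gram determinant from step \<open>Suc k\<close> and the square of
  the denominator \<open>g\<close> found in step \<open>k\<close>. The first alternative alone would
  need only one factor.\<close>

lemma residual_lower_bound:
  assumes k: "Suc k < K" and fin: "\<And>k. k < K \<Longrightarrow> finite (C k)"
    and card: "\<And>k. k < K \<Longrightarrow> card (C k) \<le> q"
    and indep: "\<And>k. k < K \<Longrightarrow> affinely_independent v (C k)"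
    and ints: "\<And>i j. i \<in> I \<Longrightarrow> j \<in> I \<Longrightarrow> inner (v i) (v j) \<in> \<int>"
      "\<And>i. i \<in> I \<Longrightarrow> inner (v i) c \<in> \<int>" "inner c c \<in> \<int>"
    and bound: "\<And>i j. i \<in> I \<Longrightarrow> j \<in> I \<Longrightarrow> \<bar>inner (v i) (v j)\<bar> \<le> M"
      "\<And>i. i \<in> I \<Longrightarrow> \<bar>inner (v i) c\<bar> \<le> M" "\<bar>inner c c\<bar> \<le> M" and M: "1 \<le> M"
  defines "b \<equiv> fact q * (4 * M) ^ q"
  shows "1 \<le> b ^ 3 * inner (d k) (d k)"
proof -
  have b: "1 \<le> b"
  proof -
    have "(1::real) * 1 \<le> fact q * (4 * M) ^ q"
      using M by (intro mult_mono fact_ge_1 one_le_power) auto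
    then show ?thesis by (simp add: b_def)
  qed
  have k': "k < K" using k by simp
  obtain g where g: "g \<in> \<int>" "g \<noteq> 0" "\<bar>g\<bar> \<le> b"
    "1 \<le> \<bar>g\<bar> * inner (d k) (d k) \<or> g * (h k / s k) \<in> \<int>"
    using residual_bound_or_integral_radius[OF k' fin[OF k'] card[OF k'] indep[OF k'] ints bound M]
    unfolding b_def by blast
  show ?thesis
  proof (cases "g * (h k / s k) \<in> \<int>")
    case True
    then have "g * \<rho> (Suc k) \<in> \<int>" using radius_Suc[OF k] by simp
    from residual_bound_of_integral_radius[OF k fin[OF k] card[OF k] indep[OF k] ints bound(1) M
        g(1,2) this]
    have "1 \<le> b * (g\<^sup>2 * inner (d (Suc k)) (d (Suc k)))" by (simp add: b_def)
    also have "\<dots> \<le> b * (b\<^sup>2 * inner (d k) (d k))"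
    proof (intro mult_left_mono mult_mono)
      show "g\<^sup>2 \<le> b\<^sup>2" using g(3) b by (intro abs_le_square_iff[THEN iffD1]) simp
      show "inner (d (Suc k)) (d (Suc k)) \<le> inner (d k) (d k)"
        using residual_norm_Suc_less[OF k] by (simp add: norm_eq_sqrt_inner)
    qed (use b in auto)
    finally show ?thesis by (simp add: power3_eq_cube power2_eq_square mult.assoc)
  next
    case False
    then have "1 \<le> \<bar>g\<bar> * inner (d k) (d k)" using g(4) by simp
    also have "\<dots> \<le> b ^ 3 * inner (d k) (d k)"
      using g(3) b self_le_power[of b 3] by (intro mult_right_mono) auto
    finally show ?thesis .
  qed
qed

text \<open>The slope is caught between two estimates: \<open>4 ^ k * s k\<close> is at most
  \<open>s 0\<close>, which is at most \<open>(\<rho> 0 + 1) * M\<close>, while the squared residual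
  is at most \<open>\<rho> 0 * s k\<close> and bounded below by
  \<open>residual_lower_bound\<close>.\<close>

lemma four_power_le:
  assumes k: "Suc k < K" and fin: "\<And>k. k < K \<Longrightarrow> finite (C k)"
    and card: "\<And>k. k < K \<Longrightarrow> card (C k) \<le> q"
    and indep: "\<And>k. k < K \<Longrightarrow> affinely_independent v (C k)"
    and ints: "\<And>i j. i \<in> I \<Longrightarrow> j \<in> I \<Longrightarrow> inner (v i) (v j) \<in> \<int>"
      "\<And>i. i \<in> I \<Longrightarrow> inner (v i) c \<in> \<int>" "inner c c \<in> \<int>"
    and bound: "\<And>i j. i \<in> I \<Longrightarrow> j \<in> I \<Longrightarrow> \<bar>inner (v i) (v j)\<bar> \<le> M"
      "\<And>i. i \<in> I \<Longrightarrow> \<bar>inner (v i) c\<bar> \<le> M" "\<bar>inner c c\<bar> \<le> M" and M: "1 \<le> M"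
  shows "4 ^ k \<le> (\<rho> 0 + 1) * \<rho> 0 * M * (fact q * (4 * M) ^ q) ^ 3"
proof -
  define b where "b = fact q * (4 * M) ^ q"
  have b: "0 \<le> b" using M by (simp add: b_def)
  have k': "k < K" "0 < K" using k by simp_all
  have \<rho>0: "0 < \<rho> 0" using radius_pos k' by simp
  have sk: "0 < s k" using slope_pos k' by simp
  have "inner (- c) (z 0) \<le> M"
    unfolding z_def
  proof (rule inner_lincomb_on_le)
    fix i assume "i \<in> C 0"
    then show "inner (- c) (v i) \<le> M"
      using bound(2)[of i] subset[OF k'(2)] by (auto simp: inner_commute[of c "v i" for i] abs_le_iff)
  qed (use weight_pos[OF k'(2)] weight_sum[OF k'(2)] in \<open>auto intro: less_imp_le\<close>)
  moreover have "\<rho> 0 * inner c c \<le> \<rho> 0 * M" using bound(3) \<rho>0 by (intro mult_left_mono) auto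
  ultimately have s0: "s 0 \<le> (\<rho> 0 + 1) * M"
    unfolding s_def by (simp add: residual_eq inner_diff_left inner_commute[of "z 0"] algebra_simps)
  have "1 \<le> b ^ 3 * inner (d k) (d k)"
    unfolding b_def by (rule residual_lower_bound[OF k fin card indep ints bound M])
  also have "\<dots> \<le> b ^ 3 * (\<rho> 0 * s k)"
  proof (rule mult_left_mono)
    have "inner (d k) (d k) \<le> \<rho> k * s k"
      using residual_square[of k] height_nonneg[OF k'(1)] by simp
    also have "\<dots> \<le> \<rho> 0 * s k" using radius_le_initial[OF k'(1)] sk by simp
    finally show "inner (d k) (d k) \<le> \<rho> 0 * s k" .
  qed (use b in simp)
  finally have "4 ^ k * 1 \<le> 4 ^ k * (b ^ 3 * (\<rho> 0 * s k))" by (intro mult_left_mono) auto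
  also have "\<dots> = (b ^ 3 * \<rho> 0) * (4 ^ k * s k)" by simp
  also have "\<dots> \<le> (b ^ 3 * \<rho> 0) * ((\<rho> 0 + 1) * M)"
    using slope_le_initial[OF k'(1)] s0 b \<rho>0 by (intro mult_left_mono) auto
  finally show ?thesis by (simp add: b_def mult_ac)
qed

end

section \<open>Wolfe's algorithm\<close>

locale generators =
  fixes A :: "real mat" and n :: nat
  assumes dim_col_A: "dim_col A = n"
begin

abbreviation E :: "real vec \<Rightarrow> fseq" where "E \<equiv> fseq_of_vec"

definition V :: "nat \<Rightarrow> fseq" where "V i = fseq_of_vec (gen A i)"

lemma gen_carrier: "gen A i \<in> carrier_vec n"
  using dim_col_A by (auto simp: gen_def intro!: carrier_vecI)

lemma comb_carrier: "comb A C w \<in> carrier_vec n"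
  using dim_col_A by (simp add: comb_def carrier_vecI)

lemma fseq_of_comb: "E (comb A C w) = lincomb_on V C w"
proof -
  have "coord (E (comb A C w)) l = coord (lincomb_on V C w) l" for l
    using dim_col_A gen_carrier
    by (simp add: coord_fseq_of_vec comb_def lincomb_on_def coord_sum scaleR_fseq.rep_eq V_def
        carrier_vecD[OF gen_carrier])
  then show ?thesis by (simp add: coord_inject[symmetric] fun_eq_iff)
qed

lemma finite_idx: "finite (idx A)"
  by (simp add: idx_def)

definition sqdist :: "real vec \<Rightarrow> active \<Rightarrow> real" where
  "sqdist y = (\<lambda>(C, w). inner (E y - lincomb_on V C w) (E y - lincomb_on V C w))"

text \<open>\<open>aff_weights\<close> is a choice among minimizers. By Pythagoras an affine
  projection is a minimizer, and every minimizer yields the same point, so the chosen one satisfies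
  the normal equations too.\<close>

lemma aff_weights_projection:
  assumes y: "y \<in> carrier_vec n" and C: "finite C" "C \<noteq> {}"
  shows "affine_projection V (E y) C (aff_weights A y C)"
proof -
  let ?f = "\<lambda>\<mu>. 1/2 * (vnorm (comb A C \<mu> - y))\<^sup>2"
  let ?P = "\<lambda>\<mu>. sum \<mu> C = 1 \<and> (\<forall>i. i \<notin> C \<longrightarrow> \<mu> i = 0)"
  have f: "?f \<mu> = 1/2 * sqdist y (C, \<mu>)" for \<mu>
  proof -
    have "(comb A C \<mu> - y) \<bullet> (comb A C \<mu> - y) = inner (E (comb A C \<mu> - y)) (E (comb A C \<mu> - y))"
      using comb_carrier[of C \<mu>] y by (intro inner_fseq_of_vec[symmetric, of _ n]) auto
    also have "\<dots> = sqdist y (C, \<mu>)"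
      by (simp add: fseq_of_vec_diff[OF comb_carrier y] fseq_of_comb sqdist_def inner_diff_left
          inner_diff_right inner_commute)
    finally show ?thesis by (simp add: vnorm_def sqdist_def)
  qed
  obtain \<mu>\<^sub>0 where \<mu>\<^sub>0: "affine_projection V (E y) C \<mu>\<^sub>0" "\<forall>i. i \<notin> C \<longrightarrow> \<mu>\<^sub>0 i = 0"
    using affine_projection_exists[OF C] by blast
  then have P\<^sub>0: "?P \<mu>\<^sub>0" by (simp add: affine_projection_def)
  have pyth: "sqdist y (C, \<nu>) = sqdist y (C, \<mu>\<^sub>0)
      + inner (lincomb_on V C \<nu> - lincomb_on V C \<mu>\<^sub>0) (lincomb_on V C \<nu> - lincomb_on V C \<mu>\<^sub>0)"
    if "sum \<nu> C = 1" for \<nu>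
    using affine_projection_pythagoras[OF \<mu>\<^sub>0(1) that] by (simp add: sqdist_def)
  have min: "sqdist y (C, \<mu>\<^sub>0) \<le> sqdist y (C, \<nu>)" if "sum \<nu> C = 1" for \<nu>
    using pyth[OF that] by simp
  have "is_arg_min ?f ?P \<mu>\<^sub>0"
    unfolding is_arg_min_linorder f using P\<^sub>0 min by simp
  then have "is_arg_min ?f ?P (aff_weights A y C)"
    unfolding aff_weights_def arg_min_def by (rule someI[of "is_arg_min ?f ?P"])
  then have a: "?P (aff_weights A y C)" "sqdist y (C, aff_weights A y C) \<le> sqdist y (C, \<mu>\<^sub>0)"
    unfolding is_arg_min_linorder f using P\<^sub>0 by auto
  define D where "D = lincomb_on V C (aff_weights A y C) - lincomb_on V C \<mu>\<^sub>0"
  have "inner D D \<le> 0" using pyth[of "aff_weights A y C"] a by (simp add: D_def)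
  then have "D = 0" using inner_ge_zero[of D] inner_eq_zero_iff[of D] by linarith
  then have "lincomb_on V C (aff_weights A y C) = lincomb_on V C \<mu>\<^sub>0" by (simp add: D_def)
  then show ?thesis using \<mu>\<^sub>0(1) a(1) by (simp add: affine_projection_def)
qed

section \<open>Active sets, insertion and reduction\<close>

definition active_ok :: "active \<Rightarrow> bool" where
  "active_ok = (\<lambda>(C, w). C \<subseteq> idx A \<and> affinely_independent V C \<and> sum w C = 1 \<and> (\<forall>i\<in>C. 0 \<le> w i))"

definition is_corral :: "real vec \<Rightarrow> active \<Rightarrow> bool" where
  "is_corral y = (\<lambda>(C, w). active_ok (C, w) \<and> (\<forall>i\<in>C. 0 < w i) \<and> affine_projection V (E y) C w)"

lemma active_ok_finite: "active_ok (C, w) \<Longrightarrow> finite C"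
  using finite_idx by (auto simp: active_ok_def intro: finite_subset)

lemma active_ok_nonempty: "active_ok (C, w) \<Longrightarrow> C \<noteq> {}"
  by (auto simp: active_ok_def)

lemma active_projection:
  assumes "active_ok (C, w)" "y \<in> carrier_vec n"
  shows "affine_projection V (E y) C (aff_weights A y C)"
  by (rule aff_weights_projection[OF assms(2) active_ok_finite[OF assms(1)]
        active_ok_nonempty[OF assms(1)]])

lemma sqdist_aff_weights:
  assumes "active_ok (C, w)" "y \<in> carrier_vec n"
  shows "sqdist y (C, w) = sqdist y (C, aff_weights A y C)
    + inner (lincomb_on V C w - lincomb_on V C (aff_weights A y C))
        (lincomb_on V C w - lincomb_on V C (aff_weights A y C))"
  using affine_projection_pythagoras[OF active_projection[OF assms], of w] assms(1)
  by (simp add: sqdist_def active_ok_def)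

lemma sqdist_aff_weights_le:
  "active_ok (C, w) \<Longrightarrow> y \<in> carrier_vec n \<Longrightarrow> sqdist y (C, aff_weights A y C) \<le> sqdist y (C, w)"
  using sqdist_aff_weights by simp

lemma is_corral_aff_weights:
  assumes "active_ok (C, w)" "y \<in> carrier_vec n" "aff_positive A y C"
  shows "is_corral y (C, aff_weights A y C)"
  using assms active_projection[OF assms(1,2)]
  by (auto simp: is_corral_def active_ok_def aff_positive_def affine_projection_def less_imp_le)

text \<open>Places the distance of a corral among the finitely many values that
  \<open>aff_weights\<close> attains on index sets, although \<open>w\<close> itself need not be the
  function chosen by \<open>aff_weights\<close>.\<close>

lemma is_corral_sqdist:
  assumes "is_corral y (C, w)" "y \<in> carrier_vec n"
  shows "sqdist y (C, aff_weights A y C) = sqdist y (C, w)"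
proof (rule antisym)
  have ok: "active_ok (C, w)" and proj: "affine_projection V (E y) C w"
    using assms by (auto simp: is_corral_def)
  show "sqdist y (C, aff_weights A y C) \<le> sqdist y (C, w)"
    using sqdist_aff_weights_le[OF ok assms(2)] .
  show "sqdist y (C, w) \<le> sqdist y (C, aff_weights A y C)"
    using affine_projection_pythagoras[OF proj, of "aff_weights A y C"]
      active_projection[OF ok assms(2)]
    by (simp add: sqdist_def affine_projection_def)
qed

text \<open>The residual \<open>r\<close> is orthogonal to the old affine hull but not to
  \<open>V j - Z\<close>. Hence independence is kept and the new affine minimizer \<open>p\<close>
  differs from \<open>Z\<close>. Since \<open>inner r (p - Z)\<close> is the squared length of
  \<open>p - Z\<close>, the new weight is positive, which prevents the next minor step from having
  length 0.\<close>

lemma insert_violator: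
  assumes y: "y \<in> carrier_vec n" and corral: "is_corral y (C, w)"
    and j: "j \<in> violators A y (comb A C w)"
  defines "a \<equiv> aff_weights A y (insert j C)"
  shows "active_ok (insert j C, w(j := 0))" "j \<notin> C" "0 < a j"
    "sqdist y (insert j C, w(j := 0)) = sqdist y (C, w)"
    "sqdist y (insert j C, a) < sqdist y (C, w)"
proof -
  define Z where "Z = lincomb_on V C w"
  define r where "r = E y - Z"
  have ok: "active_ok (C, w)" and proj: "affine_projection V (E y) C w" and pos: "\<forall>i\<in>C. 0 < w i"
    using corral by (auto simp: is_corral_def)
  have fin: "finite C" using active_ok_finite[OF ok] .
  have jI: "j \<in> idx A" using j by (simp add: violators_def)
  have "0 < (y - comb A C w) \<bullet> (gen A j - comb A C w)" using j by (simp add: violators_def)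
  also have "\<dots> = inner (E (y - comb A C w)) (E (gen A j - comb A C w))"
    using y comb_carrier gen_carrier by (intro inner_fseq_of_vec[symmetric, of _ n]) auto
  also have "\<dots> = inner r (V j - Z)"
    by (simp add: fseq_of_vec_diff[OF y comb_carrier] fseq_of_vec_diff[OF gen_carrier comb_carrier]
        fseq_of_comb r_def Z_def V_def)
  finally have viol: "0 < inner r (V j - Z)" .
  have rC: "inner r (V i) = inner r Z" if "i \<in> C" for i
    using affine_projection_inner[OF proj that] by (simp add: r_def Z_def)
  show jC: "j \<notin> C" using viol rC by (auto simp: inner_diff_right)
  \<comment> \<open>Beyond the total weight only \<open>\<mu> j\<close> matters. This is used with
    total 0 for independence and with total 1 for the sign of \<open>a j\<close>.\<close>
  have r_lincomb: "inner r (lincomb_on V (insert j C) \<mu>)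
      = sum \<mu> (insert j C) * inner r Z + \<mu> j * inner r (V j - Z)" for \<mu>
    using rC jC fin by (simp add: inner_lincomb_on inner_diff_right algebra_simps sum_distrib_left
        sum_distrib_right)
  have "affinely_independent V (insert j C)"
    unfolding affinely_independent_def
  proof (intro allI impI)
    fix \<mu> assume *: "sum \<mu> (insert j C) = 0" "lincomb_on V (insert j C) \<mu> = 0"
    then have "\<mu> j = 0" using r_lincomb[of \<mu>] viol by simp
    moreover from this have "sum \<mu> C = 0" "lincomb_on V C \<mu> = 0"
      using * jC fin by (simp_all add: lincomb_on_def)
    then have "\<forall>i\<in>C. \<mu> i = 0" using ok by (simp add: active_ok_def affinely_independent_def)
    ultimately show "\<forall>i\<in>insert j C. \<mu> i = 0" by simp
  qed
  moreover have "sum (w(j := 0)) (insert j C) = 1"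
  proof -
    have "sum (w(j := 0)) C = sum w C" by (rule sum.cong) (use jC in auto)
    then show ?thesis using ok jC fin by (simp add: active_ok_def)
  qed
  ultimately show ok': "active_ok (insert j C, w(j := 0))"
    using ok jI by (auto simp: active_ok_def)
  have Z': "lincomb_on V (insert j C) (w(j := 0)) = Z"
  proof -
    have "lincomb_on V (insert j C) (w(j := 0)) = lincomb_on V C (w(j := 0))"
      using jC fin by (simp add: lincomb_on_def)
    also have "\<dots> = Z" unfolding Z_def by (rule lincomb_on_cong) (use jC in auto)
    finally show ?thesis .
  qed
  then show eq: "sqdist y (insert j C, w(j := 0)) = sqdist y (C, w)"
    by (simp add: sqdist_def Z_def)
  define p where "p = lincomb_on V (insert j C) a"
  have pa: "affine_projection V (E y) (insert j C) a"
    unfolding a_def by (rule active_projection[OF ok' y])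
  have "p \<noteq> Z"
  proof
    assume "p = Z"
    then have "inner r (V j - Z) = 0"
      using pa by (simp add: affine_projection_def p_def r_def)
    then show False using viol by simp
  qed
  then have pZ: "0 < inner (Z - p) (Z - p)" by simp
  show "sqdist y (insert j C, a) < sqdist y (C, w)"
    using sqdist_aff_weights[OF ok' y] pZ by (simp add: a_def[symmetric] p_def[symmetric] Z' eq)
  have "inner (E y - p) Z = inner (E y - p) p"
    unfolding Z'[symmetric] using affine_projection_inner[OF pa] ok'
    by (intro inner_lincomb_on_const) (simp_all add: p_def active_ok_def)
  then have "inner r p = inner r Z + inner (Z - p) (Z - p)"
    by (simp add: r_def inner_diff_left inner_diff_right inner_commute)
  moreover have "inner r p = inner r Z + a j * inner r (V j - Z)"
    using r_lincomb[of a] pa by (simp add: p_def affine_projection_def)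
  ultimately have "0 < a j * inner r (V j - Z)" using pZ by simp
  then show "0 < a j" using viol by (simp add: zero_less_mult_iff)
qed

text \<open>\<open>pos\<close> excludes a step of length 0: every ratio lies in (0, 1], even right
  after an insertion, where the generator of weight 0 has a positive minimizer weight. Minimality of
  \<open>\<theta>\<close> keeps weights nonnegative, and the weight at which it is attained
  vanishes. The displacement from the affine minimizer contracts by \<open>1 - \<theta>\<close>,
  which Pythagoras turns into a decrease of distance.\<close>

lemma reduce_step:
  assumes y: "y \<in> carrier_vec n" and ok: "active_ok (C, w)" and neg: "\<not> aff_positive A y C"
    and pos: "\<And>i. i \<in> C \<Longrightarrow> aff_weights A y C i \<le> 0 \<Longrightarrow> 0 < w i"
  obtains C' w' where "reduce A y (C, w) = (C', w')" "active_ok (C', w')" "\<forall>i\<in>C'. 0 < w' i"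
    "C' \<subset> C" "sqdist y (C', w') \<le> sqdist y (C, w)"
    "sqdist y (C, aff_weights A y C) < sqdist y (C, w) \<Longrightarrow> sqdist y (C', w') < sqdist y (C, w)"
proof -
  define a where "a = aff_weights A y C"
  define S where "S = {i \<in> C. a i \<le> 0}"
  define t where "t = (\<lambda>i. w i / (w i - a i))"
  define \<theta> where "\<theta> = Min (t ` S)"
  define w' where "w' = (\<lambda>i. (1 - \<theta>) * w i + \<theta> * a i)"
  define C' where "C' = {i \<in> C. w' i \<noteq> 0}"
  have red: "reduce A y (C, w) = (C', w')"
    by (simp add: reduce_def Let_def C'_def w'_def \<theta>_def t_def S_def a_def)
  have fin: "finite C" using active_ok_finite[OF ok] .
  have S: "finite S" "S \<noteq> {}"
    using fin neg by (auto simp: S_def aff_positive_def a_def not_less)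
  have t: "0 < t i" "t i \<le> 1" if "i \<in> S" for i
    using that pos[of i] by (auto simp: t_def S_def a_def field_simps)
  have "\<theta> \<in> t ` S" unfolding \<theta>_def using S by (intro Min_in) auto
  then obtain l where l: "l \<in> S" "\<theta> = t l" by blast
  have \<theta>: "0 < \<theta>" "\<theta> \<le> 1" using l t by auto
  have \<theta>_le: "\<theta> \<le> t i" if "i \<in> S" for i using S that by (simp add: \<theta>_def)
  have proj: "affine_projection V (E y) C a"
    unfolding a_def by (rule active_projection[OF ok y])
  have w_nonneg: "0 \<le> w i" if "i \<in> C" for i using ok that by (simp add: active_ok_def)
  have w'_nonneg: "0 \<le> w' i" if "i \<in> C" for i
  proof (cases "i \<in> S")
    case True
    then have "0 < w i - a i" using pos[of i] by (simp add: S_def a_def)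
    then have "\<theta> * (w i - a i) \<le> w i" using \<theta>_le[OF True] by (simp add: t_def field_simps)
    then show ?thesis by (simp add: w'_def algebra_simps)
  next
    case False
    then show ?thesis using that w_nonneg \<theta> by (simp add: w'_def S_def)
  qed
  have "w' l = 0"
  proof -
    have "0 < w l - a l" using l pos[of l] by (simp add: S_def a_def)
    then have "\<theta> * (w l - a l) = w l" by (simp add: l(2) t_def)
    then show ?thesis by (simp add: w'_def algebra_simps)
  qed
  then have sub: "C' \<subset> C" using l by (auto simp: C'_def S_def)
  have sum_w': "sum w' C = 1"
  proof -
    have "sum w' C = (1 - \<theta>) * sum w C + \<theta> * sum a C"
      by (simp add: w'_def sum.distrib sum_distrib_left)
    then show ?thesis using ok proj by (simp add: active_ok_def affine_projection_def)
  qed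
  have "sum w' C' = sum w' C"
    using fin by (intro sum.mono_neutral_left) (auto simp: C'_def)
  moreover have "affinely_independent V C'"
    by (rule affinely_independent_subset[of V C]) (use ok fin in \<open>auto simp: active_ok_def C'_def\<close>)
  ultimately have ok': "active_ok (C', w')"
    using ok w'_nonneg sum_w' by (auto simp: active_ok_def C'_def)
  have pos': "\<forall>i\<in>C'. 0 < w' i" using w'_nonneg by (auto simp: C'_def less_le)
  define x where "x = lincomb_on V C w"
  define p where "p = lincomb_on V C a"
  have "lincomb_on V C' w' = lincomb_on V C w'"
    using fin by (intro lincomb_on_mono_neutral[symmetric]) (auto simp: C'_def)
  also have "\<dots> = (1 - \<theta>) *\<^sub>R x + \<theta> *\<^sub>R p"
    by (simp add: w'_def lincomb_on_add lincomb_on_scale x_def p_def)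
  finally have "lincomb_on V C w' - p = (1 - \<theta>) *\<^sub>R (x - p)" and
    same: "lincomb_on V C' w' = lincomb_on V C w'"
    using \<open>lincomb_on V C' w' = lincomb_on V C w'\<close> by (simp_all add: algebra_simps)
  then have e': "sqdist y (C', w') = sqdist y (C, a) + (1 - \<theta>)\<^sup>2 * inner (x - p) (x - p)"
    using affine_projection_pythagoras[OF proj sum_w']
    by (simp add: sqdist_def p_def power2_eq_square)
  have e: "sqdist y (C, w) = sqdist y (C, a) + inner (x - p) (x - p)"
    using sqdist_aff_weights[OF ok y] by (simp add: a_def x_def p_def)
  have sq: "(1 - \<theta>)\<^sup>2 < 1" using \<theta> by (simp add: power_less_one_iff abs_square_less_1)
  have le: "sqdist y (C', w') \<le> sqdist y (C, w)"
    unfolding e e' using mult_right_mono[of "(1 - \<theta>)\<^sup>2" 1 "inner (x - p) (x - p)"] sq by simp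
  have less: "sqdist y (C', w') < sqdist y (C, w)" if "sqdist y (C, a) < sqdist y (C, w)"
  proof -
    have "0 < inner (x - p) (x - p)" using that e by simp
    then show ?thesis unfolding e e' using sq by simp
  qed
  show thesis by (rule that[OF red ok' pos' sub le less[unfolded a_def]])
qed


text \<open>The state right after an insertion carries one zero weight. Its affine minimizer is strictly
  closer to the target than the current point, whose distance is that of a corral.\<close>

definition fresh :: "real vec \<Rightarrow> active \<Rightarrow> bool" where
  "fresh y = (\<lambda>(C, w). \<exists>j\<in>C. w j = 0 \<and> (\<forall>i\<in>C. i \<noteq> j \<longrightarrow> 0 < w i) \<and> 0 < aff_weights A y C j \<and>
     sqdist y (C, aff_weights A y C) < sqdist y (C, w) \<and>
     (\<exists>D\<subseteq>idx A. sqdist y (D, aff_weights A y D) = sqdist y (C, w)))"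

definition wolfe_inv :: "real vec \<Rightarrow> phase \<times> active \<Rightarrow> bool" where
  "wolfe_inv y = (\<lambda>(ph, C, w). case ph of
     Major \<Rightarrow> is_corral y (C, w)
   | Minor \<Rightarrow> active_ok (C, w) \<and> ((\<forall>i\<in>C. 0 < w i) \<or> fresh y (C, w)))"

text \<open>Makes the strict decrease of real distances between corrals well-founded: the distances
  that matter belong to finitely many index sets.\<close>

definition rank :: "real vec \<Rightarrow> real \<Rightarrow> nat" where
  "rank y r = card {D. D \<subseteq> idx A \<and> sqdist y (D, aff_weights A y D) \<le> r}"

text \<open>Orders the states of equal rank. An insertion keeps the distance and goes from 1 to 0;
  minor steps with positive weights shrink the active set; acceptance goes down to 1. Out of a state
  with a zero weight the stage may rise, because there the rank drops.\<close>

definition stage :: "phase \<times> active \<Rightarrow> nat" where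
  "stage = (\<lambda>(ph, C, w). case ph of
     Major \<Rightarrow> 1
   | Minor \<Rightarrow> if \<exists>j\<in>C. w j = 0 then 0 else card C + 2)"

text \<open>Lexicographic, as \<open>stage\<close> stays below the factor of \<open>rank\<close>.\<close>

definition wolfe_measure :: "real vec \<Rightarrow> phase \<times> active \<Rightarrow> nat" where
  "wolfe_measure y s = rank y (sqdist y (snd s)) * (card (idx A) + 3) + stage s"

lemma finite_subsets: "finite {D. D \<subseteq> idx A \<and> P D}"
  by (rule finite_subset[of _ "Pow (idx A)"]) (auto simp: finite_idx)

lemma rank_mono: "r \<le> r' \<Longrightarrow> rank y r \<le> rank y r'"
  unfolding rank_def by (intro card_mono finite_subsets) auto

text \<open>Strict because the larger value is attained: \<open>D\<close> is counted at its own
  distance but not below it.\<close>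

lemma rank_less:
  assumes "D \<subseteq> idx A" "r < sqdist y (D, aff_weights A y D)"
  shows "rank y r < rank y (sqdist y (D, aff_weights A y D))"
proof -
  let ?S = "\<lambda>r. {D. D \<subseteq> idx A \<and> sqdist y (D, aff_weights A y D) \<le> r}"
  let ?r = "sqdist y (D, aff_weights A y D)"
  have "D \<in> ?S ?r" "D \<notin> ?S r" "?S r \<subseteq> ?S ?r" using assms by auto
  then have "?S r \<subset> ?S ?r" by blast
  then show ?thesis unfolding rank_def by (intro psubset_card_mono finite_subsets)
qed

lemma stage_less:
  assumes "C \<subseteq> idx A" shows "stage (ph, C, w) < card (idx A) + 3"
  using card_mono[OF finite_idx assms] by (auto simp: stage_def split: phase.split)

lemma wolfe_measure_rank:
  assumes "fst (snd s') \<subseteq> idx A" "rank y (sqdist y (snd s')) < rank y (sqdist y (snd s))"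
  shows "wolfe_measure y s' < wolfe_measure y s"
proof -
  obtain ph C w where s': "s' = (ph, C, w)" by (cases s')
  have "wolfe_measure y s' < (rank y (sqdist y (snd s')) + 1) * (card (idx A) + 3)"
    using stage_less[of C ph w] assms(1) by (simp add: wolfe_measure_def s' algebra_simps)
  also have "\<dots> \<le> rank y (sqdist y (snd s)) * (card (idx A) + 3)"
    using assms(2) by (intro mult_right_mono) auto
  also have "\<dots> \<le> wolfe_measure y s" by (simp add: wolfe_measure_def)
  finally show ?thesis .
qed

lemma wolfe_measure_stage:
  assumes "sqdist y (snd s') \<le> sqdist y (snd s)" "stage s' < stage s"
  shows "wolfe_measure y s' < wolfe_measure y s"
  unfolding wolfe_measure_def
  using mult_le_mono1[OF rank_mono[OF assms(1), of y], of "card (idx A) + 3"] assms(2) by linarith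

lemma fresh_measure:
  assumes "fresh y (C, w)" "C' \<subseteq> idx A" "sqdist y (C', w') < sqdist y (C, w)"
  shows "wolfe_measure y (ph', C', w') < wolfe_measure y (ph, C, w)"
proof -
  obtain D where "D \<subseteq> idx A" "sqdist y (D, aff_weights A y D) = sqdist y (C, w)"
    using assms(1) by (auto simp: fresh_def)
  then show ?thesis
    using rank_less[of D "sqdist y (C', w')" y] assms by (intro wolfe_measure_rank) auto
qed

text \<open>Cold and warm calls share this proof, as the insertion rule enters only by returning a
  violator. Steps out of a \<open>fresh\<close> state lower the rank, all others lower the stage
  without increasing the distance.\<close>

lemma wolfe_step_inv:
  assumes y: "y \<in> carrier_vec n" and inv: "wolfe_inv y s" and not_done: "\<not> wolfe_done A y s"
    and ins: "\<And>t. \<not> verified A y (comb A (fst t) (snd t)) \<Longrightarrow>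
      ins t (comb A (fst t) (snd t)) \<in> violators A y (comb A (fst t) (snd t))"
  shows "wolfe_inv y (wolfe_step A y ins s)"
    and "wolfe_measure y (wolfe_step A y ins s) < wolfe_measure y s"
proof -
  obtain ph C w where s: "s = (ph, C, w)" by (cases s)
  define a where "a = aff_weights A y C"
  have "wolfe_inv y (wolfe_step A y ins s) \<and>
    wolfe_measure y (wolfe_step A y ins s) < wolfe_measure y s"
  proof (cases ph)
    case Major
    define j where "j = ins (C, w) (comb A C w)"
    have corral: "is_corral y (C, w)" using inv s Major by (simp add: wolfe_inv_def)
    then have CI: "C \<subseteq> idx A" by (simp add: is_corral_def active_ok_def)
    have "\<not> verified A y (comb A C w)" using not_done s Major by (simp add: wolfe_done_def)
    then have j: "j \<in> violators A y (comb A C w)" using ins[of "(C, w)"] by (simp add: j_def)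
    have step: "wolfe_step A y ins (Major, C, w) = (Minor, insert j C, w(j := 0))"
      by (simp add: wolfe_step_def Let_def j_def)
    note v = insert_violator[OF y corral j]
    have "\<forall>i\<in>C. 0 < w i" using corral by (simp add: is_corral_def)
    then have "fresh y (insert j C, w(j := 0))"
      unfolding fresh_def using v CI is_corral_sqdist[OF corral y]
      by (auto intro!: exI[of _ C])
    moreover have "wolfe_measure y (Minor, insert j C, w(j := 0)) < wolfe_measure y (Major, C, w)"
      using v(4) by (intro wolfe_measure_stage) (simp_all add: stage_def)
    ultimately show ?thesis using v(1) by (simp add: s Major step wolfe_inv_def)
  next
    case Minor
    have ok: "active_ok (C, w)" and w: "(\<forall>i\<in>C. 0 < w i) \<or> fresh y (C, w)"
      using inv s Minor by (auto simp: wolfe_inv_def)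
    have CI: "C \<subseteq> idx A" using ok by (simp add: active_ok_def)
    show ?thesis
    proof (cases "aff_positive A y C")
      case True
      have step: "wolfe_step A y ins (Minor, C, w) = (Major, C, a)"
        using True by (simp add: wolfe_step_def a_def)
      have "is_corral y (C, a)" unfolding a_def by (rule is_corral_aff_weights[OF ok y True])
      moreover have "wolfe_measure y (Major, C, a) < wolfe_measure y (Minor, C, w)"
      proof (cases "fresh y (C, w)")
        case True
        then show ?thesis
          by (intro fresh_measure[OF True CI]) (auto simp: fresh_def a_def)
      next
        case False
        then have "\<forall>i\<in>C. 0 < w i" using w by blast
        then show ?thesis
          using sqdist_aff_weights_le[OF ok y]
          by (intro wolfe_measure_stage) (auto simp: stage_def a_def)
      qed
      ultimately show ?thesis by (simp add: step s Minor wolfe_inv_def)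
    next
      case False
      have "0 < w i" if "i \<in> C" "aff_weights A y C i \<le> 0" for i
        using w that by (auto simp: fresh_def)
      then obtain C' w' where r: "reduce A y (C, w) = (C', w')" "active_ok (C', w')"
        "\<forall>i\<in>C'. 0 < w' i" "C' \<subset> C" "sqdist y (C', w') \<le> sqdist y (C, w)"
        "sqdist y (C, a) < sqdist y (C, w) \<Longrightarrow> sqdist y (C', w') < sqdist y (C, w)"
        using reduce_step[OF y ok False] unfolding a_def by metis
      have step: "wolfe_step A y ins (Minor, C, w) = (Minor, C', w')"
        using False r(1) by (simp add: wolfe_step_def)
      have "wolfe_measure y (Minor, C', w') < wolfe_measure y (Minor, C, w)"
      proof (cases "fresh y (C, w)")
        case True
        then have "sqdist y (C', w') < sqdist y (C, w)"
          by (intro r(6)) (auto simp: fresh_def a_def)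
        then show ?thesis using r(4) CI by (intro fresh_measure[OF True]) auto
      next
        case False
        then have pos: "\<forall>i\<in>C. 0 < w i" using w by blast
        have "card C' < card C" using r(4) active_ok_finite[OF ok] by (intro psubset_card_mono)
        then have "stage (Minor, C', w') < stage (Minor, C, w)"
          using pos r(3) by (auto simp: stage_def)
        then show ?thesis using r(5) by (intro wolfe_measure_stage) auto
      qed
      then show ?thesis using r(2,3) by (simp add: step s Minor wolfe_inv_def)
    qed
  qed
  then show "wolfe_inv y (wolfe_step A y ins s)"
    and "wolfe_measure y (wolfe_step A y ins s) < wolfe_measure y s" by auto
qed

section \<open>Termination and correctness of cold calls, warm calls and repair\<close>

definition proj_ok :: "real vec \<Rightarrow> projection \<Rightarrow> bool" where
  "proj_ok y = (\<lambda>(z, C, w). is_corral y (C, w) \<and> z = comb A C w \<and> verified A y z)"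

lemma wolfe_result_ok:
  "wolfe_inv y s \<Longrightarrow> wolfe_done A y s \<Longrightarrow> proj_ok y (wolfe_result A s)"
  by (cases s) (auto simp: wolfe_inv_def wolfe_done_def wolfe_result_def proj_ok_def)

lemma verified_inner:
  assumes "y \<in> carrier_vec n" "z \<in> carrier_vec n"
  shows "verified A y z \<longleftrightarrow> (\<forall>j\<in>idx A. inner (E y - E z) (V j) \<le> inner (E y - E z) (E z))"
proof -
  have "(y - z) \<bullet> (gen A j - z) = inner (E y - E z) (V j - E z)" for j
  proof -
    have "(y - z) \<bullet> (gen A j - z) = inner (E (y - z)) (E (gen A j - z))"
      using assms gen_carrier by (intro inner_fseq_of_vec[symmetric, of _ n]) auto
    then show ?thesis
      by (simp add: fseq_of_vec_diff[OF assms] fseq_of_vec_diff[OF gen_carrier assms(2)] V_def)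
  qed
  then show ?thesis by (simp add: verified_def inner_diff_right)
qed

text \<open>The violation of \<open>j\<close> is \<open>(y - z) \<bullet> gen A j\<close> minus a
  constant, so a maximizer of the linear form is a most violating generator.\<close>

lemma cold_insert_violator:
  assumes y: "y \<in> carrier_vec n" and R: "valid_cold_rule A R"
    and z: "z \<in> carrier_vec n" "\<not> verified A y z"
  shows "cold_insert A R y s z \<in> violators A y z"
proof -
  define f where "f = (\<lambda>j. (y - z) \<bullet> gen A j)"
  define S where "S = {j \<in> idx A. \<forall>i\<in>idx A. f i \<le> f j}"
  have split: "(y - z) \<bullet> (gen A j - z) = f j - (y - z) \<bullet> z" for j
    using y z gen_carrier by (simp add: f_def scalar_prod_minus_distrib[of _ n])
  have "Max (f ` idx A) \<in> f ` idx A"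
    using finite_idx by (intro Max_in) (auto simp: idx_def)
  then obtain j where j: "j \<in> idx A" "Max (f ` idx A) = f j" by blast
  have "f i \<le> f j" if "i \<in> idx A" for i
    unfolding j(2)[symmetric] using finite_idx that by (intro Max_ge) auto
  then have "j \<in> S" using j by (simp add: S_def)
  then have "cold_tie R y s S \<in> S" using R unfolding valid_cold_rule_def by blast
  then have "cold_insert A R y s z \<in> S" by (simp add: cold_insert_def S_def f_def)
  moreover obtain i where i: "i \<in> idx A" "0 < f i - (y - z) \<bullet> z"
    using z(2) by (auto simp: verified_def split not_le)
  ultimately show ?thesis by (fastforce simp: violators_def split S_def)
qed

lemma warm_insert_violator:
  assumes "valid_warm_rule A W" "\<not> verified A y z"
  shows "warm_insert A W k J y s z \<in> violators A y z"
proof -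
  define S where "S = violators A y z"
  define T where "T = (if S \<inter> J \<noteq> {} then S \<inter> J else S)"
  have "S \<noteq> {}" using assms(2) by (auto simp: S_def verified_def violators_def not_le)
  then have "T \<noteq> {}" by (simp add: T_def)
  then have "warm_tie W k y s T \<in> T"
    using assms(1)[unfolded valid_warm_rule_def, THEN conjunct2, rule_format] by simp
  moreover have "T \<subseteq> S" by (auto simp: T_def)
  ultimately have "warm_tie W k y s T \<in> S" by blast
  then show ?thesis unfolding warm_insert_def Let_def T_def S_def .
qed

lemma cold_wolfe_ok:
  assumes y: "y \<in> carrier_vec n" and R: "valid_cold_rule A R"
  shows "\<exists>p. cold_wolfe A R y = Some p \<and> proj_ok y p"
proof -
  let ?i = "start R y" and ?b = "\<lambda>s. \<not> wolfe_done A y s"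
  let ?c = "wolfe_step A y (cold_insert A R y)"
  let ?s = "(Major, {?i}, \<lambda>i. if i = ?i then 1 else 0) :: phase \<times> active"
  have step: "wolfe_inv y (?c s) \<and> wolfe_measure y (?c s) < wolfe_measure y s"
    if "wolfe_inv y s" "?b s" for s
    using wolfe_step_inv[OF y that, of "cold_insert A R y"]
      cold_insert_violator[OF y R comb_carrier] by blast
  have "?i \<in> idx A" using R by (simp add: valid_cold_rule_def)
  then have init: "wolfe_inv y ?s"
    by (simp add: wolfe_inv_def is_corral_def active_ok_def affine_projection_def lincomb_on_def
        affinely_independent_singleton)
  from measure_while_option_Some[where P = "wolfe_inv y" and f = "wolfe_measure y" and b = ?b and c = ?c,
      OF step init]
  obtain t where t: "while_option ?b ?c ?s = Some t" ..
  have "wolfe_inv y t"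
    by (rule while_option_rule[where P = "wolfe_inv y" and b = ?b and c = ?c, OF conjunct1[OF step] t init])
  then have "proj_ok y (wolfe_result A t)"
    using while_option_stop[OF t] by (intro wolfe_result_ok) auto
  then show ?thesis by (simp add: cold_wolfe_def t)
qed

text \<open>The step counter only adds an exit, and the measure ignores it; so the call also ends
  under an infinite limit. Nothing is claimed about a result cut off by the limit.\<close>

lemma warm_wolfe_ok:
  assumes y: "y \<in> carrier_vec n" and W: "valid_warm_rule A W" and corral: "is_corral y s0"
  shows "\<exists>p ok. warm_wolfe A W k y s0 = Some (p, ok) \<and> (ok \<longrightarrow> proj_ok y p)"
proof -
  let ?b = "\<lambda>(l, s). \<not> wolfe_done A y s \<and> enat l < step_limit W k"
  let ?c = "\<lambda>(l, s). (Suc l, wolfe_step A y (warm_insert A W k (cands W k (fst s0)) y) s)"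
  let ?s = "(0, Major, s0) :: nat \<times> phase \<times> active"
  let ?P = "\<lambda>(l::nat, s). wolfe_inv y s" and ?f = "\<lambda>(l::nat, s). wolfe_measure y s"
  have step: "?P (?c s) \<and> ?f (?c s) < ?f s" if "?P s" "?b s" for s
  proof -
    obtain l t where s: "s = (l, t)" by (cases s)
    have "wolfe_inv y t" "\<not> wolfe_done A y t" using that s by auto
    from wolfe_step_inv[OF y this, of "warm_insert A W k (cands W k (fst s0)) y"]
    show ?thesis using warm_insert_violator[OF W] by (simp add: s)
  qed
  have init: "?P ?s" using corral by (cases s0) (simp add: wolfe_inv_def)
  from measure_while_option_Some[where P = ?P and f = ?f and b = ?b and c = ?c, OF step init]
  obtain t where t: "while_option ?b ?c ?s = Some t" ..
  have "?P t"
    by (rule while_option_rule[where P = ?P and b = ?b and c = ?c, OF conjunct1[OF step] t init])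
  then show ?thesis
    by (cases t) (auto simp: warm_wolfe_def t intro: wolfe_result_ok)
qed

text \<open>The stored corral belongs to the previous target; what remains valid for
  \<open>y\<close> is its independence and the positivity of its weights. Each reduction preserves
  both and removes a generator.\<close>

lemma repair_ok:
  assumes y: "y \<in> carrier_vec n" and ok: "active_ok (C, w)" and pos: "\<forall>i\<in>C. 0 < w i"
  shows "\<exists>s. repair A y (C, w) = Some s \<and> is_corral y s"
proof -
  let ?b = "\<lambda>(C, w). \<not> aff_positive A y C"
  let ?P = "\<lambda>(C, w). active_ok (C, w) \<and> (\<forall>i\<in>C. 0 < w i)"
  let ?f = "\<lambda>(C, w :: nat \<Rightarrow> real). card C"
  have step: "?P (reduce A y s) \<and> ?f (reduce A y s) < ?f s" if "?P s" "?b s" for s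
  proof -
    obtain C w where s: "s = (C, w)" by (cases s)
    have ok: "active_ok (C, w)" and pos: "\<forall>i\<in>C. 0 < w i" and neg: "\<not> aff_positive A y C"
      using that s by auto
    obtain C' w' where r: "reduce A y (C, w) = (C', w')" "active_ok (C', w')"
      "\<forall>i\<in>C'. 0 < w' i" "C' \<subset> C"
      using reduce_step[OF y ok neg] pos by metis
    then have "card C' < card C" using active_ok_finite[OF ok] by (intro psubset_card_mono)
    then show ?thesis using r by (simp add: s)
  qed
  have init: "?P (C, w)" using ok pos by simp
  from measure_while_option_Some[where P = ?P and f = ?f and b = ?b and c = "reduce A y", OF step init]
  obtain t where t: "while_option ?b (reduce A y) (C, w) = Some t" ..
  have "?P t"
    by (rule while_option_rule[where P = ?P and b = ?b and c = "reduce A y", OF conjunct1[OF step] t init])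
  moreover have "\<not> ?b t" using while_option_stop[OF t] .
  ultimately show ?thesis
    using is_corral_aff_weights[OF _ y] by (cases t) (auto simp: repair_def t)
qed

text \<open>Adding the variational inequalities of the two points gives a nonpositive squared
  distance. Corrals and weights may well differ.\<close>

lemma proj_ok_unique:
  assumes y: "y \<in> carrier_vec n" and p: "proj_ok y (z, C, w)" "proj_ok y (z', C', w')"
  shows "z = z'"
proof -
  have z: "z = comb A C w" "z' = comb A C' w'" and c: "is_corral y (C, w)" "is_corral y (C', w')"
    and v: "verified A y z" "verified A y z'"
    using p by (auto simp: proj_ok_def)
  have le: "inner (E y - E z) (E z') \<le> inner (E y - E z) (E z)"
    if "verified A y z" "z' = comb A C' w'" "is_corral y (C', w')" "z \<in> carrier_vec n" for z z' C' w'
    unfolding that(2) fseq_of_comb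
    using that verified_inner[OF y that(4)]
    by (intro inner_lincomb_on_le) (auto simp: is_corral_def active_ok_def)
  have zc: "z \<in> carrier_vec n" "z' \<in> carrier_vec n" using z comb_carrier by auto
  have "inner (E z - E z') (E z - E z') \<le> 0"
    using le[OF v(1) z(2) c(2) zc(1)] le[OF v(2) z(1) c(1) zc(2)]
    by (simp add: inner_diff_left inner_diff_right inner_commute)
  then have "E z - E z' = 0"
    using inner_ge_zero[of "E z - E z'"] inner_eq_zero_iff[of "E z - E z'"] by linarith
  then show ?thesis using fseq_of_vec_inject[OF zc] by simp
qed

section \<open>The outer loop\<close>

text \<open>Second disjunct: the previous hyperplane supports the polytope and cuts the ray at the
  current radius. The first one holds initially.\<close>

definition radius_inv :: "real vec \<Rightarrow> real \<Rightarrow> real vec \<Rightarrow> real \<Rightarrow> bool" where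
  "radius_inv c \<rho> d h \<longleftrightarrow> 0 < \<rho> \<and>
     ((\<forall>i\<in>idx A. c \<bullet> gen A i < \<rho>) \<or>
      (d \<in> carrier_vec n \<and> 0 < h \<and> 0 < d \<bullet> c \<and> \<rho> = h / (d \<bullet> c) \<and> (\<forall>i\<in>idx A. d \<bullet> gen A i \<le> h)))"

text \<open>Generator \<open>i\<close> is row \<open>i - 1\<close>, so sums over a corral are
  shifted to sums over rows.\<close>

lemma sum_generators:
  assumes "C \<subseteq> {0..m}" "0 \<in> C \<Longrightarrow> f 0 = 0"
  shows "sum f C = (\<Sum>i<m. if Suc i \<in> C then f (Suc i) else 0 :: real)"
proof -
  have "sum f C = (\<Sum>i\<in>{..<Suc m}. if i \<in> C then f i else 0)"
    using assms(1) by (intro sum.mono_neutral_cong_left) auto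
  also have "\<dots> = (\<Sum>i<m. if Suc i \<in> C then f (Suc i) else 0)"
    using assms(2) by (subst sum.lessThan_Suc_shift) simp
  finally show ?thesis .
qed

lemma scalar_prod_comb:
  assumes "x \<in> carrier_vec n"
  shows "x \<bullet> comb A C w = (\<Sum>i\<in>C. w i * (x \<bullet> gen A i))"
  using inner_lincomb_on[of "E x" V C w]
  by (simp add: fseq_of_comb[symmetric] inner_fseq_of_vec[OF assms comb_carrier] V_def
      inner_fseq_of_vec[OF assms gen_carrier])

lemma verified_support:
  assumes "y \<in> carrier_vec n" "z \<in> carrier_vec n" "verified A y z" "i \<in> idx A"
  shows "(y - z) \<bullet> gen A i \<le> (y - z) \<bullet> z"
  using assms gen_carrier[of i]
  by (auto simp: verified_def scalar_prod_minus_distrib[of _ n])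

text \<open>The final tests never reject, so the outcome is decided by comparing \<open>z\<close>
  with \<open>y\<close> and \<open>h'\<close> with 0. In the optimal case this is complementary
  slackness: the previous hyperplane is tight on the whole corral, and primal and dual value are
  both \<open>1 / \<rho>\<close>.\<close>

lemma status_update_cases:
  assumes c: "c \<in> carrier_vec n" "c \<bullet> c = 1" and inv: "radius_inv c \<rho> d h"
    and p: "proj_ok (\<rho> \<cdot>\<^sub>v c) (z, C, w)"
  defines "y \<equiv> \<rho> \<cdot>\<^sub>v c" and "d' \<equiv> \<rho> \<cdot>\<^sub>v c - z"
  defines "h' \<equiv> d' \<bullet> z"
  shows "z = y \<Longrightarrow> \<exists>r. is_Optimal r \<and> status_update A c \<rho> d h (z, C, w) mem = Stopped r"
    and "z \<noteq> y \<Longrightarrow> 0 \<le> h' \<and> 0 < d' \<bullet> c"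
    and "z \<noteq> y \<Longrightarrow> h' = 0 \<Longrightarrow>
      \<exists>r. is_Unbounded r \<and> status_update A c \<rho> d h (z, C, w) mem = Stopped r"
    and "z \<noteq> y \<Longrightarrow> h' \<noteq> 0 \<Longrightarrow>
      status_update A c \<rho> d h (z, C, w) mem = Running (h' / (d' \<bullet> c)) d' h' mem
      \<and> radius_inv c (h' / (d' \<bullet> c)) d' h'"
proof -
  define m where "m = dim_row A"
  have idx: "idx A = {0..m}" by (simp add: idx_def m_def)
  have z: "z = comb A C w" and corral: "is_corral y (C, w)" and v: "verified A y z"
    using p by (auto simp: proj_ok_def y_def)
  have CI: "C \<subseteq> {0..m}" and w: "sum w C = 1" "\<forall>i\<in>C. 0 < w i"
    using corral by (auto simp: is_corral_def active_ok_def idx)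
  have zc: "z \<in> carrier_vec n" using comb_carrier z by simp
  have yc: "y \<in> carrier_vec n" using c by (simp add: y_def)
  have d': "d' = y - z" by (simp add: d'_def y_def)
  have d'c: "d' \<in> carrier_vec n" using yc zc by (simp add: d')
  have \<rho>: "0 < \<rho>" using inv by (simp add: radius_inv_def)
  have sup: "d' \<bullet> gen A i \<le> h'" if "i \<in> idx A" for i
    using verified_support[OF yc zc v that] by (simp add: d' h'_def)
  have gen0: "x \<bullet> gen A 0 = 0" if "x \<in> carrier_vec n" for x
    using that dim_col_A by (simp add: gen_def)
  \<comment> \<open>The origin is a generator, so a supporting hyperplane has nonnegative
    height.\<close>
  have h'0: "0 \<le> h'" using sup[of 0] gen0[OF d'c] by (simp add: idx)
  show pos: "0 \<le> h' \<and> 0 < d' \<bullet> c" if "z \<noteq> y"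
  proof -
    have "E y - E z \<noteq> 0" using that fseq_of_vec_inject[OF yc zc] by auto
    then have "0 < inner (E y - E z) (E y - E z)" by simp
    also have "\<dots> = d' \<bullet> d'"
      by (simp add: d' fseq_of_vec_diff[OF yc zc, symmetric] inner_fseq_of_vec[of _ n] yc zc)
    also have "\<dots> = d' \<bullet> y - h'"
      unfolding h'_def by (subst (2) d') (use d'c yc zc in \<open>simp add: scalar_prod_minus_distrib[of _ n]\<close>)
    also have "d' \<bullet> y = \<rho> * (d' \<bullet> c)" using c d'c by (simp add: y_def)
    finally have "0 < \<rho> * (d' \<bullet> c)" using h'0 by simp
    then show ?thesis using \<rho> h'0 by (simp add: zero_less_mult_iff)
  qed
  show "\<exists>r. is_Unbounded r \<and> status_update A c \<rho> d h (z, C, w) mem = Stopped r"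
    if "z \<noteq> y" "h' = 0"
  proof -
    let ?a = "c \<bullet> d'"
    have a: "0 < ?a" using pos that comm_scalar_prod[OF c(1) d'c] by simp
    have "A *\<^sub>v ((1 / ?a) \<cdot>\<^sub>v d') \<le> 0\<^sub>v (dim_row A)"
    proof -
      have "row A i \<bullet> ((1 / ?a) \<cdot>\<^sub>v d') \<le> 0" if i: "i < m" for i
      proof -
        have "row A i \<bullet> d' \<le> 0"
          using sup[of "Suc i"] i \<open>h' = 0\<close> comm_scalar_prod[OF gen_carrier d'c, of "Suc i"]
          by (simp add: idx gen_def)
        then show ?thesis
          using a d'c gen_carrier[of "Suc i"] by (simp add: gen_def divide_nonpos_pos)
      qed
      then show ?thesis by (simp add: less_eq_vec_def m_def)
    qed
    moreover have "c \<bullet> ((1 / ?a) \<cdot>\<^sub>v d') = 1" using a c d'c by simp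
    ultimately have "recession_conditions A c ((1 / ?a) \<cdot>\<^sub>v d')"
      by (simp add: recession_conditions_def)
    then show ?thesis
      using that by (simp add: status_update_def Let_def unbounded_result_def y_def[symmetric]
          d'[symmetric] h'_def)
  qed
  show "status_update A c \<rho> d h (z, C, w) mem = Running (h' / (d' \<bullet> c)) d' h' mem
      \<and> radius_inv c (h' / (d' \<bullet> c)) d' h'" if "z \<noteq> y" "h' \<noteq> 0"
    using that pos sup d'c
    by (simp add: status_update_def Let_def y_def[symmetric] d'[symmetric] h'_def[symmetric]
        radius_inv_def)
  show "\<exists>r. is_Optimal r \<and> status_update A c \<rho> d h (z, C, w) mem = Stopped r" if zy: "z = y"
  proof -
    have finC: "finite C" and Cne: "C \<noteq> {}" using CI w finite_subset by auto
    \<comment> \<open>For \<open>z = y\<close> the radius is a convex combination of the numbers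
      \<open>c \<bullet> gen A i\<close>. This excludes the initial situation, so a previous
      hyperplane is available.\<close>
    have "\<not> (\<forall>i\<in>idx A. c \<bullet> gen A i < \<rho>)"
    proof
      assume *: "\<forall>i\<in>idx A. c \<bullet> gen A i < \<rho>"
      have "\<rho> = c \<bullet> z" using c by (simp add: zy y_def)
      also have "\<dots> = (\<Sum>i\<in>C. w i * (c \<bullet> gen A i))"
        unfolding z by (rule scalar_prod_comb[OF c(1)])
      also have "\<dots> < (\<Sum>i\<in>C. w i * \<rho>)"
        using * w CI finC Cne by (intro sum_strict_mono mult_strict_left_mono) (auto simp: idx)
      also have "\<dots> = \<rho>" using w by (simp flip: sum_distrib_right)
      finally show False by simp
    qed
    then have dc: "d \<in> carrier_vec n" and h: "0 < h" and dpos: "0 < d \<bullet> c"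
      and \<rho>_eq: "\<rho> = h / (d \<bullet> c)" and dsup: "\<forall>i\<in>idx A. d \<bullet> gen A i \<le> h"
      using inv by (auto simp: radius_inv_def)
    have "d \<bullet> z = h" using c dc dpos by (simp add: zy y_def \<rho>_eq)
    \<comment> \<open>The previous hyperplane passes through \<open>z\<close>, and a vanishing sum
      of nonnegative terms makes every generator of the corral tight.\<close>
    then have "(\<Sum>i\<in>C. w i * (h - d \<bullet> gen A i)) = 0"
      using w scalar_prod_comb[OF dc, of C w]
      by (simp add: z right_diff_distrib sum_subtractf flip: sum_distrib_right)
    then have "\<forall>i\<in>C. w i * (h - d \<bullet> gen A i) = 0"
      using w dsup CI finC by (subst (asm) sum_nonneg_eq_0_iff) (auto simp: idx less_imp_le)
    then have tight: "d \<bullet> gen A i = h" if "i \<in> C" for i using that w by fastforce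
    \<comment> \<open>The origin is not on a hyperplane of positive height, so no weight is lost
      when the dual vector leaves out index 0.\<close>
    have C0: "0 \<notin> C" using tight gen0[OF dc] h by auto
    define u where "u = vec m (\<lambda>i. if Suc i \<in> C then w (Suc i) / \<rho> else 0)"
    define x where "x = (1 / h) \<cdot>\<^sub>v d"
    have xc: "x \<in> carrier_vec n" using dc by (simp add: x_def)
    have cx: "c \<bullet> x = 1 / \<rho>"
      using c dc h comm_scalar_prod[OF c(1) dc] by (simp add: x_def \<rho>_eq)
    have "A *\<^sub>v x \<le> ones m"
    proof -
      have "row A i \<bullet> x \<le> 1" if i: "i < m" for i
      proof -
        have "row A i \<bullet> d \<le> h"
          using dsup i comm_scalar_prod[OF gen_carrier dc, of "Suc i"]
          by (auto simp: idx gen_def dest!: bspec[of _ _ "Suc i"])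
        then show ?thesis
          using h dc gen_carrier[of "Suc i"] by (simp add: gen_def x_def)
      qed
      then show ?thesis by (simp add: less_eq_vec_def m_def ones_def)
    qed
    moreover have "0\<^sub>v m \<le> u"
      using w \<rho> by (auto simp: less_eq_vec_def u_def less_imp_le)
    moreover have "A\<^sup>T *\<^sub>v u = c"
    proof (rule eq_vecI)
      show "dim_vec (A\<^sup>T *\<^sub>v u) = dim_vec c" using c dim_col_A by simp
      fix l assume "l < dim_vec c"
      then have l: "l < n" using c by simp
      have "(A\<^sup>T *\<^sub>v u) $ l = (\<Sum>i<m. A $$ (i, l) * u $ i)"
        using l dim_col_A
        by (simp add: scalar_prod_def u_def m_def atLeast0LessThan)
      also have "\<dots> = (\<Sum>i<m. if Suc i \<in> C then w (Suc i) / \<rho> * gen A (Suc i) $ l else 0)"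
        using l dim_col_A by (intro sum.cong) (auto simp: u_def gen_def m_def)
      also have "\<dots> = (\<Sum>i\<in>C. w i / \<rho> * gen A i $ l)"
        using CI C0 by (intro sum_generators[symmetric]) auto
      also have "\<dots> = (\<Sum>i\<in>C. w i * gen A i $ l) / \<rho>"
        by (simp add: sum_divide_distrib)
      also have "\<dots> = z $ l / \<rho>" using l dim_col_A by (simp add: z comb_def)
      also have "\<dots> = c $ l" using l c \<rho> by (simp add: zy y_def)
      finally show "(A\<^sup>T *\<^sub>v u) $ l = c $ l" .
    qed
    moreover have "ones m \<bullet> u = 1 / \<rho>"
    proof -
      have "ones m \<bullet> u = (\<Sum>i<m. if Suc i \<in> C then w (Suc i) / \<rho> else 0)"
        by (simp add: scalar_prod_def ones_def u_def atLeast0LessThan)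
      also have "\<dots> = (\<Sum>i\<in>C. w i / \<rho>)"
        using CI C0 by (intro sum_generators[symmetric]) auto
      also have "\<dots> = 1 / \<rho>" using w by (simp flip: sum_divide_distrib)
      finally show ?thesis .
    qed
    ultimately have "optimality_conditions A c x u"
      using cx by (simp add: optimality_conditions_def m_def)
    then show ?thesis
      using \<rho> zy by (simp add: status_update_def Let_def optimal_result_def y_def[symmetric]
          x_def u_def m_def)
  qed
qed


text \<open>Independent of the target. Before iteration 0 the memory is a placeholder with an empty
  active set, and that iteration is always cold.\<close>

definition mem_ok :: "nat \<Rightarrow> cr_mem \<Rightarrow> bool" where
  "mem_ok k = (\<lambda>((C, w), _). k = 0 \<or> active_ok (C, w) \<and> (\<forall>i\<in>C. 0 < w i))"

lemma proj_ok_mem_ok: "proj_ok y p \<Longrightarrow> mem_ok k (snd p, b)"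
  by (cases p) (simp add: proj_ok_def mem_ok_def is_corral_def)

lemma p_projection_ok:
  assumes "y \<in> carrier_vec n" "valid_cold_rule A R"
  shows "\<exists>p. p_projection A R k y mem = Some (p, ()) \<and> proj_ok y p"
  using cold_wolfe_ok[OF assms] by (auto simp: p_projection_def)

lemma cr_projection_ok:
  assumes y: "y \<in> carrier_vec n" and R: "valid_cold_rule A R" and W: "valid_warm_rule A W"
    and mem: "mem_ok k mem"
  shows "\<exists>p mem'. cr_projection A R W B k y mem = Some (p, mem') \<and> proj_ok y p \<and> mem_ok (Suc k) mem'"
proof -
  obtain C w b where m: "mem = ((C, w), b)" by (cases mem) auto
  have cold: "\<exists>p mem'. cold_with_mem A R y b' = Some (p, mem') \<and> proj_ok y p \<and> mem_ok (Suc k) mem'"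
    for b'
    using cold_wolfe_ok[OF y R] proj_ok_mem_ok by (auto simp: cold_with_mem_def)
  show ?thesis
  proof (cases "k = 0 \<or> B \<le> k \<or> b")
    case True
    then show ?thesis using cold by (auto simp: cr_projection_def m)
  next
    case False
    then have "active_ok (C, w)" "\<forall>i\<in>C. 0 < w i" using mem m by (auto simp: mem_ok_def)
    then obtain s where s: "repair A y (C, w) = Some s" "is_corral y s"
      using repair_ok[OF y] by blast
    obtain p ok where p: "warm_wolfe A W k y s = Some (p, ok)" "ok \<longrightarrow> proj_ok y p"
      using warm_wolfe_ok[OF y W s(2)] by blast
    show ?thesis
    proof (cases ok)
      case True
      then show ?thesis
        using False p s proj_ok_mem_ok[of y p] by (auto simp: cr_projection_def m)
    next
      case False
      then show ?thesis
        using \<open>\<not> (k = 0 \<or> B \<le> k \<or> b)\<close> p s cold[of True] by (simp add: cr_projection_def m)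
    qed
  qed
qed

text \<open>A simulation: while both methods run, their states differ in the memory only. Stops and
  new radii are decided by the point \<open>z\<close>, shared by \<open>proj_ok_unique\<close>.
  Different weights can change the returned dual vector, which \<open>same_status\<close>
  ignores.\<close>

lemma runs_agree:
  fixes R W B \<rho>0
  assumes c: "c \<in> carrier_vec n" "c \<bullet> c = 1" and R: "valid_cold_rule A R" and W: "valid_warm_rule A W"
    and init: "\<forall>i\<in>idx A. c \<bullet> gen A i < \<rho>0"
  defines "P \<equiv> p_lpn A c R \<rho>0" and "CR \<equiv> cr_p_lpn A c R W B \<rho>0"
  shows "(\<exists>\<rho> d h mem. P k = Running \<rho> d h () \<and> CR k = Running \<rho> d h mem \<and>
      radius_inv c \<rho> d h \<and> mem_ok k mem) \<or>
    (\<exists>r r'. P k = Stopped r \<and> CR k = Stopped r' \<and> same_status r r')"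
proof (induction k)
  case 0
  have "c \<bullet> gen A 0 = 0" using c dim_col_A by (simp add: gen_def)
  then have "0 < \<rho>0" using init[rule_format, of 0] by (simp add: idx_def)
  then show ?case
    using init by (simp add: P_def CR_def p_lpn_def cr_p_lpn_def mem_ok_def radius_inv_def)
next
  case (Suc k)
  then show ?case
  proof (elim disjE exE conjE)
    fix r r' assume "P k = Stopped r" "CR k = Stopped r'" "same_status r r'"
    then show ?thesis by (simp add: P_def CR_def p_lpn_def cr_p_lpn_def)
  next
    fix \<rho> d h mem
    assume P: "P k = Running \<rho> d h ()" and CR: "CR k = Running \<rho> d h mem"
      and inv: "radius_inv c \<rho> d h" and mem: "mem_ok k mem"
    define y where "y = \<rho> \<cdot>\<^sub>v c"
    have y: "y \<in> carrier_vec n" using c by (simp add: y_def)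
    obtain p where p: "p_projection A R k y () = Some (p, ())" "proj_ok y p"
      using p_projection_ok[OF y R] by blast
    obtain q mem' where q: "cr_projection A R W B k y mem = Some (q, mem')" "proj_ok y q"
      "mem_ok (Suc k) mem'"
      using cr_projection_ok[OF y R W mem] by blast
    have PS: "P (Suc k) = status_update A c \<rho> d h p ()"
      using P p by (simp add: P_def p_lpn_def y_def)
    have CRS: "CR (Suc k) = status_update A c \<rho> d h q mem'"
      using CR q by (simp add: CR_def cr_p_lpn_def y_def)
    obtain z C w where pz: "p = (z, C, w)" by (cases p)
    obtain z' C' w' where qz: "q = (z', C', w')" by (cases q)
    have zz: "z' = z" using proj_ok_unique[OF y] p q pz qz by blast
    note sp = status_update_cases[OF c inv, of z C w, folded y_def, OF p(2)[unfolded pz]]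
    note sq = status_update_cases[OF c inv, of z C' w', folded y_def, OF q(2)[unfolded qz zz]]
    consider "z = y" | "z \<noteq> y" "(y - z) \<bullet> z = 0" | "z \<noteq> y" "(y - z) \<bullet> z \<noteq> 0" by blast
    then show ?thesis
    proof cases
      case 1
      then show ?thesis
        using sp(1)[of "()"] sq(1)[of mem'] by (auto simp: PS CRS pz qz zz same_status_def)
    next
      case 2
      then show ?thesis
        using sp(3)[of "()"] sq(3)[of mem'] by (auto simp: PS CRS pz qz zz same_status_def)
    next
      case 3
      then show ?thesis
        using sp(4)[of "()"] sq(4)[of mem'] q(3) by (auto simp: PS CRS pz qz zz)
    qed
  qed
qed

section \<open>P-LPN as an instance of the Newton iteration\<close>

definition radius :: "(nat \<Rightarrow> unit outer) \<Rightarrow> nat \<Rightarrow> real" where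
  "radius run k = (case run k of Running \<rho> d h _ \<Rightarrow> \<rho> | _ \<Rightarrow> 0)"

text \<open>P-LPN does not store its corrals; as the cold call is a function of the target, they are
  recovered by calling it again. Since \<open>P K\<close> is running, each step before
  \<open>K\<close> took the branch that computes a new radius.\<close>

lemma p_lpn_radius_newton:
  fixes R \<rho>0
  assumes c: "c \<in> carrier_vec n" "c \<bullet> c = 1" and R: "valid_cold_rule A R"
    and init: "\<forall>i\<in>idx A. c \<bullet> gen A i < \<rho>0"
    and W: "valid_warm_rule A W"
  defines "P \<equiv> p_lpn A c R \<rho>0"
  defines "S \<equiv> \<lambda>k. snd (the (cold_wolfe A R (radius P k \<cdot>\<^sub>v c)))"
  assumes K: "is_Running (P K)"
  shows "radius_newton V (idx A) (E c) (radius P) (\<lambda>k. fst (S k)) (\<lambda>k. snd (S k)) K"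
    and "k < K \<Longrightarrow> active_ok (S k)"
proof -
  have running: "is_Running (P k)" if "k \<le> K" for k
    using K that
  proof (induction K)
    case (Suc K)
    have "is_Running (P K)"
      using Suc.prems(1) by (auto simp: P_def p_lpn_def split: outer.splits)
    then show ?case using Suc by (cases "k = Suc K") auto
  qed simp
  have step: "\<exists>z C w. S k = (C, w) \<and> z = comb A C w \<and> is_corral (radius P k \<cdot>\<^sub>v c) (C, w) \<and>
      verified A (radius P k \<cdot>\<^sub>v c) z \<and> 0 < radius P k \<and> z \<noteq> radius P k \<cdot>\<^sub>v c \<and>
      0 \<le> (radius P k \<cdot>\<^sub>v c - z) \<bullet> z \<and>
      radius P (Suc k) = ((radius P k \<cdot>\<^sub>v c - z) \<bullet> z) / ((radius P k \<cdot>\<^sub>v c - z) \<bullet> c)"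
    if k: "k < K" for k
  proof -
    obtain \<rho> d h where Pk: "P k = Running \<rho> d h ()" and inv: "radius_inv c \<rho> d h"
      \<comment> \<open>Only the P-LPN half of the simulation is extracted; the reuse limit 0 is an
        arbitrary choice.\<close>
      using runs_agree[OF c R W init, where B = 0 and k = k] running[of k] k by (auto simp: P_def)
    define y where "y = \<rho> \<cdot>\<^sub>v c"
    have y: "y \<in> carrier_vec n" using c by (simp add: y_def)
    obtain p where p: "cold_wolfe A R y = Some p" "proj_ok y p"
      using cold_wolfe_ok[OF y R] by blast
    obtain z C w where pz: "p = (z, C, w)" by (cases p)
    have rad: "radius P k = \<rho>" by (simp add: radius_def Pk)
    have PS: "P (Suc k) = status_update A c \<rho> d h (z, C, w) ()"
      using Pk p by (simp add: P_def p_lpn_def y_def p_projection_def pz)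
    have run: "is_Running (P (Suc k))" using running k by simp
    note sp = status_update_cases[OF c inv, of z C w, folded y_def, OF p(2)[unfolded pz]]
    have zy: "z \<noteq> y" using sp(1)[of "()"] run by (auto simp: PS)
    have hne: "(y - z) \<bullet> z \<noteq> 0" using sp(3)[of "()"] zy run by (auto simp: PS)
    have "radius P (Suc k) = ((y - z) \<bullet> z) / ((y - z) \<bullet> c)"
      using sp(4)[of "()"] zy hne by (simp add: radius_def PS)
    moreover have "S k = (C, w)" using p by (simp add: S_def rad y_def[symmetric] pz)
    ultimately show ?thesis
      using p(2) inv zy sp(2) by (auto simp: pz proj_ok_def rad y_def[symmetric] radius_inv_def)
  qed
  have residual: "radius P k *\<^sub>R E c - lincomb_on V (fst (S k)) (snd (S k))
      = E (radius P k \<cdot>\<^sub>v c) - E (comb A (fst (S k)) (snd (S k)))" for k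
    by (simp add: fseq_of_comb fseq_of_vec_smult)
  have inner_E: "inner (E x - E z) (E u) = (x - z) \<bullet> u"
    if "x \<in> carrier_vec n" "z \<in> carrier_vec n" "u \<in> carrier_vec n" for x z u
    using that by (simp add: fseq_of_vec_diff[symmetric] inner_fseq_of_vec[of _ n])
  show "k < K \<Longrightarrow> active_ok (S k)" using step[of k] by (auto simp: is_corral_def)
  show "radius_newton V (idx A) (E c) (radius P) (\<lambda>k. fst (S k)) (\<lambda>k. snd (S k)) K"
  proof (unfold_locales, goal_cases)
    case (1 k)
    then show ?case using step[of k] by (auto simp: is_corral_def active_ok_def)
  next
    case (2 k i)
    then show ?case using step[of k] by (auto simp: is_corral_def)
  next
    case (3 k)
    then show ?case using step[of k] by (auto simp: is_corral_def active_ok_def)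
  next
    case (4 k i)
    then obtain C w where "S k = (C, w)" "is_corral (radius P k \<cdot>\<^sub>v c) (C, w)"
      using step[of k] by blast
    then show ?case
      using 4 affine_projection_inner[of V "E (radius P k \<cdot>\<^sub>v c)" C w i]
      by (simp add: is_corral_def fseq_of_vec_smult)
  next
    case (5 k i)
    then obtain C w where "S k = (C, w)" "verified A (radius P k \<cdot>\<^sub>v c) (comb A C w)"
      using step[of k] by blast
    then show ?case
      using 5 c comb_carrier verified_inner[of "radius P k \<cdot>\<^sub>v c" "comb A C w"]
      by (simp add: fseq_of_vec_smult fseq_of_comb)
  next
    case (6 k)
    then obtain C w where "S k = (C, w)" "comb A C w \<noteq> radius P k \<cdot>\<^sub>v c"
      using step[of k] by blast
    then show ?case
      unfolding residual using c comb_carrier fseq_of_vec_inject[of "radius P k \<cdot>\<^sub>v c" n "comb A C w"]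
      by auto
  next
    case (7 k)
    then show ?case using step[of k] by blast
  next
    case (8 k)
    then obtain C w where "S k = (C, w)" "0 \<le> (radius P k \<cdot>\<^sub>v c - comb A C w) \<bullet> comb A C w"
      using step[of k] by blast
    then show ?case
      unfolding residual using c comb_carrier
      by (simp add: fseq_of_comb[symmetric] inner_E)
  next
    case (9 k)
    then obtain C w where "S k = (C, w)" "radius P (Suc k) =
        ((radius P k \<cdot>\<^sub>v c - comb A C w) \<bullet> comb A C w) / ((radius P k \<cdot>\<^sub>v c - comb A C w) \<bullet> c)"
      using step[of k] by auto
    then show ?case
      unfolding residual using c comb_carrier
      by (simp add: fseq_of_comb[symmetric] inner_E)
  qed
qed

end

text \<open>For \<open>c = \<gamma> / t\<close> with \<open>t\<close> the norm of
  \<open>\<gamma>\<close>, the new direction is \<open>D *\<^sub>R \<gamma>\<close>, free of the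
  irrational norm. Residuals are multiplied by \<open>D\<close>, and the corrals stay the
  same.\<close>

lemma (in radius_newton) rescale:
  assumes "0 < D" "0 < t"
  shows "radius_newton (\<lambda>i. D *\<^sub>R v i) I ((D * t) *\<^sub>R c) (\<lambda>k. \<rho> k / t) C w K"
proof -
  have z': "lincomb_on (\<lambda>i. D *\<^sub>R v i) (C k) (w k) = D *\<^sub>R z k" for k
    by (simp add: lincomb_on_def z_def scaleR_sum_right mult.commute)
  have d': "(\<rho> k / t) *\<^sub>R (D * t) *\<^sub>R c - lincomb_on (\<lambda>i. D *\<^sub>R v i) (C k) (w k) = D *\<^sub>R d k" for k
    unfolding z' residual_eq using assms by (simp add: scaleR_right_diff_distrib)
  show ?thesis
  proof (unfold_locales, goal_cases)
    case (4 k i)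
    then show ?case unfolding d' unfolding z' using face[of k i] by (simp add: h_def)
  next
    case (5 k i)
    then show ?case unfolding d' unfolding z' using support[of k i] assms
      by (simp add: h_def)
  next
    case (6 k)
    then show ?case unfolding d' using residual_nonzero assms by simp
  next
    case (8 k)
    then show ?case unfolding d' unfolding z' using height_nonneg[of k] assms by (simp add: h_def)
  next
    case (9 k)
    then show ?case unfolding d' unfolding z' using radius_Suc[of k] assms
      by (simp add: h_def s_def field_simps)
  qed (use subset weight_pos weight_sum radius_pos assms in auto)
qed

section \<open>Counting corrals\<close>

lemma card_small_subsets:
  assumes "finite I"
  shows "card {D. D \<subseteq> I \<and> D \<noteq> {} \<and> card D \<le> n + 1} = (\<Sum>j=1..min (n + 1) (card I). card I choose j)"
proof -
  have "{D. D \<subseteq> I \<and> D \<noteq> {} \<and> card D \<le> n + 1}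
      = (\<Union>j\<in>{1..min (n + 1) (card I)}. {D. D \<subseteq> I \<and> card D = j})"
  proof (intro equalityI subsetI)
    fix D assume "D \<in> {D. D \<subseteq> I \<and> D \<noteq> {} \<and> card D \<le> n + 1}"
    then have D: "D \<subseteq> I" "D \<noteq> {}" "card D \<le> n + 1" by auto
    moreover have "finite D" using D(1) assms by (rule finite_subset)
    ultimately have "card D \<in> {1..min (n + 1) (card I)}"
      using card_mono[OF assms D(1)] by (simp add: Suc_le_eq card_gt_0_iff)
    then show "D \<in> (\<Union>j\<in>{1..min (n + 1) (card I)}. {D. D \<subseteq> I \<and> card D = j})" using D by blast
  qed auto
  also have "card \<dots> = (\<Sum>j=1..min (n + 1) (card I). card {D. D \<subseteq> I \<and> card D = j})"
    by (rule card_UN_disjoint) (auto intro: finite_subset[OF _ finite_Pow_iff[THEN iffD2, OF assms]])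
  also have "\<dots> = (\<Sum>j=1..min (n + 1) (card I). card I choose j)"
    using assms by (simp add: n_subsets)
  finally show ?thesis .
qed

text \<open>The \<open>K\<close> steps before the stopping iteration have distinct corrals, each
  nonempty with at most \<open>n + 1\<close> elements. The summand 1 in \<open>corral_bound\<close>
  pays for the stopping iteration \<open>K\<close>, to which \<open>corral_inj\<close> does not
  apply.\<close>

lemma (in generators) running_less_corral_bound:
  assumes c: "c \<in> carrier_vec n" "c \<bullet> c = 1" and R: "valid_cold_rule A R"
    and init: "\<forall>i\<in>idx A. c \<bullet> gen A i < \<rho>0" and W: "valid_warm_rule A W"
    and K: "is_Running (p_lpn A c R \<rho>0 K)"
  shows "K < corral_bound (dim_row A + 1) n"
proof -
  define S where "S = (\<lambda>k. snd (the (cold_wolfe A R (radius (p_lpn A c R \<rho>0) k \<cdot>\<^sub>v c))))"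
  interpret radius_newton V "idx A" "E c" "radius (p_lpn A c R \<rho>0)" "\<lambda>k. fst (S k)" "\<lambda>k. snd (S k)" K
    "\<lambda>k. lincomb_on V (fst (S k)) (snd (S k))"
    "\<lambda>k. radius (p_lpn A c R \<rho>0) k *\<^sub>R E c - lincomb_on V (fst (S k)) (snd (S k))"
    "\<lambda>k. inner (radius (p_lpn A c R \<rho>0) k *\<^sub>R E c - lincomb_on V (fst (S k)) (snd (S k)))
      (lincomb_on V (fst (S k)) (snd (S k)))"
    "\<lambda>k. inner (radius (p_lpn A c R \<rho>0) k *\<^sub>R E c - lincomb_on V (fst (S k)) (snd (S k))) (E c)"
    unfolding S_def by (rule p_lpn_radius_newton(1)[OF c R init W K]) simp_all
  have ok: "active_ok (S k)" if "k < K" for k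
    using p_lpn_radius_newton(2)[OF c R init W K that] by (simp add: S_def)
  let ?T = "{D. D \<subseteq> idx A \<and> D \<noteq> {} \<and> card D \<le> n + 1}"
  have "fst (S k) \<in> ?T" if "k < K" for k
  proof -
    obtain C w where Sk: "S k = (C, w)" by (cases "S k")
    have ok': "active_ok (C, w)" using ok[OF that] Sk by simp
    then have CI: "C \<subseteq> idx A" and indep: "affinely_independent (\<lambda>i. E (gen A i)) C"
      by (simp_all add: active_ok_def V_def[abs_def])
    have "card C \<le> n + 1"
      by (rule affinely_independent_card_le[OF indep active_ok_finite[OF ok'] gen_carrier])
    then show ?thesis using CI active_ok_nonempty[OF ok'] by (simp add: Sk)
  qed
  then have "card ((\<lambda>k. fst (S k)) ` {..<K}) \<le> card ?T"
    by (intro card_mono finite_subsets) auto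
  then have "K \<le> card ?T" using card_image[OF corral_inj] by simp
  also have "\<dots> = (\<Sum>j=1..min (n + 1) (dim_row A + 1). (dim_row A + 1) choose j)"
    using card_small_subsets[OF finite_idx, of n] by (simp add: idx_def)
  finally show ?thesis by (simp add: corral_bound_def)
qed

section \<open>Encoding length\<close>

lemma quotient_of_bounds:
  "\<exists>a b. quotient_of q = (a, b) \<and> 0 < b \<and> real_of_rat q = a / b \<and>
    \<bar>real_of_int a\<bar> \<le> 2 ^ floorlog 2 (nat \<bar>a\<bar>) \<and> real_of_int b \<le> 2 ^ floorlog 2 (nat b) \<and>
    rat_bits q = floorlog 2 (nat \<bar>a\<bar>) + floorlog 2 (nat b)"
proof -
  obtain a b where q: "quotient_of q = (a, b)" by (cases "quotient_of q")
  have b: "0 < b" using quotient_of_denom_pos[OF q] .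
  have le: "real x \<le> 2 ^ floorlog 2 x" for x
  proof (cases "x = 0")
    case False
    then have "x < 2 ^ floorlog 2 x" using floorlog_bounds[of x 2] by simp
    then have "real x < real (2 ^ floorlog 2 x)" by (simp only: of_nat_less_iff)
    then show ?thesis by simp
  qed simp
  have "real_of_rat q = a / b" using quotient_of_div[OF q] by (simp add: of_rat_divide)
  moreover have "\<bar>real_of_int a\<bar> \<le> 2 ^ floorlog 2 (nat \<bar>a\<bar>)" using le[of "nat \<bar>a\<bar>"] by simp
  moreover have "real_of_int b \<le> 2 ^ floorlog 2 (nat b)" using le[of "nat b"] b by simp
  moreover have "rat_bits q = floorlog 2 (nat \<bar>a\<bar>) + floorlog 2 (nat b)"
    by (simp add: rat_bits_def q)
  ultimately show ?thesis using q b by blast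
qed

lemma rat_bits_ge_1: "1 \<le> rat_bits q"
proof -
  obtain a b where ab: "0 < b" "real_of_int b \<le> 2 ^ floorlog 2 (nat b)"
    "rat_bits q = floorlog 2 (nat \<bar>a\<bar>) + floorlog 2 (nat b)"
    using quotient_of_bounds[of q] by blast
  have "floorlog 2 (nat b) \<noteq> 0" using ab(1) by (simp add: floorlog_eq_zero_iff)
  then show ?thesis using ab(3) by simp
qed

lemma rat_le_bits: "real_of_rat q \<le> 2 ^ rat_bits q"
proof -
  obtain a b where ab: "0 < b" "real_of_rat q = a / b"
    "\<bar>real_of_int a\<bar> \<le> 2 ^ floorlog 2 (nat \<bar>a\<bar>)"
    "rat_bits q = floorlog 2 (nat \<bar>a\<bar>) + floorlog 2 (nat b)"
    using quotient_of_bounds[of q] by blast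
  have "real_of_rat q \<le> \<bar>real_of_int a\<bar> / b"
    unfolding ab(2) using ab(1) by (intro divide_right_mono) auto
  also have "\<dots> \<le> \<bar>real_of_int a\<bar> / 1"
    using ab(1) by (intro divide_left_mono) auto
  also have "\<dots> \<le> 2 ^ floorlog 2 (nat \<bar>a\<bar>)" using ab(3) by simp
  also have "\<dots> \<le> 2 ^ rat_bits q" unfolding ab(4) by (intro power_increasing) auto
  finally show ?thesis .
qed

text \<open>The product of all denominators serves as a common denominator; the scaled numerators still
  have at most as many bits as all the data together.\<close>

lemma common_denominator:
  fixes q :: "'s \<Rightarrow> rat"
  assumes "finite S" "(\<Sum>x\<in>S. rat_bits (q x)) \<le> L"
  obtains D :: real where "0 < D" "\<And>x. x \<in> S \<Longrightarrow> D * real_of_rat (q x) \<in> \<int>"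
    "\<And>x. x \<in> S \<Longrightarrow> \<bar>D * real_of_rat (q x)\<bar> \<le> 2 ^ L"
proof -
  define num where "num = (\<lambda>x. fst (quotient_of (q x)))"
  define den where "den = (\<lambda>x. snd (quotient_of (q x)))"
  have nd: "0 < den x \<and> real_of_rat (q x) = num x / den x \<and>
      \<bar>real_of_int (num x)\<bar> \<le> 2 ^ rat_bits (q x) \<and> real_of_int (den x) \<le> 2 ^ rat_bits (q x)" for x
  proof -
    obtain a b where ab: "quotient_of (q x) = (a, b)" "0 < b" "real_of_rat (q x) = a / b"
      "\<bar>real_of_int a\<bar> \<le> 2 ^ floorlog 2 (nat \<bar>a\<bar>)" "real_of_int b \<le> 2 ^ floorlog 2 (nat b)"
      "rat_bits (q x) = floorlog 2 (nat \<bar>a\<bar>) + floorlog 2 (nat b)"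
      using quotient_of_bounds[of "q x"] by blast
    have "(2::real) ^ floorlog 2 (nat \<bar>a\<bar>) \<le> 2 ^ rat_bits (q x)"
      "(2::real) ^ floorlog 2 (nat b) \<le> 2 ^ rat_bits (q x)"
      unfolding ab(6) by (intro power_increasing; simp)+
    then have "\<bar>real_of_int a\<bar> \<le> 2 ^ rat_bits (q x)" "real_of_int b \<le> 2 ^ rat_bits (q x)"
      using ab(4,5) by linarith+
    then show ?thesis using ab(1-3) by (simp add: num_def den_def)
  qed
  define D where "D = (\<Prod>x\<in>S. real_of_int (den x))"
  have "0 < D" unfolding D_def using nd by (intro prod_pos) auto
  moreover have eq: "D * real_of_rat (q x) = real_of_int (num x) * (\<Prod>x\<in>S - {x}. real_of_int (den x))"
    if "x \<in> S" for x
    using nd[of x] assms(1) that by (simp add: D_def prod.remove[of S x])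
  moreover have "\<bar>D * real_of_rat (q x)\<bar> \<le> 2 ^ L" if "x \<in> S" for x
  proof -
    have "\<bar>D * real_of_rat (q x)\<bar>
        = \<bar>real_of_int (num x)\<bar> * (\<Prod>x\<in>S - {x}. real_of_int (den x))"
    proof -
      have "0 \<le> (\<Prod>x\<in>S - {x}. real_of_int (den x))"
        using nd by (intro prod_nonneg) (simp add: less_imp_le)
      then show ?thesis by (simp add: eq[OF that] abs_mult)
    qed
    also have "\<dots> \<le> 2 ^ rat_bits (q x) * (\<Prod>x\<in>S - {x}. 2 ^ rat_bits (q x))"
      using nd by (intro mult_mono prod_mono prod_nonneg) (auto intro: less_imp_le)
    also have "\<dots> = (2::real) ^ (\<Sum>x\<in>S. rat_bits (q x))"
      using assms(1) that by (simp add: power_sum prod.remove[of S x])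
    also have "\<dots> \<le> 2 ^ L" using assms(2) by (intro power_increasing) auto
    finally show ?thesis .
  qed
  ultimately show thesis
    by (intro that[of D]) (auto simp: intro!: Ints_mult Ints_prod)
qed

text \<open>The exponent consists of \<open>L\<close> for each factor and \<open>L\<close> for the
  number of summands.\<close>

lemma scalar_prod_integral:
  fixes x y :: "real vec"
  assumes "x \<in> carrier_vec n" "y \<in> carrier_vec n" "n \<le> 2 ^ L"
    and "\<And>l. l < n \<Longrightarrow> x $ l \<in> \<int> \<and> \<bar>x $ l\<bar> \<le> 2 ^ L" "\<And>l. l < n \<Longrightarrow> y $ l \<in> \<int> \<and> \<bar>y $ l\<bar> \<le> 2 ^ L"
  shows "x \<bullet> y \<in> \<int>" "\<bar>x \<bullet> y\<bar> \<le> 2 ^ (3 * L)"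
proof -
  have xy: "x \<bullet> y = (\<Sum>l<n. x $ l * y $ l)"
    using assms by (simp add: scalar_prod_def atLeast0LessThan)
  show "x \<bullet> y \<in> \<int>" unfolding xy using assms by (intro Ints_sum Ints_mult) auto
  have "\<bar>x \<bullet> y\<bar> \<le> (\<Sum>l<n. 2 ^ L * 2 ^ L)"
    unfolding xy using assms
    by (intro order_trans[OF sum_abs] sum_mono) (auto simp: abs_mult intro!: mult_mono)
  also have "\<dots> = real n * (2 ^ L * 2 ^ L)" by simp
  also have "\<dots> \<le> 2 ^ L * (2 ^ L * 2 ^ L)"
  proof (rule mult_right_mono)
    have "real n \<le> real (2 ^ L)" using assms(3) by (simp only: of_nat_le_iff)
    then show "real n \<le> 2 ^ L" by simp
  qed simp
  also have "\<dots> = 2 ^ (L + (L + L))" by (simp only: power_add)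
  also have "L + (L + L) = 3 * L" by simp
  finally show "\<bar>x \<bullet> y\<bar> \<le> 2 ^ (3 * L)" .
qed

text \<open>Comparing exponents of 2: \<open>2 * L + 1\<close> for the two factors in
  \<open>t\<close>, \<open>3 * L\<close> for the bound on inner products, and three times
  \<open>(4 * L + 2) * (n + 1)\<close> for the Gram bound, where \<open>fact (n + 1)\<close> costs
  \<open>L * (n + 1)\<close>. The total is at most \<open>42 * n * L\<close>, against
  \<open>2 * k\<close>.\<close>

lemma bit_bound_arith:
  fixes t :: real
  assumes le: "4 ^ k \<le> (t + 1) * t * 2 ^ (3 * L) * (fact (n + 1) * (4 * 2 ^ (3 * L)) ^ (n + 1)) ^ 3"
    and t: "0 < t" "t \<le> 2 ^ L" and nL: "n + 1 \<le> L" "1 \<le> n"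
  shows "k \<le> 21 * n * L"
proof -
  have "fact (n + 1) \<le> real ((n + 1) ^ (n + 1))" by (rule fact_le_power)
  also have "\<dots> = real (n + 1) ^ (n + 1)" by (simp only: of_nat_power)
  also have "\<dots> \<le> (2 ^ L) ^ (n + 1)"
  proof (rule power_mono)
    have "n + 1 < 2 ^ (n + 1)" by (rule less_exp)
    also have "\<dots> \<le> 2 ^ L" using nL by (intro power_increasing) auto
    finally have "real (n + 1) \<le> real (2 ^ L)" by (simp only: of_nat_le_iff less_imp_le)
    then show "real (n + 1) \<le> 2 ^ L" by simp
  qed simp
  finally have f: "fact (n + 1) \<le> (2 ^ L :: real) ^ (n + 1)" .
  have "fact (n + 1) * (4 * 2 ^ (3 * L)) ^ (n + 1)
      \<le> (2 ^ L) ^ (n + 1) * (4 * 2 ^ (3 * L) :: real) ^ (n + 1)"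
    using f by (rule mult_right_mono) simp
  also have "\<dots> = (2 ^ (4 * L + 2)) ^ (n + 1)"
    by (simp only: power_mult_distrib[symmetric]) (simp add: power_add[symmetric] algebra_simps flip: power_mult)
  finally have b: "(fact (n + 1) * (4 * 2 ^ (3 * L)) ^ (n + 1)) ^ 3
      \<le> ((2 ^ (4 * L + 2)) ^ (n + 1) :: real) ^ 3"
    by (rule power_mono) simp
  have one: "(1::real) \<le> 2 ^ L" by simp
  have "(t + 1) * t \<le> (2 ^ L + 2 ^ L) * 2 ^ L"
    using t one by (intro mult_mono add_mono) auto
  also have "\<dots> = 2 * (2 ^ L)\<^sup>2" by (simp add: power2_eq_square)
  also have "\<dots> = 2 ^ (2 * L + 1)" by (simp add: power_mult[symmetric] mult.commute[of L])
  finally have tt: "(t + 1) * t \<le> 2 ^ (2 * L + 1)" .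
  have "(2::real) ^ (2 * k) = 4 ^ k" by (simp add: power_mult)
  also note le
  also have "(t + 1) * t * 2 ^ (3 * L) * (fact (n + 1) * (4 * 2 ^ (3 * L)) ^ (n + 1)) ^ 3
      \<le> 2 ^ (2 * L + 1) * 2 ^ (3 * L) * ((2 ^ (4 * L + 2)) ^ (n + 1)) ^ 3"
    using tt b t by (intro mult_mono) auto
  also have "\<dots> = 2 ^ (2 * L + 1 + 3 * L + (4 * L + 2) * (n + 1) * 3)"
    by (simp only: power_add power_mult)
  finally have "2 * k \<le> 2 * L + 1 + 3 * L + (4 * L + 2) * (n + 1) * 3"
    by (rule power_le_imp_le_exp[rotated]) simp
  also have "\<dots> \<le> 6 * L + 6 * L * (n + 1) * 3"
    using nL by (intro add_mono mult_right_mono) auto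
  also have "\<dots> = 24 * L + 18 * (n * L)" by (simp add: algebra_simps)
  also have "\<dots> \<le> 42 * (n * L)" using nL by simp
  finally show ?thesis by (simp add: mult_ac)
qed

lemma sum_bits_ge_card: "finite S \<Longrightarrow> card S \<le> (\<Sum>x\<in>S. rat_bits (q x))"
  using sum_mono[of S "\<lambda>_. 1" "\<lambda>x. rat_bits (q x)"] rat_bits_ge_1 by simp

text \<open>\<open>D\<close> clears the denominators of the generators and of
  \<open>\<gamma>\<close> only: the residual estimates work with radii determined by corrals, so
  \<open>t0\<close> enters just through its size.\<close>

lemma (in generators) running_le_encoding_length:
  fixes A' :: "rat mat" and \<gamma>' :: "rat vec" and t0' :: rat
  defines "\<gamma> \<equiv> map_vec real_of_rat \<gamma>'" and "t0 \<equiv> real_of_rat t0'"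
  assumes c: "c \<in> carrier_vec n" "c \<bullet> c = 1" and R: "valid_cold_rule A R"
    and init: "\<forall>i\<in>idx A. c \<bullet> gen A i < \<rho>0" and W: "valid_warm_rule A W"
    and K: "is_Running (p_lpn A c R \<rho>0 K)"
    and A: "A = map_mat real_of_rat A'" and \<gamma>: "\<gamma> \<in> carrier_vec n" "\<gamma> \<noteq> 0\<^sub>v n"
    and c\<gamma>: "c = (1 / vnorm \<gamma>) \<cdot>\<^sub>v \<gamma>" and \<rho>0: "\<rho>0 = t0 * vnorm \<gamma>"
  shows "K + 1 \<le> 24 * n * encoding_length A' \<gamma>' t0'"
proof -
  define L where "L = encoding_length A' \<gamma>' t0'"
  define m where "m = dim_row A"
  have dims: "dim_row A' = m" "dim_col A' = n" "dim_vec \<gamma>' = n"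
    using A dim_col_A \<gamma>(1) by (auto simp: m_def \<gamma>_def)
  have "n \<noteq> 0"
  proof
    assume "n = 0"
    then show False using c by (simp add: scalar_prod_def)
  qed
  then have n: "1 \<le> n" by simp
  have dim_gen: "dim_vec (gen A' i) = n" for i by (simp add: gen_def dims)
  have gen_eq: "gen A i $ l = real_of_rat (gen A' i $ l)" if "i \<le> m" "l < n" for i l
    using that dims by (cases i) (simp_all add: gen_def A)
  \<comment> \<open>Rows up to \<open>m\<close> of this grid are the generators, including the zero
    generator; row \<open>Suc m\<close> is \<open>\<gamma>\<close>.\<close>
  define S where "S = {..Suc m} \<times> {..<n}"
  define q where "q = (\<lambda>(i, l). if i \<le> m then gen A' i $ l else \<gamma>' $ l)"
  have "(\<Sum>x\<in>S. rat_bits (q x)) = (\<Sum>i\<le>Suc m. \<Sum>l<n. rat_bits (q (i, l)))"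
    by (simp add: S_def sum.cartesian_product)
  also have "\<dots> = (\<Sum>i\<le>m. \<Sum>l<n. rat_bits (q (i, l))) + (\<Sum>l<n. rat_bits (q (Suc m, l)))"
    by simp
  also have "(\<Sum>i\<le>m. \<Sum>l<n. rat_bits (q (i, l))) = (\<Sum>i\<le>m. vec_bits (gen A' i))"
    by (intro sum.cong) (simp_all add: q_def vec_bits_def dim_gen)
  also have "(\<Sum>l<n. rat_bits (q (Suc m, l))) = vec_bits \<gamma>'"
    by (simp add: q_def vec_bits_def dims)
  finally have L: "L = (\<Sum>x\<in>S. rat_bits (q x)) + rat_bits t0'"
    by (simp add: L_def encoding_length_def dims)
  \<comment> \<open>Every coordinate costs at least one bit, and \<open>t0\<close> costs one
    more.\<close>
  have "(m + 2) * n \<le> (\<Sum>x\<in>S. rat_bits (q x))"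
    using sum_bits_ge_card[of S q] by (simp add: S_def card_cartesian_product)
  then have nL: "n + 1 \<le> L"
    using L rat_bits_ge_1[of t0'] by (simp add: algebra_simps)
  have "finite S" "(\<Sum>x\<in>S. rat_bits (q x)) \<le> L" using L by (simp_all add: S_def)
  then obtain D :: real where D: "0 < D" "\<And>x. x \<in> S \<Longrightarrow> D * real_of_rat (q x) \<in> \<int>"
    "\<And>x. x \<in> S \<Longrightarrow> \<bar>D * real_of_rat (q x)\<bar> \<le> 2 ^ L"
    using common_denominator by metis
  have D_gen: "(D \<cdot>\<^sub>v gen A i) $ l \<in> \<int> \<and> \<bar>(D \<cdot>\<^sub>v gen A i) $ l\<bar> \<le> 2 ^ L" if "i \<in> idx A" "l < n" for i l
  proof -
    have "i \<le> m" using that by (simp add: idx_def m_def)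
    then have "(D \<cdot>\<^sub>v gen A i) $ l = D * real_of_rat (q (i, l))" "(i, l) \<in> S"
      using that gen_eq carrier_vecD[OF gen_carrier] by (auto simp: q_def S_def)
    then show ?thesis using D by simp
  qed
  have D_\<gamma>: "(D \<cdot>\<^sub>v \<gamma>) $ l \<in> \<int> \<and> \<bar>(D \<cdot>\<^sub>v \<gamma>) $ l\<bar> \<le> 2 ^ L" if "l < n" for l
  proof -
    have "(D \<cdot>\<^sub>v \<gamma>) $ l = D * real_of_rat (q (Suc m, l))" "(Suc m, l) \<in> S"
      using that dims by (auto simp: q_def S_def \<gamma>_def)
    then show ?thesis using D by simp
  qed
  have n2L: "n \<le> 2 ^ L" using nL less_exp[of L] by linarith
  have carr: "D \<cdot>\<^sub>v gen A i \<in> carrier_vec n" "D \<cdot>\<^sub>v \<gamma> \<in> carrier_vec n" for i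
    using gen_carrier \<gamma> by auto
  have "\<gamma> \<bullet> \<gamma> \<noteq> 0"
    using inner_fseq_of_vec[OF \<gamma>(1) \<gamma>(1)] fseq_of_vec_inject[OF \<gamma>(1), of "0\<^sub>v n"] \<gamma>(2)
    by (metis fseq_of_vec_zero inner_eq_zero_iff zero_carrier_vec)
  moreover have "0 \<le> \<gamma> \<bullet> \<gamma>"
    using inner_fseq_of_vec[OF \<gamma>(1) \<gamma>(1)] inner_ge_zero[of "E \<gamma>"] by simp
  ultimately have \<tau>: "0 < vnorm \<gamma>" by (simp add: vnorm_def)
  have V': "D *\<^sub>R V i = E (D \<cdot>\<^sub>v gen A i)" for i by (simp add: V_def fseq_of_vec_smult)
  have c': "(D * vnorm \<gamma>) *\<^sub>R E c = E (D \<cdot>\<^sub>v \<gamma>)"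
    using \<tau> by (simp add: c\<gamma> fseq_of_vec_smult)
  define P where "P = p_lpn A c R \<rho>0"
  define C where "C = (\<lambda>k. snd (the (cold_wolfe A R (radius P k \<cdot>\<^sub>v c))))"
  have "radius_newton V (idx A) (E c) (radius P) (\<lambda>k. fst (C k)) (\<lambda>k. snd (C k)) K"
    unfolding C_def P_def by (rule p_lpn_radius_newton(1)[OF c R init W K])
  from radius_newton.rescale[OF this D(1) \<tau>]
  have newton: "radius_newton (\<lambda>i. D *\<^sub>R V i) (idx A) (E (D \<cdot>\<^sub>v \<gamma>)) (\<lambda>k. radius P k / vnorm \<gamma>)
      (\<lambda>k. fst (C k)) (\<lambda>k. snd (C k)) K"
    by (simp only: c')
  have ok: "active_ok (C k)" if "k < K" for k
    using p_lpn_radius_newton(2)[OF c R init W K that] by (simp add: C_def P_def)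
  have fin: "finite (fst (C k))" if "k < K" for k
    using active_ok_finite ok[OF that] by (cases "C k") auto
  have indep: "affinely_independent (\<lambda>i. E (D \<cdot>\<^sub>v gen A i)) (fst (C k))" if "k < K" for k
    unfolding affinely_independent_def
  proof (intro allI impI)
    fix \<mu> assume *: "sum \<mu> (fst (C k)) = 0" "lincomb_on (\<lambda>i. E (D \<cdot>\<^sub>v gen A i)) (fst (C k)) \<mu> = 0"
    have "lincomb_on (\<lambda>i. E (D \<cdot>\<^sub>v gen A i)) (fst (C k)) \<mu> = D *\<^sub>R lincomb_on V (fst (C k)) \<mu>"
      by (simp add: lincomb_on_def V'[symmetric] scaleR_sum_right mult.commute)
    then have "lincomb_on V (fst (C k)) \<mu> = 0" using * D(1) by simp
    then show "\<forall>i\<in>fst (C k). \<mu> i = 0"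
      using ok[OF that] * by (cases "C k") (simp add: active_ok_def affinely_independent_def)
  qed
  have card: "card (fst (C k)) \<le> n + 1" if "k < K" for k
    by (rule affinely_independent_card_le[OF indep[OF that] fin[OF that] carr(1)])
  have bounds: "inner (E x) (E y) \<in> \<int> \<and> \<bar>inner (E x) (E y)\<bar> \<le> 2 ^ (3 * L)"
    if "x \<in> carrier_vec n" "\<And>l. l < n \<Longrightarrow> x $ l \<in> \<int> \<and> \<bar>x $ l\<bar> \<le> 2 ^ L"
      "y \<in> carrier_vec n" "\<And>l. l < n \<Longrightarrow> y $ l \<in> \<int> \<and> \<bar>y $ l\<bar> \<le> 2 ^ L" for x y
    unfolding inner_fseq_of_vec[OF that(1,3)]
    using scalar_prod_integral[OF that(1,3) n2L that(2,4)] by blast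
  have int_VV: "inner (D *\<^sub>R V i) (D *\<^sub>R V j) \<in> \<int>" "\<bar>inner (D *\<^sub>R V i) (D *\<^sub>R V j)\<bar> \<le> 2 ^ (3 * L)"
    if "i \<in> idx A" "j \<in> idx A" for i j
    using bounds[OF carr(1) D_gen[OF that(1)] carr(1) D_gen[OF that(2)]] by (simp_all add: V')
  have int_Vc: "inner (D *\<^sub>R V i) (E (D \<cdot>\<^sub>v \<gamma>)) \<in> \<int>" "\<bar>inner (D *\<^sub>R V i) (E (D \<cdot>\<^sub>v \<gamma>))\<bar> \<le> 2 ^ (3 * L)"
    if "i \<in> idx A" for i
    using bounds[OF carr(1) D_gen[OF that] carr(2) D_\<gamma>] by (simp_all add: V')
  have int_cc: "inner (E (D \<cdot>\<^sub>v \<gamma>)) (E (D \<cdot>\<^sub>v \<gamma>)) \<in> \<int>"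
    "\<bar>inner (E (D \<cdot>\<^sub>v \<gamma>)) (E (D \<cdot>\<^sub>v \<gamma>))\<bar> \<le> 2 ^ (3 * L)"
    using bounds[OF carr(2) D_\<gamma> carr(2) D_\<gamma>] by simp_all
  have t0: "0 < t0"
  proof -
    have "c \<bullet> gen A 0 = 0" using c dim_col_A by (simp add: gen_def)
    then have "0 < \<rho>0" using init[rule_format, of 0] by (simp add: idx_def)
    then show ?thesis using \<tau> by (simp add: \<rho>0 zero_less_mult_iff)
  qed
  have t0L: "t0 \<le> 2 ^ L"
  proof -
    have "t0 \<le> 2 ^ rat_bits t0'" unfolding t0_def by (rule rat_le_bits)
    also have "\<dots> \<le> 2 ^ L" using L by (intro power_increasing) auto
    finally show ?thesis .
  qed
  have r0: "radius P 0 / vnorm \<gamma> = t0" using \<tau> by (simp add: radius_def P_def p_lpn_def \<rho>0)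
  have k_le: "k \<le> 21 * n * L" if "Suc k < K" for k
  proof (rule bit_bound_arith[OF _ t0 t0L nL n])
    have "4 ^ k \<le> (radius P 0 / vnorm \<gamma> + 1) * (radius P 0 / vnorm \<gamma>) * 2 ^ (3 * L)
        * (fact (n + 1) * (4 * 2 ^ (3 * L)) ^ (n + 1)) ^ 3"
      by (rule radius_newton.four_power_le[OF newton that fin card indep[folded V'] int_VV(1)
            int_Vc(1) int_cc(1) int_VV(2) int_Vc(2) int_cc(2)]) simp_all
    then show "4 ^ k \<le> (t0 + 1) * t0 * 2 ^ (3 * L)
        * (fact (n + 1) * (4 * 2 ^ (3 * L)) ^ (n + 1)) ^ 3"
      by (simp only: r0)
  qed
  have "1 \<le> n * L" using n nL by simp
  \<comment> \<open>\<open>four_power_le\<close> asks for a further step below \<open>K\<close>, so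
    the last index it covers is \<open>K - 2\<close>. The stopping iteration then makes the count
    \<open>K + 1\<close>, and the surplus 3 is absorbed by \<open>1 \<le> n * L\<close>.\<close>
  have "K \<le> 21 * (n * L) + 2"
  proof (cases "K < 2")
    case False
    then have "K - 2 \<le> 21 * n * L" by (intro k_le) linarith
    then show ?thesis by (simp add: mult.assoc)
  qed simp
  then have "K + 1 \<le> 24 * (n * L)" using \<open>1 \<le> n * L\<close> by linarith
  then show ?thesis by (simp only: L_def mult.assoc)
qed

section \<open>Termination and the final assembly\<close>

lemma (in generators) runs_terminate:
  fixes R W B \<rho>0
  assumes c: "c \<in> carrier_vec n" "c \<bullet> c = 1" and R: "valid_cold_rule A R" and W: "valid_warm_rule A W"
    and init: "\<forall>i\<in>idx A. c \<bullet> gen A i < \<rho>0"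
  defines "P \<equiv> p_lpn A c R \<rho>0" and "CR \<equiv> cr_p_lpn A c R W B \<rho>0"
  obtains K r r' where "is_Running (P K)" "P (Suc K) = Stopped r" "CR (Suc K) = Stopped r'"
    "same_status r r'" "completed P = {..K}" "completed CR = {..K}"
proof -
  note agree = runs_agree[OF c R W init, where B = B, folded P_def CR_def]
  have "\<not> is_Running (P (corral_bound (dim_row A + 1) n))"
    using running_less_corral_bound[OF c R init W] unfolding P_def by blast
  moreover have "is_Running (P 0)" by (simp add: P_def p_lpn_def)
  \<comment> \<open>Contraposed induction: a property that holds at 0 and fails later is lost at
    some step, which is the stopping iteration.\<close>
  ultimately obtain K where K: "is_Running (P K)" "\<not> is_Running (P (Suc K))"
    using nat_induct[of "\<lambda>k. is_Running (P k)"] by blast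
  have down: "is_Running (P k)" if "is_Running (P (Suc k))" for k
    using that by (auto simp: P_def p_lpn_def split: outer.splits)
  have le: "is_Running (P k)" if "k \<le> K" for k
    using that K(1) by (induction rule: inc_induct) (use down in auto)
  have gt: "\<not> is_Running (P k)" if "Suc K \<le> k" for k
    using that K(2) by (induction rule: dec_induct) (use down in auto)
  have run: "is_Running (P k) \<longleftrightarrow> k \<le> K" for k
    using le[of k] gt[of k] by (cases "k \<le> K") (auto simp: not_le Suc_le_eq)
  have CR_run: "is_Running (CR k) \<longleftrightarrow> is_Running (P k)" for k
    using agree[of k] by auto
  have hung: "P k \<noteq> Hung" "CR k \<noteq> Hung" for k
    using agree[of k] by auto
  obtain r r' where "P (Suc K) = Stopped r" "CR (Suc K) = Stopped r'" "same_status r r'"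
    using agree[of "Suc K"] K(2) by auto
  moreover have "completed P = {..K}" "completed CR = {..K}"
    using run hung by (auto simp: completed_def CR_run)
  ultimately show thesis using that K(1) by blast
qed

theorem theorem4:
  shows "\<exists>\<kappa>::real. \<forall>(m::nat) (n::nat) (A::real mat) (c::real vec) (B::nat) (\<rho>0::real)
      (R::cold_rule) (W::warm_rule).
    A \<in> carrier_mat m n \<longrightarrow> c \<in> carrier_vec n \<longrightarrow> vnorm c = 1 \<longrightarrow> B \<ge> 1 \<longrightarrow>
    (\<forall>i\<in>{0..m}. \<rho>0 > c \<bullet> gen A i) \<longrightarrow> valid_cold_rule A R \<longrightarrow> valid_warm_rule A W \<longrightarrow>
    (let P = p_lpn A c R \<rho>0;
         CR = cr_p_lpn A c R W B \<rho>0;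
         N\<^sub>P = card (completed P);
         N\<^sub>C\<^sub>R = card (completed CR)
     in (\<exists>r r'. terminates_with P r \<and> terminates_with CR r' \<and> same_status r r') \<and>
        (\<forall>k. target c (CR k) = target c (P k)) \<and>
        finite (completed P) \<and> finite (completed CR) \<and>
        N\<^sub>C\<^sub>R = N\<^sub>P \<and> N\<^sub>P \<le> corral_bound (m + 1) n \<and>
        (\<forall>(A' :: rat mat) (\<gamma>' :: rat vec) (t0' :: rat).
          let \<gamma> = map_vec real_of_rat \<gamma>'; t0 = real_of_rat t0'
          in A = map_mat real_of_rat A' \<longrightarrow>
             \<gamma> \<in> carrier_vec n \<longrightarrow> \<gamma> \<noteq> 0\<^sub>v n \<longrightarrow> c = (1 / vnorm \<gamma>) \<cdot>\<^sub>v \<gamma> \<longrightarrow>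
             (\<forall>i\<in>{0..m}. t0 > (\<gamma> \<bullet> gen A i) / (vnorm \<gamma>)\<^sup>2) \<longrightarrow>
             \<rho>0 = t0 * vnorm \<gamma> \<longrightarrow>
             real N\<^sub>P \<le> \<kappa> * (real n)\<^sup>2 * real (encoding_length A' \<gamma>' t0')))"
proof (rule exI[of _ 24], intro allI impI, goal_cases)
  case (1 m n A c B \<rho>0 R W)
  interpret generators A n by unfold_locales (use 1 in auto)
  have cc: "c \<bullet> c = 1" using 1(3) by (simp add: vnorm_def)
  have m: "dim_row A = m" using 1 by auto
  have init: "\<forall>i\<in>idx A. c \<bullet> gen A i < \<rho>0" using 1(5) by (simp add: idx_def m)
  define P where "P = p_lpn A c R \<rho>0"
  define CR where "CR = cr_p_lpn A c R W B \<rho>0"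
  obtain K r r' where K: "is_Running (P K)" "P (Suc K) = Stopped r" "CR (Suc K) = Stopped r'"
    "same_status r r'" "completed P = {..K}" "completed CR = {..K}"
    using runs_terminate[OF 1(2) cc 1(6,7) init, where B = B] unfolding P_def CR_def by metis
  have "target c (CR k) = target c (P k)" for k
    using runs_agree[OF 1(2) cc 1(6,7) init, where B = B and k = k]
    by (auto simp: P_def CR_def target_def)
  moreover have "K < corral_bound (m + 1) n"
    using running_less_corral_bound[OF 1(2) cc 1(6) init 1(7)] K(1) by (simp add: P_def m)
  moreover have "real (card (completed P)) \<le> 24 * (real n)\<^sup>2 * real (encoding_length A' \<gamma>' t0')"
    if "A = map_mat real_of_rat A'" "map_vec real_of_rat \<gamma>' \<in> carrier_vec n"
      "map_vec real_of_rat \<gamma>' \<noteq> 0\<^sub>v n"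
      "c = (1 / vnorm (map_vec real_of_rat \<gamma>')) \<cdot>\<^sub>v map_vec real_of_rat \<gamma>'"
      "\<rho>0 = real_of_rat t0' * vnorm (map_vec real_of_rat \<gamma>')" for A' \<gamma>' t0'
  proof -
    have "K + 1 \<le> 24 * n * encoding_length A' \<gamma>' t0'"
      using running_le_encoding_length[OF 1(2) cc 1(6) init 1(7) _ that] K(1) by (simp add: P_def)
    \<comment> \<open>The linear bound is weakened by a factor \<open>n\<close>; for
      \<open>n = 0\<close> both sides vanish.\<close>
    also have "\<dots> \<le> 24 * n * encoding_length A' \<gamma>' t0' * n" by (cases n) simp_all
    finally have "real (K + 1) \<le> real (24 * n * encoding_length A' \<gamma>' t0' * n)"
      by (simp only: of_nat_le_iff)
    then show ?thesis by (simp add: K(5) power2_eq_square mult_ac)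
  qed
  ultimately show ?case
    unfolding Let_def P_def[symmetric] CR_def[symmetric]
    using K by (auto simp: terminates_with_def)
qed

end
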